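(* Let $Q_0\subset\mathbb R^d$ be a cube, $1<p<\infty$, $0<q,r\le\infty$, $k\in\mathbb N$ with $k>d/p$, and $b<-1/r$. Then $$\|f^{\#}_{Q_0}\|_{L_{\infty,r}(\log L)_b(Q_0)}\lesssim\|f\|_{B^{d/p,\,b+1/r}_rL_{p,q}(Q_0);k}.$$ In particular, $$\|f^{\#}_{Q_0}\|_{L_{\infty,r}(\log L)_b(Q_0)}\lesssim\|f\|_{B^{d/p,\,b+1/r}_{p,r}(Q_0);k},$$ and if $\lambda>0$ then $$\|f^{\#}_{Q_0}\|_{\exp L^\lambda(Q_0)}\lesssim\|f\|_{B^{d/p,\,-1/\lambda}_{p,\infty}(Q_0);k}.$$ The inequalities hold for all $f$ in the respective Besov spaces with constants independent of $f$.
   Context: Cubes have sides parallel to the axes; Lebesgue measure $|\cdot|_d$ is used. $f^*(t)=\inf\{\lambda\ge0:|\{|f|>\lambda\}|_d\le t\}$. $f^{\#}_{Q_0}(x)=\sup_{x\in Q\subset Q_0}\frac1{|Q|_d}\int_Q|f-f_Q|$, $f_Q=\frac1{|Q|_d}\int_Qf$. $\|g\|_{L_{\infty,r}(\log L)_b(Q_0)}=\big(\int_0^1((1+|\log t|)^bg^*(t))^r\frac{dt}t\big)^{1/r}$ (supremum if $r=\infty$); $\exp L^\lambda(Q_0)=L_{\infty,\infty}(\log L)_{-1/\lambda}(Q_0)$. $\|f\|_{L_{p,q}(Q_0)}=\big(\int_0^1(t^{1/p}f^*(t))^q\frac{dt}t\big)^{1/q}$ (supremum if $q=\infty$). With $\Delta_hf(x)=f(x+h)-f(x)$,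 $\Delta^k_h=\Delta_h\Delta_h^{k-1}$, $\omega_k(f,t)_{p,q}=\sup_{|h|\le t}\|\Delta_h^kf\|_{L_{p,q}(Q_{kh})}$, where $Q_{kh}=\{x:x,\,x+kh\in Q_0\}$. The inhomogeneous Besov space $B^{s,\xi}_rL_{p,q}(Q_0)$ ($s>0$, $\xi\in\mathbb R$) consists of $f\in L_{p,q}(Q_0)$ with $$\|f\|_{B^{s,\xi}_rL_{p,q}(Q_0);k}=\|f\|_{L_{p,q}(Q_0)}+\Big(\int_0^1\big(t^{-s}(1+|\log t|)^\xi\omega_k(f,t)_{p,q}\big)^r\frac{dt}t\Big)^{1/r}<\infty$$ (usual modification if $r=\infty$), and $B^{s,\xi}_{p,r}(Q_0)=B^{s,\xi}_rL_{p,p}(Q_0)$. $A\lesssim B$ means $A\le CB$ with a constant $C>0$. *)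

theory Defs
  imports "HOL-Analysis.Analysis"
begin

section \<open>Cubes and the sharp maximal function\<close>

definition cube :: "'a::euclidean_space set \<Rightarrow> bool" where
  "cube Q \<longleftrightarrow> (\<exists>a l. 0 < l \<and> Q = cbox a (a + l *\<^sub>R One))"

definition average :: "'a::euclidean_space set \<Rightarrow> ('a \<Rightarrow> 'b::euclidean_space) \<Rightarrow> 'b" where
  "average Q f = (1 / measure lebesgue Q) *\<^sub>R (LINT x:Q|lebesgue. f x)"

definition mean_oscillation :: "'a::euclidean_space set \<Rightarrow> ('a \<Rightarrow> 'b::euclidean_space) \<Rightarrow> ennreal" where
  "mean_oscillation Q f =
     (\<integral>\<^sup>+x\<in>Q. ennreal (norm (f x - average Q f)) \<partial>lebesgue) / emeasure lebesgue Q"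

definition sharp_max ::
    "'a::euclidean_space set \<Rightarrow> ('a \<Rightarrow> 'b::euclidean_space) \<Rightarrow> 'a \<Rightarrow> ennreal" where
  "sharp_max Q0 f x = (SUP Q \<in> {Q. cube Q \<and> x \<in> Q \<and> Q \<subseteq> Q0}. mean_oscillation Q f)"

section \<open>Rearrangements and the function (quasi-)norms\<close>

text \<open>All (quasi-)norms take values in \<^typ>\<open>ennreal\<close>, and they act on nonnegative extended
  functions on the domain \<open>S\<close>, because the sharp maximal function may take the value \<open>\<infinity>\<close>.
  A scalar function \<open>f\<close> enters through its absolute value \<open>\<lambda>x. ennreal (norm (f x))\<close>.\<close>

definition rearrangement :: "'a::euclidean_space set \<Rightarrow> ('a \<Rightarrow> ennreal) \<Rightarrow> real \<Rightarrow> ennreal" where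
  "rearrangement S g t = Inf {l. emeasure lebesgue {x \<in> S. l < g x} \<le> ennreal t}"

text \<open>Real powers on \<^typ>\<open>ennreal\<close>; only used for exponents \<open>a > 0\<close>, where
  \<open>0\<close> and \<open>\<infinity>\<close> are fixed points.\<close>

definition epowr :: "ennreal \<Rightarrow> real \<Rightarrow> ennreal" where
  "epowr x a = (if x = \<infinity> then \<infinity> else ennreal (enn2real x powr a))"

text \<open>The quasi-norm of \<open>L\<^sub>r((0,1), dt/t)\<close> for \<open>0 < r \<le> \<infinity>\<close>.\<close>

definition Lr_dtt :: "ennreal \<Rightarrow> (real \<Rightarrow> ennreal) \<Rightarrow> ennreal" where
  "Lr_dtt r \<phi> =
     (if r = \<infinity> then (SUP t\<in>{0<..<1}. \<phi> t)
      else epowr (\<integral>\<^sup>+t\<in>{0<..<1}. (epowr (\<phi> t) (enn2real r) * ennreal (1 / t)) \<partial>lborel)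
             (1 / enn2real r))"

definition log_weight :: "real \<Rightarrow> real \<Rightarrow> real" where
  "log_weight b t = (1 + \<bar>ln t\<bar>) powr b"

definition log_norm ::
    "'a::euclidean_space set \<Rightarrow> ennreal \<Rightarrow> real \<Rightarrow> ('a \<Rightarrow> ennreal) \<Rightarrow> ennreal" where
  "log_norm S r b g = Lr_dtt r (\<lambda>t. ennreal (log_weight b t) * rearrangement S g t)"

definition exp_norm :: "'a::euclidean_space set \<Rightarrow> real \<Rightarrow> ('a \<Rightarrow> ennreal) \<Rightarrow> ennreal" where
  "exp_norm S lam g = log_norm S \<infinity> (- 1 / lam) g"

definition lorentz_norm ::
    "'a::euclidean_space set \<Rightarrow> real \<Rightarrow> ennreal \<Rightarrow> ('a \<Rightarrow> ennreal) \<Rightarrow> ennreal" where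
  "lorentz_norm S p q g = Lr_dtt q (\<lambda>t. ennreal (t powr (1 / p)) * rearrangement S g t)"

definition lorentz_space ::
    "'a::euclidean_space set \<Rightarrow> real \<Rightarrow> ennreal \<Rightarrow> ('a \<Rightarrow> 'b::euclidean_space) set" where
  "lorentz_space S p q =
     {f \<in> borel_measurable (lebesgue_on S). lorentz_norm S p q (\<lambda>x. ennreal (norm (f x))) < \<infinity>}"

section \<open>Moduli of smoothness and Besov spaces\<close>

definition fdiff :: "'a::euclidean_space \<Rightarrow> ('a \<Rightarrow> 'b::euclidean_space) \<Rightarrow> 'a \<Rightarrow> 'b" where
  "fdiff h f = (\<lambda>x. f (x + h) - f x)"

definition modulus ::
    "'a::euclidean_space set \<Rightarrow> nat \<Rightarrow> real \<Rightarrow> ennreal \<Rightarrow> ('a \<Rightarrow> 'b::euclidean_space) \<Rightarrow> real \<Rightarrow> ennreal"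
  where
  "modulus Q0 k p q f t =
     (SUP h \<in> {h. norm h \<le> t}.
        lorentz_norm {x. x \<in> Q0 \<and> x + real k *\<^sub>R h \<in> Q0} p q
          (\<lambda>x. ennreal (norm ((fdiff h ^^ k) f x))))"

definition besov_norm ::
    "'a::euclidean_space set \<Rightarrow> nat \<Rightarrow> real \<Rightarrow> real \<Rightarrow> ennreal \<Rightarrow> real \<Rightarrow> ennreal
      \<Rightarrow> ('a \<Rightarrow> 'b::euclidean_space) \<Rightarrow> ennreal" where
  "besov_norm Q0 k s \<xi> r p q f =
     lorentz_norm Q0 p q (\<lambda>x. ennreal (norm (f x)))
     + Lr_dtt r (\<lambda>t. ennreal (t powr (- s) * log_weight \<xi> t) * modulus Q0 k p q f t)"

definition besov_space ::
    "'a::euclidean_space set \<Rightarrow> nat \<Rightarrow> real \<Rightarrow> real \<Rightarrow> ennreal \<Rightarrow> real \<Rightarrow> ennreal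
      \<Rightarrow> ('a \<Rightarrow> 'b::euclidean_space) set" where
  "besov_space Q0 k s \<xi> r p q =
     {f \<in> lorentz_space Q0 p q. besov_norm Q0 k s \<xi> r p q f < \<infinity>}"

text \<open>The classical scale \<open>B\<^sup>s\<^sup>,\<^sup>\<xi>\<^sub>p\<^sub>,\<^sub>r\<close> is the case \<open>q = p\<close>.\<close>

definition besov_pr_norm ::
    "'a::euclidean_space set \<Rightarrow> nat \<Rightarrow> real \<Rightarrow> real \<Rightarrow> real \<Rightarrow> ennreal
      \<Rightarrow> ('a \<Rightarrow> 'b::euclidean_space) \<Rightarrow> ennreal" where
  "besov_pr_norm Q0 k s \<xi> p r f = besov_norm Q0 k s \<xi> r p (ennreal p) f"

definition besov_pr_space ::
    "'a::euclidean_space set \<Rightarrow> nat \<Rightarrow> real \<Rightarrow> real \<Rightarrow> real \<Rightarrow> ennreal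
      \<Rightarrow> ('a \<Rightarrow> 'b::euclidean_space) set" where
  "besov_pr_space Q0 k s \<xi> p r = besov_space Q0 k s \<xi> r p (ennreal p)"

end

theory Submission
  imports Defs
begin

text \<open>
  The estimate reduces to
  \<open>(f\<^sup>#)\<^sup>*(t) \<lesssim> \<parallel>f\<parallel> + sup {u\<^bsup>-d/p\<^esup> \<omega>\<^sub>k(f, u) | c t\<^bsup>1/d\<^esup> \<le> u \<le> 1/2}\<close>,
  to which a Hardy inequality for suprema applies. To prove it, let \<open>A\<^sub>s f\<close> be the combination of
  averages of \<open>f\<close> over cubes of side \<open>s, \<dots>, k s\<close> for which \<open>f - A\<^sub>s f\<close> is, up to sign, the average of
  \<open>\<Delta>\<^sub>h\<^sup>k f\<close> over steps \<open>h\<close> of size \<open>s\<close>. Since the operators \<open>A\<^sub>s\<close> commute,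
  \<open>A\<^sub>s f - A\<^bsub>2s\<^esub> f = A\<^sub>s(f - A\<^bsub>2s\<^esub> f) - A\<^bsub>2s\<^esub>(f - A\<^sub>s f)\<close>, and telescoping over dyadic scales bounds
  the oscillation of \<open>A\<^sub>s f\<close> on cubes of side at most \<open>s\<close> by the supremum. The remainder \<open>f - A\<^sub>s f\<close> at the
  scale \<open>s \<approx> t\<^bsup>1/d\<^esup>\<close> is small in \<open>L\<^bsub>p,\<infinity>\<^esub>\<close> and is handled by a Vitali covering. Near the boundary of
  \<open>Q\<^sub>0\<close> the averages are taken over one of \<open>2\<^sup>d\<close> cubes of steps, chosen to point into \<open>Q\<^sub>0\<close>.\<close>

text \<open>The Lorentz quasi-norm enters through one consequence only: the integral of
  \<open>|g|\<close> over any measurable \<open>E\<close> is at most a multiple of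
  \<open>|E| powr (1 - 1/p)\<close>. This form survives averaging over steps by Tonelli, without a
  triangle inequality for the quasi-norm, and the index \<open>q\<close> disappears with it. It also
  yields regularity: moving a cube of side \<open>s\<close> by \<open>l\<close> exchanges a fraction
  of order \<open>l/s\<close> of its volume, so averages at scale \<open>s\<close> are Hoelder
  continuous with exponent \<open>1 - 1/p\<close>, at the price \<open>s powr (- d/p)\<close>. The
  smoothness \<open>d/p\<close> is critical: the remainder at scale \<open>s\<close> has size
  \<open>s powr (d/p)\<close>, which just cancels that price. Size alone therefore gives no decay,
  and the dyadic sum has to converge by the Hoelder factor; this is why the telescoped difference is
  written with averages of remainders rather than with the remainders themselves. The scales stop at
  about \<open>t powr (1/d)\<close> because a set of measure \<open>t\<close> may be discarded, and
  at \<open>1/2\<close> because the Hardy inequality replaces the value at \<open>u\<close> by an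
  integral over \<open>(u, 2u)\<close> inside \<open>(0, 1)\<close>.\<close>

lemma fdiff_funpow:
  fixes f :: "'a::euclidean_space \<Rightarrow> 'b::euclidean_space"
  shows "(fdiff h ^^ k) f x =
    (\<Sum>j\<le>k. ((-1) ^ (k + j) * real (k choose j)) *\<^sub>R f (x + real j *\<^sub>R h))"
proof (induction k arbitrary: x)
  case (Suc k)
  let ?c = "\<lambda>k j. (-1) ^ (k + j) * real (k choose j)"
  let ?F = "\<lambda>j. f (x + real j *\<^sub>R h)"
  have "(fdiff h ^^ Suc k) f x =
      (\<Sum>j\<le>k. ?c k j *\<^sub>R ?F (Suc j)) - (\<Sum>j\<le>k. ?c k j *\<^sub>R ?F j)"
    by (simp add: Suc.IH) (simp add: fdiff_def Suc.IH algebra_simps)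
  also have "(\<Sum>j\<le>k. ?c k j *\<^sub>R ?F j) = (\<Sum>j\<le>Suc k. ?c k j *\<^sub>R ?F j)"
    by simp
  also have "\<dots> = ?c k 0 *\<^sub>R ?F 0 + (\<Sum>j\<le>k. ?c k (Suc j) *\<^sub>R ?F (Suc j))"
    by (rule sum.atMost_Suc_shift)
  also have "(\<Sum>j\<le>k. ?c k j *\<^sub>R ?F (Suc j)) - \<dots> =
      ?c (Suc k) 0 *\<^sub>R ?F 0 + (\<Sum>j\<le>k. ?c (Suc k) (Suc j) *\<^sub>R ?F (Suc j))"
    by (simp add: sum_subtractf [symmetric] sum_negf [symmetric] algebra_simps)
  also have "\<dots> = (\<Sum>j\<le>Suc k. ?c (Suc k) j *\<^sub>R ?F j)"
    by (rule sum.atMost_Suc_shift [symmetric])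
  finally show ?case .
qed simp

section \<open>Weak-type bounds in Lorentz spaces\<close>

lemma epowr_ennreal: "0 \<le> x \<Longrightarrow> epowr (ennreal x) a = ennreal (x powr a)"
  by (simp add: epowr_def)

lemma epowr_mono: assumes "x \<le> y" "0 < a" shows "epowr x a \<le> epowr y a"
  using assms
  by (cases x; cases y)
     (auto simp: epowr_def top_unique infinity_ennreal_def intro!: ennreal_leI powr_mono2)

lemma epowr_epowr: assumes "0 < a" "0 < b" shows "epowr (epowr x a) b = epowr x (a * b)"
  by (cases x) (auto simp: epowr_def infinity_ennreal_def powr_powr)

lemma epowr_1 [simp]: "epowr x 1 = x"
  by (cases x) (auto simp: epowr_def infinity_ennreal_def)

lemma epowr_mult_ennreal:
  assumes "0 < c" "0 < a"
  shows "epowr (ennreal c * x) a = ennreal (c powr a) * epowr x a"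
proof (cases x)
  case (real y)
  then have "ennreal c * x = ennreal (c * y)"
    using assms by (simp add: ennreal_mult')
  then show ?thesis
    using assms real by (simp add: epowr_ennreal powr_mult flip: ennreal_mult')
next
  case top
  then show ?thesis
    using assms by (simp add: epowr_def ennreal_mult_top)
qed

lemma epowr_le_iff:
  assumes "0 < a" shows "epowr x a \<le> y \<longleftrightarrow> x \<le> epowr y (1 / a)"
proof
  assume "epowr x a \<le> y"
  from epowr_mono [OF this, of "1 / a"] assms show "x \<le> epowr y (1 / a)"
    by (simp add: epowr_epowr)
next
  assume "x \<le> epowr y (1 / a)"
  from epowr_mono [OF this assms] assms show "epowr x a \<le> y"
    by (simp add: epowr_epowr)
qed

text \<open>Bounding the sum by twice the maximum treats all exponents \<open>a > 0\<close> alike,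
  below and above 1. The Hardy inequality uses this once with the exponent \<open>r\<close> and once
  with \<open>1/r\<close>.\<close>

lemma epowr_add_le:
  assumes "0 < a" shows "epowr (x + y) a \<le> ennreal (2 powr a) * (epowr x a + epowr y a)"
proof -
  have "x + y \<le> ennreal 2 * max x y"
    by (metis add_mono max.cobounded1 max.cobounded2 mult_2 ennreal_numeral zero_le_numeral)
  then have "epowr (x + y) a \<le> ennreal (2 powr a) * epowr (max x y) a"
    using assms epowr_mono [of "x + y" "ennreal 2 * max x y" a] by (simp add: epowr_mult_ennreal del: ennreal_numeral)
  also have "epowr (max x y) a \<le> epowr x a + epowr y a"
    by (simp add: max_def)
  finally show ?thesis
    by (simp add: mult_left_mono)
qed

lemma rearrangement_antimono: "s \<le> t \<Longrightarrow> rearrangement S g t \<le> rearrangement S g s"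
  unfolding rearrangement_def
  by (rule Inf_superset_mono) (auto intro: order_trans ennreal_leI)

text \<open>The quantity \<open>t powr (1 / p) * g\<^sup>*(t)\<close> is controlled by the part of the integral over \<open>(t/2, t)\<close>,
  because \<open>g\<^sup>*\<close> decreases.\<close>
lemma lorentz_norm_weak_bound:
  assumes "0 < p" "0 < q"
  obtains C where "0 < C"
    "\<And>(S::'a::euclidean_space set) g t. 0 < t \<Longrightarrow> t < 1 \<Longrightarrow>
      ennreal (t powr (1 / p)) * rearrangement S g t \<le> ennreal C * lorentz_norm S p q g"
proof (cases "q = \<infinity>")
  case True
  show ?thesis
  proof (rule that [of 1])
    fix S :: "'a set" and g and t :: real
    assume "0 < t" "t < 1"
    then show "ennreal (t powr (1 / p)) * rearrangement S g t \<le> ennreal 1 * lorentz_norm S p q g"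
      by (auto simp: lorentz_norm_def Lr_dtt_def True intro!: SUP_upper)
  qed simp
next
  case False
  define \<rho> where "\<rho> = enn2real q"
  have \<rho>: "0 < \<rho>"
    using assms False by (cases q) (auto simp: \<rho>_def infinity_ennreal_def)
  \<comment> \<open>The interval \<open>(t/2, t)\<close> has mass 1/2 against the constant
    \<open>1/t\<close>, whence the first factor; the second pays for lowering the weight from
    \<open>t\<close> to \<open>t/2\<close>.\<close>
  define C where "C = 2 powr (1 / \<rho>) * 2 powr (1 / p)"
  show ?thesis
  proof (rule that [of C])
    show "0 < C" by (simp add: C_def)
    fix S :: "'a set" and g and t :: real
    assume t: "0 < t" "t < 1"
    let ?R = "rearrangement S g"
    have "ennreal (1/2) * epowr (ennreal ((t/2) powr (1 / p)) * ?R t) \<rho>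
        = (\<integral>\<^sup>+u\<in>{t/2<..<t}. (epowr (ennreal ((t/2) powr (1 / p)) * ?R t) \<rho> * ennreal (1 / t)) \<partial>lborel)"
    proof -
      have "ennreal (1/2) = ennreal (1 / t) * ennreal (t - t/2)"
        using t by (simp flip: ennreal_mult')
      then show ?thesis
        using t by (subst nn_integral_cmult_indicator) (auto simp: mult_ac)
    qed
    also have "\<dots> \<le> (\<integral>\<^sup>+u\<in>{0<..<1}. (epowr (ennreal (u powr (1 / p)) * ?R u) \<rho> * ennreal (1 / u)) \<partial>lborel)"
    proof (rule nn_integral_mono)
      fix u :: real
      show "epowr (ennreal ((t/2) powr (1 / p)) * ?R t) \<rho> * ennreal (1 / t) * indicator {t/2<..<t} u
        \<le> epowr (ennreal (u powr (1 / p)) * ?R u) \<rho> * ennreal (1 / u) * indicator {0<..<1} u"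
      proof (cases "u \<in> {t/2<..<t}")
        case True
        then have "epowr (ennreal ((t/2) powr (1 / p)) * ?R t) \<rho> * ennreal (1 / t)
          \<le> epowr (ennreal (u powr (1 / p)) * ?R u) \<rho> * ennreal (1 / u)"
          using t \<rho> assms
          by (intro mult_mono epowr_mono ennreal_leI powr_mono2 rearrangement_antimono divide_left_mono) auto
        then show ?thesis using True t by (auto simp: indicator_def)
      qed simp
    qed
    also have "\<dots> = epowr (lorentz_norm S p q g) \<rho>"
      using False \<rho> by (simp add: lorentz_norm_def Lr_dtt_def epowr_epowr flip: \<rho>_def)
    finally have "ennreal 2 * (ennreal (1/2) * epowr (ennreal ((t/2) powr (1 / p)) * ?R t) \<rho>)
        \<le> ennreal 2 * epowr (lorentz_norm S p q g) \<rho>"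
      by (rule mult_left_mono) simp
    then have "epowr (ennreal ((t/2) powr (1 / p)) * ?R t) \<rho> \<le> ennreal 2 * epowr (lorentz_norm S p q g) \<rho>"
      by (simp flip: mult.assoc ennreal_mult' del: ennreal_numeral ennreal_half)
    then have *: "ennreal ((t/2) powr (1 / p)) * ?R t \<le> ennreal (2 powr (1 / \<rho>)) * lorentz_norm S p q g"
      using \<rho> by (simp add: epowr_le_iff epowr_mult_ennreal epowr_epowr del: ennreal_numeral)
    have "ennreal (t powr (1 / p)) * ?R t = ennreal (2 powr (1 / p)) * (ennreal ((t/2) powr (1 / p)) * ?R t)"
      using t by (simp add: powr_divide flip: mult.assoc ennreal_mult')
    also have "\<dots> \<le> ennreal (2 powr (1 / p)) * (ennreal (2 powr (1 / \<rho>)) * lorentz_norm S p q g)"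
      by (intro mult_left_mono *) simp
    also have "\<dots> = ennreal C * lorentz_norm S p q g"
      by (simp add: C_def ennreal_mult' mult_ac)
    finally show "ennreal (t powr (1 / p)) * ?R t \<le> ennreal C * lorentz_norm S p q g" .
  qed
qed

text \<open>A dyadic layer cake: raising the cut-off from \<open>2 ^ N * c\<close> to its double
  adds at most \<open>2 ^ N * c\<close>, and adds nothing unless \<open>y\<close> exceeds that
  height.\<close>

lemma min_pow2_layers:
  fixes y :: ennreal
  shows "min y (2 ^ N * c) \<le> c + (\<Sum>i<N. if 2 ^ i * c < y then 2 ^ i * c else 0)"
proof (induction N)
  case (Suc N)
  show ?case
  proof (cases "2 ^ N * c < y")
    case True
    then have "min y (2 ^ Suc N * c) \<le> min y (2 ^ N * c) + 2 ^ N * c"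
      by (auto simp: mult_2 distrib_right min_def intro: antisym add_increasing)
    then show ?thesis
      using Suc True by (simp add: add.assoc[symmetric]) (meson add_right_mono order_trans)
  next
    case False
    then have "min y (2 ^ Suc N * c) \<le> min y (2 ^ N * c)"
      by (simp add: not_less min_absorb1)
    also have "\<dots> \<le> c + (\<Sum>i<N. if 2 ^ i * c < y then 2 ^ i * c else 0)"
      by (rule Suc)
    finally show ?thesis using False by simp
  qed
qed simp

text \<open>The weak-type bound controls the measure of \<open>{g > l}\<close> by
  \<open>(A / l) powr p\<close>. Summed over the levels \<open>2 ^ i * c\<close>, this gives a
  geometric series with ratio \<open>2 powr (1 - p) < 1\<close>. The norm sees \<open>t < 1\<close>
  only, that is, levels above \<open>A\<close>; the bound \<open>V\<close> on the measure of
  \<open>E\<close> makes up for this.\<close>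

lemma lorentz_norm_integral_bound:
  assumes p: "1 < p" and q: "0 < q" and V: "0 \<le> V"
  obtains K where "0 < K"
    "\<And>(S::'a::euclidean_space set) g M E. (\<And>l. {x \<in> S. l < g x} \<in> sets lebesgue) \<Longrightarrow> (\<And>x. g x < \<infinity>) \<Longrightarrow>
       0 < M \<Longrightarrow> lorentz_norm S p q g \<le> ennreal M \<Longrightarrow> S \<in> sets lebesgue \<Longrightarrow> E \<in> sets lebesgue \<Longrightarrow>
       E \<subseteq> S \<Longrightarrow> emeasure lebesgue E \<le> ennreal V \<Longrightarrow>
       (\<integral>\<^sup>+x\<in>E. g x \<partial>lebesgue) \<le> ennreal (K * M * measure lebesgue E powr (1 - 1 / p))"
proof -
  obtain C where C: "0 < C"
    "\<And>(S::'a set) g t. 0 < t \<Longrightarrow> t < 1 \<Longrightarrow>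
      ennreal (t powr (1 / p)) * rearrangement S g t \<le> ennreal C * lorentz_norm S p q g"
    using lorentz_norm_weak_bound [of p q] p q by auto
  define V1 where "V1 = max 1 V powr (1 / p)"
  have V1: "1 \<le> V1" using p by (auto simp: V1_def intro!: ge_one_powr_ge_zero)
  define K where "K = 2 * C * (2 * V1 + 1 / (1 - 2 powr (1 - p)))"
  have r: "2 powr (1 - p) < 1" using p by (simp add: powr_less_one)
  have "0 < K" using C(1) V1 r by (auto simp: K_def intro!: mult_pos_pos add_pos_pos)
  moreover
  { fix S :: "'a set" and g M E
    assume meas: "\<And>l. {x \<in> S. l < g x} \<in> sets lebesgue" and fin: "\<And>x. g x < \<infinity>" and M: "0 < M" and
      L: "lorentz_norm S p q g \<le> ennreal M" and S [measurable]: "S \<in> sets lebesgue" and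
      E [measurable]: "E \<in> sets lebesgue" and ES: "E \<subseteq> S" and EV: "emeasure lebesgue E \<le> ennreal V"
    \<comment> \<open>The factor 2 brings the rearrangement down to \<open>l / 2\<close>, strictly
      below \<open>l\<close>, so that the infimum defining it supplies an admissible level
      \<open>l' < l\<close>.\<close>
    define A where "A = 2 * C * M"
    have A: "0 < A" using C(1) M by (simp add: A_def)
    have dist: "emeasure lebesgue {x \<in> S. ennreal l < g x} \<le> ennreal ((A / l) powr p)" if l: "A < l" for l
    proof -
      \<comment> \<open>The requirement \<open>t < 1\<close> is exactly
        \<open>A < l\<close>.\<close>
      define t where "t = (A / l) powr p"
      have l0: "0 < l" using A that by simp
      have t: "0 < t" "t < 1" using A that p powr_less_mono2 [of p "A/l" 1] by (auto simp: t_def)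
      have tp: "t powr (1 / p) = A / l"
        using A l0 p by (simp add: t_def powr_powr)
      have "ennreal (A / l) * rearrangement S g t \<le> ennreal C * ennreal M"
        using C(2) [OF t, of S g] mult_left_mono [OF L, of "ennreal C"] tp by (auto intro: order_trans)
      also have "\<dots> = ennreal (A / l) * ennreal (l / 2)"
        using C(1) M l0 by (simp add: A_def flip: ennreal_mult')
      finally have "rearrangement S g t \<le> ennreal (l / 2)"
        using A l0 by (subst (asm) ennreal_mult_le_mult_iff) auto
      also have "\<dots> < ennreal l" using l0 by (simp add: ennreal_lessI)
      finally obtain l' where l': "l' < ennreal l" "emeasure lebesgue {x \<in> S. l' < g x} \<le> ennreal t"
        unfolding rearrangement_def by (auto simp: Inf_less_iff)
      have "emeasure lebesgue {x \<in> S. ennreal l < g x} \<le> emeasure lebesgue {x \<in> S. l' < g x}"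
        using l'(1) meas by (intro emeasure_mono) auto
      with l'(2) show ?thesis by (simp add: t_def)
    qed
    have "(\<integral>\<^sup>+x\<in>E. g x \<partial>lebesgue) \<le> ennreal (K * M * measure lebesgue E powr (1 - 1 / p))"
    proof (cases "emeasure lebesgue E = 0")
      case True
      then have "E \<in> null_sets lebesgue" by (simp add: null_setsI)
      then show ?thesis by (simp add: nn_integral_null_set)
    next
      case False
      define m where "m = measure lebesgue E"
      have Em: "emeasure lebesgue E = ennreal m"
        using EV unfolding m_def by (intro emeasure_eq_ennreal_measure) (auto simp: top_unique)
      have m: "0 < m" "m \<le> V" using False Em EV V by (auto simp: m_def zero_less_measure_iff)
      \<comment> \<open>At height of order \<open>A * m powr (- 1 / p)\<close> the part below the
        cut, \<open>c * m\<close>, and the tail above it both have the desired size. The factor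
        \<open>V1\<close> keeps the lowest level above \<open>A\<close> when
        \<open>m > 1\<close>.\<close>
      define c where "c = 2 * A * V1 * m powr (- 1 / p)"
      have mV: "m powr (1 / p) \<le> V1"
        unfolding V1_def using m p by (intro powr_mono2) auto
      have m1: "1 \<le> V1 * m powr (- 1 / p)"
        using mV m by (simp add: powr_minus field_simps)
      then have c1: "2 * A \<le> c" using A by (simp add: c_def mult.assoc)
      have c0: "0 < c" using c1 A by linarith
      have cA: "A < 2 ^ i * c" for i :: nat
      proof -
        have "c \<le> 2 ^ i * c" using c0 by simp
        with c1 A show ?thesis by linarith
      qed
      define D where "D i = {x \<in> S. ennreal (2 ^ i * c) < g x}" for i :: nat
      have [measurable]: "D i \<in> sets lebesgue" for i using meas by (simp add: D_def)
      have pt: "g x * indicator E x \<le> ennreal c * indicator E x + (\<Sum>i. ennreal (2 ^ i * c) * indicator (D i) x)" for x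
      proof (cases "x \<in> E")
        case True
        obtain y where y: "g x = ennreal y" "0 \<le> y" using fin [of x] by (cases "g x") auto
        obtain N :: nat where N: "y / c < 2 ^ N" using real_arch_pow [of 2 "y / c"] by auto
        have pow: "ennreal (2 ^ i * c) = 2 ^ i * ennreal c" for i :: nat
          using c0 by (simp add: ennreal_mult' flip: ennreal_power)
        have "g x = min (g x) (2 ^ N * ennreal c)"
          unfolding y pow[symmetric] using N c0 by (auto simp: min_def field_simps intro!: ennreal_leI antisym)
        also have "\<dots> \<le> ennreal c + (\<Sum>i<N. if 2 ^ i * ennreal c < g x then 2 ^ i * ennreal c else 0)"
          by (rule min_pow2_layers)
        also have "(\<Sum>i<N. if 2 ^ i * ennreal c < g x then 2 ^ i * ennreal c else 0)
           = (\<Sum>i<N. ennreal (2 ^ i * c) * indicator (D i) x)"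
          using True ES by (intro sum.cong) (auto simp: D_def pow indicator_def)
        also have "\<dots> \<le> (\<Sum>i. ennreal (2 ^ i * c) * indicator (D i) x)"
          by (rule sum_le_suminf) auto
        finally show ?thesis using True by (simp add: add_mono)
      qed simp
      have "(\<integral>\<^sup>+x\<in>E. g x \<partial>lebesgue) \<le>
          (\<integral>\<^sup>+x. ennreal c * indicator E x + (\<Sum>i. ennreal (2 ^ i * c) * indicator (D i) x) \<partial>lebesgue)"
        by (rule nn_integral_mono) (rule pt)
      also have "\<dots> = ennreal c * emeasure lebesgue E + (\<Sum>i. ennreal (2 ^ i * c) * emeasure lebesgue (D i))"
        by (subst nn_integral_add, simp, simp, subst nn_integral_suminf)
           (auto simp: nn_integral_cmult_indicator)
      also have "\<dots> \<le> ennreal c * ennreal m + (\<Sum>i. ennreal (A powr p * c powr (1 - p) * (2 powr (1 - p)) ^ i))"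
      proof (intro add_mono suminf_le)
        fix i :: nat
        have "ennreal (2 ^ i * c) * emeasure lebesgue (D i) \<le> ennreal (2 ^ i * c) * ennreal ((A / (2 ^ i * c)) powr p)"
          unfolding D_def by (intro mult_left_mono dist cA) auto
        also have "\<dots> = ennreal (2 ^ i * c * (A / (2 ^ i * c)) powr p)"
          using c0 by (simp add: ennreal_mult')
        also have "2 ^ i * c * (A / (2 ^ i * c)) powr p = A powr p * c powr (1 - p) * (2 powr (1 - p)) ^ i"
        proof -
          have "2 ^ i * c * (A / (2 ^ i * c)) powr p = A powr p * (2 ^ i * c) powr (1 - p)"
            using A c0 by (simp add: powr_divide powr_diff)
          also have "(2 ^ i * c) powr (1 - p) = c powr (1 - p) * (2 powr (1 - p)) ^ i"
            using c0 by (simp add: powr_mult powr_powr mult.commute flip: powr_realpow)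
          finally show ?thesis by simp
        qed
        finally show "ennreal (2 ^ i * c) * emeasure lebesgue (D i) \<le> \<dots>" .
      qed (auto simp: Em)
      also have "(\<Sum>i. ennreal (A powr p * c powr (1 - p) * (2 powr (1 - p)) ^ i)) =
          ennreal (A powr p * c powr (1 - p) * (1 / (1 - 2 powr (1 - p))))"
        using r by (intro suminf_ennreal_eq sums_mult geometric_sums) auto
      also have "ennreal c * ennreal m + \<dots> = ennreal (c * m + A powr p * c powr (1 - p) * (1 / (1 - 2 powr (1 - p))))"
        using c0 m r by (simp flip: ennreal_mult' ennreal_plus)
      also have "c * m + A powr p * c powr (1 - p) * (1 / (1 - 2 powr (1 - p))) \<le> K * M * m powr (1 - 1 / p)"
      proof -
        have 1: "c * m = 2 * A * V1 * m powr (1 - 1 / p)"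
          using m by (simp add: c_def powr_diff powr_minus field_simps)
        have "A * m powr (- 1 / p) \<le> c"
        proof -
          have "A * 1 \<le> A * (2 * V1)" using A V1 by (intro mult_left_mono) auto
          then have "A * m powr (- 1 / p) \<le> A * (2 * V1) * m powr (- 1 / p)" by (intro mult_right_mono) auto
          then show ?thesis by (simp add: c_def)
        qed
        then have "c powr (1 - p) \<le> (A * m powr (- 1 / p)) powr (1 - p)"
          using A m p by (intro powr_mono2') auto
        also have "\<dots> = A powr (1 - p) * m powr (1 - 1 / p)"
        proof -
          have "- 1 / p * (1 - p) = 1 - 1 / p" using p by (simp add: field_simps)
          then show ?thesis using A by (simp add: powr_mult powr_powr)
        qed
        finally have "A powr p * c powr (1 - p) \<le> A powr p * (A powr (1 - p) * m powr (1 - 1 / p))"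
          by (intro mult_left_mono) auto
        also have "\<dots> = A * m powr (1 - 1 / p)"
          using A by (simp flip: mult.assoc powr_add)
        finally have "A powr p * c powr (1 - p) * (1 / (1 - 2 powr (1 - p))) \<le> A * m powr (1 - 1 / p) * (1 / (1 - 2 powr (1 - p)))"
          using r by (intro mult_right_mono) auto
        with 1 show ?thesis by (simp add: K_def A_def algebra_simps)
      qed
      finally show ?thesis by (simp add: m_def ennreal_leI)
    qed }
  ultimately show ?thesis using that by blast
qed

section \<open>Coverings by cubes\<close>

lemma emeasure_lborel_cube:
  fixes c :: "'a::euclidean_space"
  assumes "0 \<le> l" shows "emeasure lborel (cbox c (c + l *\<^sub>R One)) = ennreal (l ^ DIM('a))"
  using assms by (simp add: emeasure_lborel_cbox_eq inner_simps)

lemma measure_lborel_cube: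
  fixes c :: "'a::euclidean_space"
  assumes "0 \<le> l" shows "measure lborel (cbox c (c + l *\<^sub>R One)) = l ^ DIM('a)"
  using emeasure_lborel_cube [OF assms, of c] assms by (simp add: measure_def)

lemma cball_subset_cube:
  fixes c :: "'a::euclidean_space"
  shows "cball c r \<subseteq> cbox (c - r *\<^sub>R One) ((c - r *\<^sub>R One) + (2 * r) *\<^sub>R One)"
proof
  fix x assume x: "x \<in> cball c r"
  have "\<bar>(x - c) \<bullet> i\<bar> \<le> r" if "i \<in> Basis" for i
    using Basis_le_norm [OF that, of "x - c"] x by (simp add: dist_norm norm_minus_commute)
  then show "x \<in> cbox (c - r *\<^sub>R One) ((c - r *\<^sub>R One) + (2 * r) *\<^sub>R One)"
    by (fastforce simp: mem_box inner_simps abs_le_iff)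
qed

lemma cube_subset_cball:
  fixes c :: "'a::euclidean_space"
  shows "cbox c (c + l *\<^sub>R One) \<subseteq> cball (c + (l / 2) *\<^sub>R One) (real DIM('a) * l / 2)"
proof
  fix x assume x: "x \<in> cbox c (c + l *\<^sub>R One)"
  have "norm (x - (c + (l / 2) *\<^sub>R One)) \<le> (\<Sum>i\<in>(Basis::'a set). \<bar>(x - (c + (l / 2) *\<^sub>R One)) \<bullet> i\<bar>)"
    by (rule norm_le_l1)
  also have "\<dots> \<le> (\<Sum>i\<in>(Basis::'a set). l / 2)"
  proof (rule sum_mono)
    fix i :: 'a assume "i \<in> Basis"
    then have "c \<bullet> i \<le> x \<bullet> i" "x \<bullet> i \<le> c \<bullet> i + l"
      using x by (auto simp: mem_box inner_simps)
    moreover have "(x - (c + (l / 2) *\<^sub>R One)) \<bullet> i = x \<bullet> i - c \<bullet> i - l / 2"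
      using \<open>i \<in> Basis\<close> by (simp add: inner_simps)
    ultimately show "\<bar>(x - (c + (l / 2) *\<^sub>R One)) \<bullet> i\<bar> \<le> l / 2"
      by linarith
  qed
  finally show "x \<in> cball (c + (l / 2) *\<^sub>R One) (real DIM('a) * l / 2)"
    by (simp add: dist_norm norm_minus_commute)
qed

text \<open>Countable subadditivity as an integral against counting measure, which suits the index
  set produced by Vitali's lemma without an enumeration of it.\<close>

lemma emeasure_UN_le_count_space:
  assumes "countable I" and [measurable]: "\<And>i. X i \<in> sets M"
  shows "emeasure M (\<Union>i\<in>I. X i) \<le> (\<integral>\<^sup>+i. emeasure M (X i) \<partial>count_space I)"
proof -
  have [measurable]: "(\<Union>i\<in>I. X i) \<in> sets M"
    using assms by (intro sets.countable_UN') auto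
  have "indicator (\<Union>i\<in>I. X i) x \<le> (\<integral>\<^sup>+i. indicator (X i) x \<partial>count_space I)" for x
  proof (cases "x \<in> (\<Union>i\<in>I. X i)")
    case True
    then obtain i where "i \<in> I" "x \<in> X i" by auto
    then show ?thesis
      using nn_integral_ge_point [of i I "\<lambda>i. indicator (X i) x"] True by simp
  qed simp
  then have "emeasure M (\<Union>i\<in>I. X i) \<le> (\<integral>\<^sup>+x. (\<integral>\<^sup>+i. indicator (X i) x \<partial>count_space I) \<partial>M)"
    by (subst nn_integral_indicator [symmetric], simp) (rule nn_integral_mono)
  also have "\<dots> = (\<integral>\<^sup>+i. (\<integral>\<^sup>+x. indicator (X i) x \<partial>M) \<partial>count_space I)"
    using assms by (intro nn_integral_count_space_nn_integral) auto
  finally show ?thesis by simp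
qed

text \<open>A weak-type bound for a maximal function over a family of cubes: on the disjoint cubes
  selected by Vitali's lemma the two hypotheses on \<open>F\<close> compete, which bounds their total measure.\<close>
lemma cube_family_cover:
  fixes \<K> :: "('a::euclidean_space \<times> real) set" and F :: "'a \<Rightarrow> ennreal"
  defines "cb \<equiv> \<lambda>(c, l). cbox c (c + l *\<^sub>R One)"
  assumes p: "1 < p" and A: "0 < A" and lam: "0 < lam"
    and F [measurable]: "F \<in> borel_measurable borel"
    and side: "\<And>c l. (c, l) \<in> \<K> \<Longrightarrow> 0 < l \<and> l \<le> B"
    and sub: "\<And>K. K \<in> \<K> \<Longrightarrow> cb K \<subseteq> cbox a b"
    and big: "\<And>c l. (c, l) \<in> \<K> \<Longrightarrow> ennreal (lam * l ^ DIM('a)) \<le> (\<integral>\<^sup>+x\<in>cb (c, l). F x \<partial>lborel)"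
    and small: "\<And>E. E \<in> sets borel \<Longrightarrow> E \<subseteq> \<Union>(cb ` \<K>) \<Longrightarrow>
       (\<integral>\<^sup>+x\<in>E. F x \<partial>lborel) \<le> ennreal (A * measure lborel E powr (1 - 1 / p))"
  obtains Z where "Z \<in> sets borel" "\<Union>(cb ` \<K>) \<subseteq> Z"
    "emeasure lborel Z \<le> ennreal ((5 * real DIM('a)) ^ DIM('a) * (A / lam) powr p)"
proof -
  let ?n = "DIM('a)"
  define ctr where "ctr = (\<lambda>(c, l). c + (l / 2) *\<^sub>R (One::'a))"
  define rad where "rad = (\<lambda>(c::'a, l::real). real ?n * l / 2)"
  have sb: "cb K \<subseteq> cball (ctr K) (rad K)" for K
    using cube_subset_cball by (cases K) (auto simp: cb_def ctr_def rad_def)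
  have rd: "0 < rad K \<and> rad K \<le> real ?n * B / 2" if "K \<in> \<K>" for K
    using side that by (cases K) (auto simp: rad_def intro!: mult_left_mono divide_right_mono)
  have "\<Union>(cb ` \<K>) \<subseteq> (\<Union>K\<in>\<K>. cball (ctr K) (rad K))"
    using sb by blast
  then obtain \<C> where \<C>: "countable \<C>" "\<C> \<subseteq> \<K>"
      "pairwise (\<lambda>i j. disjnt (cball (ctr i) (rad i)) (cball (ctr j) (rad j))) \<C>"
      "\<Union>(cb ` \<K>) \<subseteq> (\<Union>i\<in>\<C>. cball (ctr i) (5 * rad i))"
    by (rule Vitali_covering_lemma_cballs [OF _ rd])
  define E where "E = \<Union>(cb ` \<C>)"
  define Z where "Z = (\<Union>i\<in>\<C>. cball (ctr i) (5 * rad i))"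
  have cbm [measurable]: "cb K \<in> sets borel" for K by (cases K) (simp add: cb_def)
  have Em [measurable]: "E \<in> sets borel" unfolding E_def using \<C>(1) by (intro sets.countable_UN') auto
  have Zm: "Z \<in> sets borel" unfolding Z_def using \<C>(1) by (intro sets.countable_UN') auto
  \<comment> \<open>Finiteness permits dividing by a power of the measure of \<open>E\<close> at the
    end.\<close>
  have Efin: "emeasure lborel E < \<infinity>"
  proof -
    have "emeasure lborel E \<le> emeasure lborel (cbox a b)"
      using sub \<C>(2) by (intro emeasure_mono) (auto simp: E_def)
    then show ?thesis using emeasure_lborel_cbox_finite [of a b] by (auto simp: less_top[symmetric] top_unique)
  qed
  define m where "m = measure lborel E"
  have Eeq: "emeasure lborel E = ennreal m"
    unfolding m_def using Efin by (intro emeasure_eq_ennreal_measure) auto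
  have disj: "disjoint_family_on cb \<C>"
    unfolding disjoint_family_on_def
  proof (intro ballI impI)
    fix i j assume "i \<in> \<C>" "j \<in> \<C>" "i \<noteq> j"
    with \<C>(3) have "disjnt (cball (ctr i) (rad i)) (cball (ctr j) (rad j))" by (auto simp: pairwise_def)
    then show "cb i \<inter> cb j = {}" using sb [of i] sb [of j] by (auto simp: disjnt_def)
  qed
  have sumE: "emeasure lborel E = (\<integral>\<^sup>+K. emeasure lborel (cb K) \<partial>count_space \<C>)"
    unfolding E_def using \<C>(1) disj by (intro emeasure_UN_countable) auto
  have "emeasure lborel Z \<le> (\<integral>\<^sup>+K. emeasure lborel (cball (ctr K) (5 * rad K)) \<partial>count_space \<C>)"
    unfolding Z_def using \<C>(1) by (intro emeasure_UN_le_count_space) auto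
  also have "\<dots> \<le> (\<integral>\<^sup>+K. ennreal ((5 * real ?n) ^ ?n) * emeasure lborel (cb K) \<partial>count_space \<C>)"
  proof (rule nn_integral_mono)
    fix K assume "K \<in> space (count_space \<C>)"
    then obtain c l where K: "K = (c, l)" "(c, l) \<in> \<C>" by (cases K) auto
    then have l: "0 < l" using side \<C>(2) by auto
    have "emeasure lborel (cball (ctr K) (5 * rad K)) \<le>
       emeasure lborel (cbox (ctr K - (5 * rad K) *\<^sub>R One)
          ((ctr K - (5 * rad K) *\<^sub>R One) + (2 * (5 * rad K)) *\<^sub>R One))"
      by (intro emeasure_mono cball_subset_cube) auto
    also have "\<dots> = ennreal ((5 * real ?n * l) ^ ?n)"
    proof (subst emeasure_lborel_cube)
      show "0 \<le> 2 * (5 * rad K)" using l by (simp add: rad_def K)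
      \<comment> \<open>The 5 is Vitali's dilation; \<open>real ?n\<close> is the loss from
        enclosing the cube in a ball by the l1 norm and that ball in a cube again.\<close>
      have "2 * (5 * rad K) = 5 * real ?n * l" by (simp add: rad_def K)
      then show "ennreal ((2 * (5 * rad K)) ^ ?n) = ennreal ((5 * real ?n * l) ^ ?n)" by (simp only:)
    qed
    also have "\<dots> = ennreal ((5 * real ?n) ^ ?n) * emeasure lborel (cb K)"
      using l by (simp add: cb_def K emeasure_lborel_cube power_mult_distrib ennreal_mult')
    finally show "emeasure lborel (cball (ctr K) (5 * rad K)) \<le>
       ennreal ((5 * real ?n) ^ ?n) * emeasure lborel (cb K)" .
  qed
  also have "\<dots> = ennreal ((5 * real ?n) ^ ?n) * ennreal m"
    by (simp add: nn_integral_cmult flip: sumE Eeq)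
  finally have Zle: "emeasure lborel Z \<le> ennreal ((5 * real ?n) ^ ?n) * ennreal m" .
  have "ennreal lam * ennreal m = (\<integral>\<^sup>+K. ennreal lam * emeasure lborel (cb K) \<partial>count_space \<C>)"
    by (simp add: nn_integral_cmult flip: sumE Eeq)
  also have "\<dots> \<le> (\<integral>\<^sup>+K. (\<integral>\<^sup>+x\<in>cb K. F x \<partial>lborel) \<partial>count_space \<C>)"
  proof (rule nn_integral_mono)
    fix K assume "K \<in> space (count_space \<C>)"
    then obtain c l where K: "K = (c, l)" "(c, l) \<in> \<K>" using \<C>(2) by (cases K) auto
    then have "0 < l" using side by auto
    then have "ennreal lam * emeasure lborel (cb K) = ennreal (lam * l ^ ?n)"
      using lam by (simp add: K cb_def emeasure_lborel_cube ennreal_mult')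
    then show "ennreal lam * emeasure lborel (cb K) \<le> (\<integral>\<^sup>+x\<in>cb K. F x \<partial>lborel)"
      using big [OF K(2)] K(1) by simp
  qed
  \<comment> \<open>Read as measures with density \<open>F\<close>, the integrals over the disjoint
    selected cubes add up to the integral over \<open>E\<close>.\<close>
  also have "\<dots> = (\<integral>\<^sup>+K. emeasure (density lborel F) (cb K) \<partial>count_space \<C>)"
    by (simp add: emeasure_density)
  also have "\<dots> = emeasure (density lborel F) E"
    unfolding E_def using \<C>(1) disj by (intro emeasure_UN_countable [symmetric]) auto
  also have "\<dots> = (\<integral>\<^sup>+x\<in>E. F x \<partial>lborel)"
    by (simp add: emeasure_density)
  also have "\<dots> \<le> ennreal (A * m powr (1 - 1 / p))"
    unfolding m_def using \<C>(2) by (intro small Em) (auto simp: E_def)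
  finally have "lam * m \<le> A * m powr (1 - 1 / p)"
    using lam A by (simp flip: ennreal_mult' add: m_def)
  have "m \<le> (A / lam) powr p"
  proof (cases "m = 0")
    case False
    then have m: "0 < m" by (simp add: m_def zero_less_measure_iff less_le)
    \<comment> \<open>Cancelling \<open>m powr (1 - 1 / p)\<close> in
      \<open>lam * m \<le> A * m powr (1 - 1 / p)\<close> leaves the weak-type estimate.\<close>
    have "m powr (1 / p) * m powr (1 - 1 / p) = m" using m by (simp flip: powr_add)
    then have "m powr (1 / p) * (m powr (1 - 1 / p) * lam) \<le> A * m powr (1 - 1 / p)"
      using \<open>lam * m \<le> A * m powr (1 - 1 / p)\<close> by (simp only: mult.assoc [symmetric] mult.commute [of lam])
    then have "m powr (1 / p) \<le> A / lam" using m lam by (simp add: field_simps)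
    then have "(m powr (1 / p)) powr p \<le> (A / lam) powr p" using p by (intro powr_mono2) auto
    then show ?thesis using p m by (simp add: powr_powr)
  qed simp
  then have "ennreal ((5 * real ?n) ^ ?n) * ennreal m \<le> ennreal ((5 * real ?n) ^ ?n * (A / lam) powr p)"
    by (simp add: ennreal_mult' ennreal_leI mult_left_mono)
  with Zle have "emeasure lborel Z \<le> ennreal ((5 * real ?n) ^ ?n * (A / lam) powr p)" by (rule order_trans)
  with Zm \<C>(4) show ?thesis using that [of Z] by (simp add: Z_def)
qed

section \<open>Smoothing by averaged differences\<close>

lemma nn_integral_lborel_affine:
  fixes g :: "'a::euclidean_space \<Rightarrow> ennreal"
  assumes [measurable]: "g \<in> borel_measurable borel" and L: "0 < L"
  shows "(\<integral>\<^sup>+u. g (x + L *\<^sub>R u) \<partial>lborel) = ennreal (1 / L ^ DIM('a)) * (\<integral>\<^sup>+z. g z \<partial>lborel)"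
proof -
  have "(\<integral>\<^sup>+z. g z \<partial>lborel) =
      (\<integral>\<^sup>+z. g z \<partial>density (distr lborel borel (\<lambda>u. x + L *\<^sub>R u)) (\<lambda>_. \<bar>L\<bar> ^ DIM('a)))"
    using lborel_affine [of L x] L by simp
  also have "\<dots> = ennreal (L ^ DIM('a)) * (\<integral>\<^sup>+u. g (x + L *\<^sub>R u) \<partial>lborel)"
    using L by (simp add: nn_integral_density nn_integral_distr nn_integral_cmult)
  finally have "ennreal (1 / L ^ DIM('a)) * (\<integral>\<^sup>+z. g z \<partial>lborel) =
      ennreal (1 / L ^ DIM('a)) * ennreal (L ^ DIM('a)) * (\<integral>\<^sup>+u. g (x + L *\<^sub>R u) \<partial>lborel)"
    by (simp add: mult.assoc)
  also have "ennreal (1 / L ^ DIM('a)) * ennreal (L ^ DIM('a)) = 1"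
    using L by (simp flip: ennreal_mult')
  finally show ?thesis by simp
qed

lemma integrable_lborel_affine:
  fixes f :: "'a::euclidean_space \<Rightarrow> 'b::euclidean_space"
  assumes f: "integrable lborel f" and L: "0 < L"
  shows "integrable lborel (\<lambda>u. f (x + L *\<^sub>R u))"
proof -
  have [measurable]: "f \<in> borel_measurable borel" using f by auto
  show ?thesis
    using f nn_integral_lborel_affine [of "\<lambda>x. ennreal (norm (f x))" L x] L
    by (simp add: integrable_iff_bounded ennreal_mult_less_top)
qed

lemma integral_lborel_affine:
  fixes f :: "'a::euclidean_space \<Rightarrow> 'b::euclidean_space"
  assumes f: "integrable lborel f" and L: "0 < L"
  shows "(LINT u|lborel. f (x + L *\<^sub>R u)) = (1 / L ^ DIM('a)) *\<^sub>R (LINT z|lborel. f z)"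
proof -
  have [measurable]: "f \<in> borel_measurable borel" using f by auto
  have "(LINT z|lborel. f z) =
      (LINT z|density (distr lborel borel (\<lambda>u. x + L *\<^sub>R u)) (\<lambda>_. ennreal (L ^ DIM('a))). f z)"
    using lborel_affine [of L x] L by (simp add: ennreal_power)
  also have "\<dots> = L ^ DIM('a) *\<^sub>R (LINT u|lborel. f (x + L *\<^sub>R u))"
    using L by (subst integral_density) (auto simp: integral_distr)
  finally show ?thesis using L by simp
qed

text \<open>The corner \<open>w\<close> of the averaging cube will be chosen so that the cube \<open>w + [0,1]\<^sup>d\<close>
  contains \<open>0\<close> and points into the domain from the region under consideration.\<close>

definition shift_mean ::
    "'a::euclidean_space \<Rightarrow> real \<Rightarrow> ('a \<Rightarrow> 'b::euclidean_space) \<Rightarrow> 'a \<Rightarrow> 'b" where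
  "shift_mean w L f x = (LINT u:cbox w (w + One)|lborel. f (x + L *\<^sub>R u))"

lemma emeasure_unit_cube [simp]: "emeasure lborel (cbox w (w + One)) = 1"
  using emeasure_lborel_cube [of 1 w] by simp

lemma measure_unit_cube [simp]: "measure lborel (cbox w (w + One)) = 1"
  using measure_lborel_cube [of 1 w] by simp

text \<open>Integrating in \<open>x\<close> first leaves the integral of \<open>norm f\<close> for
  each \<open>u\<close>, by translation invariance, and the cube of the \<open>u\<close> has volume
  1.\<close>

lemma shift_mean_integrable_pair:
  fixes f :: "'a::euclidean_space \<Rightarrow> 'b::euclidean_space"
  assumes f: "integrable lborel f"
  shows "integrable (lborel \<Otimes>\<^sub>M lborel)
    (\<lambda>(x, u). indicator (cbox w (w + One)) u *\<^sub>R f (x + L *\<^sub>R u))"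
proof -
  have [measurable]: "f \<in> borel_measurable borel" using f by auto
  let ?g = "\<lambda>(x, u). indicator (cbox w (w + One)) u *\<^sub>R f (x + L *\<^sub>R u)"
  have [measurable]: "?g \<in> borel_measurable (lborel \<Otimes>\<^sub>M lborel)" by measurable
  have "(\<integral>\<^sup>+z. ennreal (norm (?g z)) \<partial>(lborel \<Otimes>\<^sub>M lborel)) =
     (\<integral>\<^sup>+u. (\<integral>\<^sup>+x. ennreal (norm (?g (x, u))) \<partial>lborel) \<partial>lborel)"
    by (rule lborel_pair.nn_integral_snd [symmetric]) measurable
  also have "\<dots> = (\<integral>\<^sup>+u. (\<integral>\<^sup>+x. ennreal (norm (f x)) \<partial>lborel) * indicator (cbox w (w + One)) u \<partial>lborel)"
  proof (rule nn_integral_cong)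
    fix u
    have "(\<integral>\<^sup>+x. ennreal (norm (f (x + L *\<^sub>R u))) \<partial>lborel) = (\<integral>\<^sup>+x. ennreal (norm (f x)) \<partial>lborel)"
      using nn_integral_lborel_affine [of "\<lambda>x. ennreal (norm (f x))" 1 "L *\<^sub>R u"]
      by (simp add: add.commute)
    then show "(\<integral>\<^sup>+x. ennreal (norm (?g (x, u))) \<partial>lborel) =
        (\<integral>\<^sup>+x. ennreal (norm (f x)) \<partial>lborel) * indicator (cbox w (w + One)) u"
      by (auto simp: indicator_def)
  qed
  also have "\<dots> < \<infinity>"
    using f by (simp add: nn_integral_cmult_indicator integrable_iff_bounded)
  finally show ?thesis
    by (intro integrableI_bounded) auto
qed

lemma integrable_shift_mean:
  fixes f :: "'a::euclidean_space \<Rightarrow> 'b::euclidean_space"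
  assumes f: "integrable lborel f"
  shows "integrable lborel (shift_mean w L f)"
  using lborel_pair.integrable_fst' [OF shift_mean_integrable_pair [OF f, of w L]]
  by (simp add: shift_mean_def [abs_def] set_lebesgue_integral_def)

lemma set_integrable_shift:
  fixes f :: "'a::euclidean_space \<Rightarrow> 'b::euclidean_space"
  assumes "integrable lborel f" and "0 < L"
  shows "set_integrable lborel (cbox w (w + One)) (\<lambda>u. f (x + L *\<^sub>R u))"
  using integrable_lborel_affine [OF assms, of x]
  unfolding set_integrable_def by (intro integrable_mult_indicator) auto

lemma shift_mean_0: "shift_mean w 0 f x = f x"
  by (simp add: shift_mean_def set_lebesgue_integral_def)

text \<open>In this form the mean is taken over a box that moves with \<open>x\<close>, so that
  comparing the values at two points becomes comparing two boxes.\<close>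

lemma shift_mean_eq_box:
  fixes f :: "'a::euclidean_space \<Rightarrow> 'b::euclidean_space"
  assumes f: "integrable lborel f" and L: "0 < L"
  shows "shift_mean w L f x = (1 / L ^ DIM('a)) *\<^sub>R
    (LINT z:cbox (x + L *\<^sub>R w) (x + L *\<^sub>R w + L *\<^sub>R One)|lborel. f z)"
proof -
  let ?B = "cbox (x + L *\<^sub>R w) (x + L *\<^sub>R w + L *\<^sub>R One)"
  have "u \<in> cbox w (w + One) \<longleftrightarrow> x + L *\<^sub>R u \<in> ?B" for u
  proof -
    have "w \<bullet> i \<le> u \<bullet> i \<and> u \<bullet> i \<le> w \<bullet> i + 1 \<longleftrightarrow>
        L * (w \<bullet> i) \<le> L * (u \<bullet> i) \<and> L * (u \<bullet> i) \<le> L * (w \<bullet> i) + L" for i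
      using L mult_le_cancel_left_pos [of L "u \<bullet> i" "w \<bullet> i + 1"] by (simp add: distrib_left)
    then show ?thesis
      by (simp add: mem_box inner_simps add.assoc)
  qed
  then have "shift_mean w L f x = (LINT u|lborel. indicator ?B (x + L *\<^sub>R u) *\<^sub>R f (x + L *\<^sub>R u))"
    by (simp add: shift_mean_def set_lebesgue_integral_def indicator_def)
  also have "\<dots> = (1 / L ^ DIM('a)) *\<^sub>R (LINT z|lborel. indicator ?B z *\<^sub>R f z)"
    using f L by (intro integral_lborel_affine integrable_mult_indicator) auto
  finally show ?thesis by (simp add: set_lebesgue_integral_def)
qed

lemma shift_mean_diff:
  assumes "integrable lborel f" "integrable lborel g" and "0 < L"
  shows "shift_mean w L (\<lambda>y. f y - g y) x = shift_mean w L f x - shift_mean w L g x"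
  unfolding shift_mean_def using assms by (intro set_integral_diff set_integrable_shift)

lemma shift_mean_sum:
  assumes "\<And>j. j \<in> J \<Longrightarrow> integrable lborel (f j)" and "0 < L" "finite J"
  shows "shift_mean w L (\<lambda>y. \<Sum>j\<in>J. c j *\<^sub>R f j y) x = (\<Sum>j\<in>J. c j *\<^sub>R shift_mean w L (f j) x)"
proof -
  have "shift_mean w L (\<lambda>y. \<Sum>j\<in>J. c j *\<^sub>R f j y) x =
      (LINT u|lborel. (\<Sum>j\<in>J. c j *\<^sub>R (indicator (cbox w (w + One)) u *\<^sub>R f j (x + L *\<^sub>R u))))"
    by (simp add: shift_mean_def set_lebesgue_integral_def scaleR_sum_right mult.commute)
  also have "\<dots> = (\<Sum>j\<in>J. c j *\<^sub>R (LINT u|lborel. indicator (cbox w (w + One)) u *\<^sub>R f j (x + L *\<^sub>R u)))"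
    using set_integrable_shift [of _ L w x] assms unfolding set_integrable_def
    by (subst Bochner_Integration.integral_sum)
       (auto intro!: integrable_scaleR_right simp del: scaleR_scaleR)
  finally show ?thesis
    by (simp add: shift_mean_def set_lebesgue_integral_def)
qed

text \<open>Both sides are the double average of \<open>f (x + L u + L' v)\<close> over
  \<open>u\<close> and \<open>v\<close> in the same cube; Fubini exchanges the two.\<close>

lemma shift_mean_commute:
  fixes f :: "'a::euclidean_space \<Rightarrow> 'b::euclidean_space"
  assumes f: "integrable lborel f" and L: "0 < L" "0 < L'"
  shows "shift_mean w L (shift_mean w L' f) x = shift_mean w L' (shift_mean w L f) x"
proof -
  let ?I = "indicator (cbox w (w + One)) :: 'a \<Rightarrow> real"
  have [measurable]: "f \<in> borel_measurable borel" using f by auto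
  let ?g = "\<lambda>u v. ?I u *\<^sub>R ?I v *\<^sub>R f (x + L *\<^sub>R u + L' *\<^sub>R v)"
  have [measurable]: "case_prod ?g \<in> borel_measurable (lborel \<Otimes>\<^sub>M lborel)" by measurable
  have "(\<integral>\<^sup>+z. ennreal (norm (case_prod ?g z)) \<partial>(lborel \<Otimes>\<^sub>M lborel)) =
     (\<integral>\<^sup>+u. (\<integral>\<^sup>+v. ennreal (norm (?g u v)) \<partial>lborel) \<partial>lborel)"
    by (subst lborel.nn_integral_fst [symmetric]) auto
  also have "\<dots> \<le> (\<integral>\<^sup>+u. (ennreal (1 / L' ^ DIM('a)) * (\<integral>\<^sup>+x. ennreal (norm (f x)) \<partial>lborel)) *
       indicator (cbox w (w + One)) u \<partial>lborel)"
  proof (rule nn_integral_mono)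
    fix u
    have "(\<integral>\<^sup>+v. ennreal (norm (?g u v)) \<partial>lborel) \<le>
        (\<integral>\<^sup>+v. indicator (cbox w (w + One)) u * ennreal (norm (f ((x + L *\<^sub>R u) + L' *\<^sub>R v))) \<partial>lborel)"
      by (rule nn_integral_mono) (auto simp: indicator_def)
    also have "\<dots> = indicator (cbox w (w + One)) u * (ennreal (1 / L' ^ DIM('a)) * (\<integral>\<^sup>+x. ennreal (norm (f x)) \<partial>lborel))"
      using L by (subst nn_integral_cmult, simp, subst nn_integral_lborel_affine) auto
    finally show "(\<integral>\<^sup>+v. ennreal (norm (?g u v)) \<partial>lborel) \<le>
      (ennreal (1 / L' ^ DIM('a)) * (\<integral>\<^sup>+x. ennreal (norm (f x)) \<partial>lborel)) * indicator (cbox w (w + One)) u"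
      by (simp add: mult.commute)
  qed
  also have "\<dots> < \<infinity>"
    using f by (simp add: nn_integral_cmult_indicator integrable_iff_bounded ennreal_mult_less_top)
  finally have int: "integrable (lborel \<Otimes>\<^sub>M lborel) (case_prod ?g)"
    by (intro integrableI_bounded) auto
  have "shift_mean w L (shift_mean w L' f) x = (LINT u|lborel. LINT v|lborel. ?g u v)"
    by (simp add: shift_mean_def set_lebesgue_integral_def add.assoc del: scaleR_scaleR)
  also have "\<dots> = (LINT v|lborel. LINT u|lborel. ?g u v)"
    by (rule lborel_pair.Fubini_integral [OF int, symmetric])
  also have "\<dots> = (LINT v|lborel. LINT u|lborel. ?I v *\<^sub>R ?I u *\<^sub>R f (x + L' *\<^sub>R v + L *\<^sub>R u))"
    by (simp add: ac_simps)
  also have "\<dots> = shift_mean w L' (shift_mean w L f) x"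
    by (simp add: shift_mean_def set_lebesgue_integral_def add.assoc del: scaleR_scaleR)
  finally show ?thesis .
qed

text \<open>Expanding \<open>\<Delta>\<^sub>h\<^sup>k f(x)\<close> and averaging over the step \<open>h = s u\<close>, all terms except \<open>f(x)\<close>
  are smooth; they form the approximation \<open>smoothing w k s f\<close> of \<open>f\<close> at scale \<open>s\<close>.\<close>

definition smoothing ::
    "'a::euclidean_space \<Rightarrow> nat \<Rightarrow> real \<Rightarrow> ('a \<Rightarrow> 'b::euclidean_space) \<Rightarrow> 'a \<Rightarrow> 'b" where
  "smoothing w k s f x =
    (\<Sum>j\<in>{1..k}. ((-1) ^ (j + 1) * real (k choose j)) *\<^sub>R shift_mean w (real j * s) f x)"

lemma integrable_smoothing:
  "integrable lborel f \<Longrightarrow> integrable lborel (smoothing w k s f)"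
  unfolding smoothing_def [abs_def]
  by (intro Bochner_Integration.integrable_sum integrable_scaleR_right integrable_shift_mean)

lemma smoothing_diff:
  assumes "integrable lborel f" "integrable lborel g" and "0 < s"
  shows "smoothing w k s (\<lambda>y. f y - g y) x = smoothing w k s f x - smoothing w k s g x"
  unfolding smoothing_def sum_subtractf [symmetric]
  using assms by (intro sum.cong) (auto simp: shift_mean_diff scaleR_diff_right)

lemma smoothing_commute:
  assumes f: "integrable lborel f" and "0 < s" "0 < s'"
  shows "smoothing w k s (smoothing w k s' f) x = smoothing w k s' (smoothing w k s f) x"
proof -
  let ?c = "\<lambda>j. (-1) ^ (j + 1) * real (k choose j) :: real"
  have *: "smoothing w k a (smoothing w k b f) x =
      (\<Sum>i\<in>{1..k}. \<Sum>j\<in>{1..k}. (?c i * ?c j) *\<^sub>R shift_mean w (real i * a) (shift_mean w (real j * b) f) x)"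
    if "0 < a" "0 < b" for a b
    unfolding smoothing_def [of w k a]
  proof (rule sum.cong [OF refl])
    fix i assume "i \<in> {1..k}"
    then have "shift_mean w (real i * a) (smoothing w k b f) x =
        (\<Sum>j\<in>{1..k}. ?c j *\<^sub>R shift_mean w (real i * a) (shift_mean w (real j * b) f) x)"
      unfolding smoothing_def [abs_def] using that f
      by (intro shift_mean_sum integrable_shift_mean) auto
    then show "?c i *\<^sub>R shift_mean w (real i * a) (smoothing w k b f) x =
        (\<Sum>j\<in>{1..k}. (?c i * ?c j) *\<^sub>R shift_mean w (real i * a) (shift_mean w (real j * b) f) x)"
      by (simp only: scaleR_sum_right scaleR_scaleR)
  qed
  show ?thesis
    unfolding * [OF assms(2,3)] * [OF assms(3,2)]
    by (subst sum.swap, intro sum.cong refl)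
       (use assms in \<open>auto simp: shift_mean_commute [OF f] mult.commute\<close>)
qed

text \<open>The differences at consecutive scales are thus smooth averages of small remainders.\<close>

lemma smoothing_telescope:
  assumes f: "integrable lborel f" and s: "0 < s" "0 < s'"
  shows "smoothing w k s f x - smoothing w k s' f x =
    smoothing w k s (\<lambda>y. f y - smoothing w k s' f y) x
      - smoothing w k s' (\<lambda>y. f y - smoothing w k s f y) x"
  using smoothing_commute [OF f s, of w k x]
  by (simp add: smoothing_diff f s integrable_smoothing)

text \<open>The term \<open>j = 0\<close> of the averaged expansion is \<open>(-1) ^ k\<close> times
  \<open>f x\<close>, as the cube of steps has volume 1; factoring out this sign turns the other
  terms into \<open>- smoothing w k s f x\<close>.\<close>

lemma smoothing_error:
  fixes f :: "'a::euclidean_space \<Rightarrow> 'b::euclidean_space"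
  assumes f: "integrable lborel f" and s: "0 < s"
  shows "ennreal (norm (f x - smoothing w k s f x)) \<le>
    (\<integral>\<^sup>+u\<in>cbox w (w + One). ennreal (norm ((fdiff (s *\<^sub>R u) ^^ k) f x)) \<partial>lborel)"
proof -
  let ?I = "indicator (cbox w (w + One)) :: 'a \<Rightarrow> real"
  let ?c = "\<lambda>j. (-1) ^ (k + j) * real (k choose j) :: real"
  have int: "integrable lborel (\<lambda>u. ?I u *\<^sub>R f (x + (real j * s) *\<^sub>R u))" for j
  \<comment> \<open>For \<open>j = 0\<close> the integrand is constant in \<open>u\<close> on the
    cube, and the change of variables, which asks for a positive scale, does not cover it.\<close>
  proof (cases "j = 0")
    case True
    have "integrable lborel (\<lambda>u. ?I u *\<^sub>R f x)"
      by (intro integrable_scaleR_left impI) (simp add: integrable_indicator_iff)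
    then show ?thesis using True by simp
  next
    case False
    then show ?thesis
      using set_integrable_shift [OF f, of "real j * s" w x] s by (simp add: set_integrable_def)
  qed
  have eq: "?I u *\<^sub>R (fdiff (s *\<^sub>R u) ^^ k) f x =
      (\<Sum>j\<le>k. ?c j *\<^sub>R (?I u *\<^sub>R f (x + (real j * s) *\<^sub>R u)))" for u
    by (simp add: fdiff_funpow scaleR_sum_right mult.commute)
  have intD: "integrable lborel (\<lambda>u. ?I u *\<^sub>R (fdiff (s *\<^sub>R u) ^^ k) f x)"
    unfolding eq by (intro Bochner_Integration.integrable_sum integrable_scaleR_right int)
  have "(LINT u|lborel. ?I u *\<^sub>R (fdiff (s *\<^sub>R u) ^^ k) f x) =
      (\<Sum>j\<le>k. ?c j *\<^sub>R shift_mean w (real j * s) f x)"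
    unfolding eq by (subst Bochner_Integration.integral_sum)
      (auto intro!: integrable_scaleR_right int simp: shift_mean_def set_lebesgue_integral_def simp del: scaleR_scaleR)
  also have "\<dots> = (-1) ^ k *\<^sub>R (f x - smoothing w k s f x)"
  proof -
    have "{..k} = insert 0 {1..k}" by auto
    then have "(\<Sum>j\<le>k. ?c j *\<^sub>R shift_mean w (real j * s) f x) =
        (-1) ^ k *\<^sub>R f x + (\<Sum>j\<in>{1..k}. ?c j *\<^sub>R shift_mean w (real j * s) f x)"
      by (simp add: shift_mean_0)
    also have "(\<Sum>j\<in>{1..k}. ?c j *\<^sub>R shift_mean w (real j * s) f x) = - ((-1) ^ k *\<^sub>R smoothing w k s f x)"
      by (simp add: smoothing_def scaleR_sum_right power_add mult.assoc sum_negf [symmetric])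
    finally show ?thesis by (simp add: scaleR_diff_right)
  qed
  finally have "norm (f x - smoothing w k s f x) = norm (LINT u|lborel. ?I u *\<^sub>R (fdiff (s *\<^sub>R u) ^^ k) f x)"
    by simp
  also have "ennreal \<dots> \<le> (\<integral>\<^sup>+u. norm (?I u *\<^sub>R (fdiff (s *\<^sub>R u) ^^ k) f x) \<partial>lborel)"
    by (rule integral_norm_bound_ennreal [OF intD])
  also have "\<dots> = (\<integral>\<^sup>+u\<in>cbox w (w + One). ennreal (norm ((fdiff (s *\<^sub>R u) ^^ k) f x)) \<partial>lborel)"
    by (rule nn_integral_cong) (auto simp: indicator_def)
  finally show ?thesis .
qed

section \<open>Oscillation of the smooth part\<close>

text \<open>This is the erosion of \<open>Z\<close> by the cube of steps with corner
  \<open>L w\<close> and side \<open>L\<close>. It marks where an average at scale \<open>L\<close>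
  only looks at \<open>Z\<close>.\<close>

definition shift_region :: "'a::euclidean_space \<Rightarrow> real \<Rightarrow> 'a set \<Rightarrow> 'a set" where
  "shift_region w L Z = {x. \<forall>v \<in> cbox (L *\<^sub>R w) (L *\<^sub>R w + L *\<^sub>R One). x + v \<in> Z}"

text \<open>Equivalently, the unit cube with corner \<open>w\<close> contains the origin, so that
  its dilates increase with the scale.\<close>

definition inward_corner :: "'a::euclidean_space \<Rightarrow> bool" where
  "inward_corner w \<longleftrightarrow> (\<forall>i\<in>Basis. -1 \<le> w \<bullet> i \<and> w \<bullet> i \<le> 0)"

lemma scaled_unit_cube:
  fixes w :: "'a::euclidean_space"
  assumes "0 \<le> L" "u \<in> cbox w (w + One)"
  shows "L *\<^sub>R u \<in> cbox (L *\<^sub>R w) (L *\<^sub>R w + L *\<^sub>R One)"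
proof -
  have "L * (w \<bullet> i) \<le> L * (u \<bullet> i) \<and> L * (u \<bullet> i) \<le> L * (w \<bullet> i) + L" if "i \<in> Basis" for i
  proof -
    have "w \<bullet> i \<le> u \<bullet> i" "u \<bullet> i \<le> w \<bullet> i + 1" using assms(2) that by (auto simp: mem_box inner_simps)
    then have "L * (w \<bullet> i) \<le> L * (u \<bullet> i)" "L * (u \<bullet> i) \<le> L * (w \<bullet> i + 1)"
      using assms(1) by (intro mult_left_mono; simp)+
    then show ?thesis by (simp add: distrib_left)
  qed
  then show ?thesis by (simp add: mem_box inner_simps)
qed

lemma shift_region_add:
  assumes "x \<in> shift_region w (L + L') Z" "v \<in> cbox (L *\<^sub>R w) (L *\<^sub>R w + L *\<^sub>R One)"
  shows "x + v \<in> shift_region w L' Z"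
  unfolding shift_region_def
proof (intro CollectI ballI)
  fix v' assume v': "v' \<in> cbox (L' *\<^sub>R w) (L' *\<^sub>R w + L' *\<^sub>R One)"
  have "v + v' \<in> cbox ((L + L') *\<^sub>R w) ((L + L') *\<^sub>R w + (L + L') *\<^sub>R One)"
    using assms(2) v' by (fastforce simp: mem_box inner_simps algebra_simps)
  then show "x + v + v' \<in> Z"
    using assms(1) by (auto simp: shift_region_def add.assoc)
qed

text \<open>Margins add up: two successive averages at scales \<open>L'\<close> and \<open>L\<close>
  are safe as soon as a single one at scale \<open>L + L'\<close> is. The telescoped differences are
  such double averages.\<close>

lemma shift_region_nested:
  "shift_region w (L + L') Z \<subseteq> shift_region w L (shift_region w L' Z)"
  using shift_region_add by (fastforce simp: shift_region_def [of w L])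

text \<open>Since the cube at \<open>w\<close> contains the origin, the cube of steps at scale
  \<open>L'\<close> lies inside the one at the larger scale \<open>L\<close>.\<close>

lemma shift_region_antimono:
  fixes w :: "'a::euclidean_space"
  assumes w: "inward_corner w" and L: "0 \<le> L'" "L' \<le> L"
  shows "shift_region w L Z \<subseteq> shift_region w L' Z"
proof -
  have "cbox (L' *\<^sub>R w) (L' *\<^sub>R w + L' *\<^sub>R One) \<subseteq> cbox (L *\<^sub>R w) (L *\<^sub>R w + L *\<^sub>R One)"
    unfolding subset_box
  proof (intro disjI1 impI ballI)
    fix i :: 'a assume i: "i \<in> Basis"
    then have "-1 \<le> w \<bullet> i" "w \<bullet> i \<le> 0" using w by (auto simp: inward_corner_def)
    then have "L * (w \<bullet> i) \<le> L' * (w \<bullet> i)" "L' * (w \<bullet> i + 1) \<le> L * (w \<bullet> i + 1)"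
      using L by (auto intro: mult_right_mono mult_right_mono_neg)
    then show "L *\<^sub>R w \<bullet> i \<le> L' *\<^sub>R w \<bullet> i \<and>
        (L' *\<^sub>R w + L' *\<^sub>R One) \<bullet> i \<le> (L *\<^sub>R w + L *\<^sub>R One) \<bullet> i"
      using i by (simp add: inner_simps distrib_left)
  qed
  then show ?thesis by (auto simp: shift_region_def)
qed

lemma shift_region_subset:
  fixes w :: "'a::euclidean_space"
  assumes "inward_corner w" "0 \<le> L"
  shows "shift_region w L Z \<subseteq> Z"
  using shift_region_antimono [OF assms(1), of 0 L Z] assms(2) by (auto simp: shift_region_def)

lemma fdiff_funpow_measurable [measurable]:
  fixes f :: "'a::euclidean_space \<Rightarrow> 'b::euclidean_space"
  assumes [measurable]: "f \<in> borel_measurable borel"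
  shows "(\<lambda>(x, u). (fdiff (s *\<^sub>R u) ^^ k) f x) \<in> borel_measurable (lborel \<Otimes>\<^sub>M lborel)"
  unfolding fdiff_funpow by measurable

text \<open>Tonelli pulls the average over the steps out of the integral over \<open>E\<close>,
  after which the bound for one fixed step applies and the average over a unit cube loses nothing.
  Stating bounds by sets \<open>E\<close> replaces Minkowski's inequality for the
  quasi-norm.\<close>

lemma smoothing_error_integral:
  fixes f :: "'a::euclidean_space \<Rightarrow> 'b::euclidean_space"
  assumes f: "integrable lborel f" and s: "0 < s" and w: "inward_corner w"
    and bound: "\<And>u E. u \<in> cbox w (w + One) \<Longrightarrow> E \<in> sets borel \<Longrightarrow>
      E \<subseteq> {x \<in> Q. x + real k *\<^sub>R (s *\<^sub>R u) \<in> Q} \<Longrightarrow>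
      (\<integral>\<^sup>+x\<in>E. ennreal (norm ((fdiff (s *\<^sub>R u) ^^ k) f x)) \<partial>lborel) \<le>
        ennreal (A * measure lborel E powr \<theta>)"
    and E [measurable]: "E \<in> sets borel" and sub: "E \<subseteq> shift_region w (real k * s) Q"
  shows "(\<integral>\<^sup>+x\<in>E. ennreal (norm (f x - smoothing w k s f x)) \<partial>lborel) \<le>
      ennreal (A * measure lborel E powr \<theta>)"
proof -
  have [measurable]: "f \<in> borel_measurable borel" using f by auto
  let ?D = "\<lambda>u x. ennreal (norm ((fdiff (s *\<^sub>R u) ^^ k) f x))"
  have "(\<integral>\<^sup>+x\<in>E. ennreal (norm (f x - smoothing w k s f x)) \<partial>lborel) \<le>
      (\<integral>\<^sup>+x. (\<integral>\<^sup>+u. ?D u x * indicator (cbox w (w + One)) u * indicator E x \<partial>lborel) \<partial>lborel)"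
  proof (rule nn_integral_mono)
    fix x
    show "ennreal (norm (f x - smoothing w k s f x)) * indicator E x \<le>
       (\<integral>\<^sup>+u. ?D u x * indicator (cbox w (w + One)) u * indicator E x \<partial>lborel)"
      using smoothing_error [OF f s, of x w k] by (cases "x \<in> E") auto
  qed
  also have "\<dots> = (\<integral>\<^sup>+u. (\<integral>\<^sup>+x. ?D u x * indicator (cbox w (w + One)) u * indicator E x \<partial>lborel) \<partial>lborel)"
    by (rule lborel_pair.Fubini' [symmetric]) (simp add: split_beta')
  also have "\<dots> \<le> (\<integral>\<^sup>+u. ennreal (A * measure lborel E powr \<theta>) * indicator (cbox w (w + One)) u \<partial>lborel)"
  proof (rule nn_integral_mono)
    fix u
    show "(\<integral>\<^sup>+x. ?D u x * indicator (cbox w (w + One)) u * indicator E x \<partial>lborel) \<le>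
       ennreal (A * measure lborel E powr \<theta>) * indicator (cbox w (w + One)) u"
    proof (cases "u \<in> cbox w (w + One)")
      case True
      have "E \<subseteq> {x \<in> Q. x + real k *\<^sub>R (s *\<^sub>R u) \<in> Q}"
        using sub shift_region_subset [OF w, of "real k * s" Q] s
          scaled_unit_cube [OF _ True, of "real k * s"] by (auto simp: shift_region_def)
      from bound [OF True E this] True show ?thesis by simp
    qed simp
  qed
  also have "\<dots> = ennreal (A * measure lborel E powr \<theta>)"
    by (simp add: nn_integral_cmult_indicator)
  finally show ?thesis .
qed

lemma norm_set_integral_le:
  fixes f :: "'a::euclidean_space \<Rightarrow> 'b::euclidean_space"
  assumes f: "integrable lborel f" and D: "D \<in> sets borel" and B: "0 \<le> B"
    and le: "(\<integral>\<^sup>+x\<in>D. ennreal (norm (f x)) \<partial>lborel) \<le> ennreal B"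
  shows "norm (LINT x:D|lborel. f x) \<le> B"
proof -
  have "ennreal (norm (LINT x:D|lborel. f x)) \<le> (\<integral>\<^sup>+x. norm (indicator D x *\<^sub>R f x) \<partial>lborel)"
    unfolding set_lebesgue_integral_def
    using f D by (intro integral_norm_bound_ennreal integrable_mult_indicator) auto
  also have "\<dots> = (\<integral>\<^sup>+x\<in>D. ennreal (norm (f x)) \<partial>lborel)"
    by (rule nn_integral_cong) (auto simp: indicator_def)
  finally show ?thesis using le B by (metis ennreal_le_iff order_trans)
qed

text \<open>The cube of side \<open>L - l\<close> at the coordinatewise maximum \<open>z\<close> of
  the two corners lies in both cubes; Bernoulli's inequality bounds its volume from below linearly
  in \<open>l / L\<close>.\<close>

lemma measure_cube_diff_le:
  fixes x y :: "'a::euclidean_space" and L l :: real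
  assumes L: "0 < L" "0 \<le> l" "l \<le> L" and xy: "\<And>i. i \<in> Basis \<Longrightarrow> \<bar>x \<bullet> i - y \<bullet> i\<bar> \<le> l"
  shows "measure lborel (cbox x (x + L *\<^sub>R One) - cbox y (y + L *\<^sub>R One)) \<le> L ^ DIM('a) * (DIM('a) * l / L)"
proof -
  let ?X = "cbox x (x + L *\<^sub>R One)" and ?Y = "cbox y (y + L *\<^sub>R One)"
  define z where "z = (\<Sum>i\<in>Basis. max (x \<bullet> i) (y \<bullet> i) *\<^sub>R i)"
  have z: "z \<bullet> i = max (x \<bullet> i) (y \<bullet> i)" if "i \<in> Basis" for i
    using that by (simp add: z_def)
  have sub: "cbox z (z + (L - l) *\<^sub>R One) \<subseteq> ?X \<inter> ?Y"
    unfolding Int_subset_iff subset_box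
  proof (intro conjI disjI1 impI ballI)
    fix i :: 'a assume i: "i \<in> Basis"
    show "x \<bullet> i \<le> z \<bullet> i" "y \<bullet> i \<le> z \<bullet> i" by (simp_all add: z i)
    show "(z + (L - l) *\<^sub>R One) \<bullet> i \<le> (x + L *\<^sub>R One) \<bullet> i" "(z + (L - l) *\<^sub>R One) \<bullet> i \<le> (y + L *\<^sub>R One) \<bullet> i"
      using xy [OF i] i by (auto simp: inner_simps z)
  qed
  have fin: "?X \<in> fmeasurable lborel" "?X \<inter> ?Y \<in> fmeasurable lborel"
    using emeasure_lborel_cbox_finite by (auto simp: fmeasurable_def Int_interval less_top[symmetric])
  have "(L - l) ^ DIM('a) = measure lborel (cbox z (z + (L - l) *\<^sub>R One))"
    using L by (simp add: measure_lborel_cube)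
  also have "\<dots> \<le> measure lborel (?X \<inter> ?Y)"
    using sub fin by (intro measure_mono_fmeasurable) auto
  finally have "(L - l) ^ DIM('a) \<le> measure lborel (?X \<inter> ?Y)" .
  moreover have "measure lborel (?X - ?Y) = L ^ DIM('a) - measure lborel (?X \<inter> ?Y)"
  proof -
    have "?X - ?Y = ?X - ?X \<inter> ?Y" by auto
    then show ?thesis
      using fin L by (simp add: measurable_measure_Diff measure_lborel_cube)
  qed
  moreover have "L ^ DIM('a) * (1 - DIM('a) * l / L) \<le> (L - l) ^ DIM('a)"
  proof -
    have "1 + real DIM('a) * (- l / L) \<le> (1 + (- l / L)) ^ DIM('a)"
      using L by (intro Bernoulli_inequality) (simp add: field_simps)
    then have "L ^ DIM('a) * (1 - DIM('a) * l / L) \<le> L ^ DIM('a) * (1 - l / L) ^ DIM('a)"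
      using L by (intro mult_left_mono) auto
    also have "\<dots> = (L - l) ^ DIM('a)"
      using L by (simp add: right_diff_distrib flip: power_mult_distrib)
    finally show ?thesis .
  qed
  ultimately show ?thesis by (simp add: right_diff_distrib)
qed

text \<open>The common part of the two boxes cancels. Each of the two leftovers has at most the
  fraction \<open>DIM('a) * l / L\<close> of the volume, and the normalisation
  \<open>1 / L ^ DIM('a)\<close> against the volume to the power \<open>1 - 1 / p\<close> leaves
  \<open>L powr (- (DIM('a) / p))\<close>.\<close>

lemma shift_mean_holder:
  fixes f :: "'a::euclidean_space \<Rightarrow> 'b::euclidean_space"
    and l :: real
  assumes f: "integrable lborel f" and p: "1 < p" and L: "0 < L" "0 \<le> l" "l \<le> L" and A: "0 \<le> A"
    and bound: "\<And>E. E \<in> sets borel \<Longrightarrow> E \<subseteq> Z \<Longrightarrow>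
      (\<integral>\<^sup>+x\<in>E. ennreal (norm (f x)) \<partial>lborel) \<le> ennreal (A * measure lborel E powr (1 - 1 / p))"
    and x: "x \<in> shift_region w L Z" and y: "y \<in> shift_region w L Z"
    and xy: "\<And>i. i \<in> Basis \<Longrightarrow> \<bar>x \<bullet> i - y \<bullet> i\<bar> \<le> l"
  shows "norm (shift_mean w L f x - shift_mean w L f y) \<le>
    2 * A * (DIM('a) * l / L) powr (1 - 1 / p) * L powr (- (DIM('a) / p))"
proof -
  let ?n = "DIM('a)" and ?\<theta> = "1 - 1 / p"
  define bx where "bx x = cbox (x + L *\<^sub>R w) (x + L *\<^sub>R w + L *\<^sub>R One)" for x
  have bxZ: "bx x \<subseteq> Z" if "x \<in> shift_region w L Z" for x
  proof
    fix z assume "z \<in> bx x"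
    then have "z - x \<in> cbox (L *\<^sub>R w) (L *\<^sub>R w + L *\<^sub>R One)"
      by (fastforce simp: bx_def mem_box inner_simps)
    then show "z \<in> Z" using that by (fastforce simp: shift_region_def)
  qed
  have [measurable]: "bx x \<in> sets borel" for x by (simp add: bx_def)
  define R where "R = A * (L ^ ?n * (?n * l / L)) powr ?\<theta>"
  have piece: "norm (LINT z:bx a - bx b|lborel. f z) \<le> R"
    if "a \<in> shift_region w L Z" and ab: "\<And>i. i \<in> Basis \<Longrightarrow> \<bar>a \<bullet> i - b \<bullet> i\<bar> \<le> l" for a b
  proof (rule norm_set_integral_le [OF f])
    have "(\<integral>\<^sup>+z\<in>bx a - bx b. ennreal (norm (f z)) \<partial>lborel) \<le> ennreal (A * measure lborel (bx a - bx b) powr ?\<theta>)"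
      using bxZ [OF that(1)] by (intro bound) auto
    also have "measure lborel (bx a - bx b) \<le> L ^ ?n * (?n * l / L)"
      unfolding bx_def using ab L by (intro measure_cube_diff_le) (auto simp: inner_simps)
    then have "A * measure lborel (bx a - bx b) powr ?\<theta> \<le> R"
      unfolding R_def using A p by (intro mult_left_mono powr_mono2) auto
    finally show "(\<integral>\<^sup>+z\<in>bx a - bx b. ennreal (norm (f z)) \<partial>lborel) \<le> ennreal R"
      by (simp add: ennreal_leI)
    show "0 \<le> R" using A by (simp add: R_def)
  qed auto
  have int: "set_integrable lborel S f" if "S \<in> sets borel" for S
    unfolding set_integrable_def using f that by (intro integrable_mult_indicator) auto
  have split: "(LINT z:bx a|lborel. f z) = (LINT z:bx a - bx b|lborel. f z) + (LINT z:bx a \<inter> bx b|lborel. f z)" for a b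
  proof -
    have "(LINT z:(bx a - bx b) \<union> (bx a \<inter> bx b)|lborel. f z) = (LINT z:bx a - bx b|lborel. f z) + (LINT z:bx a \<inter> bx b|lborel. f z)"
      by (intro set_integral_Un int) auto
    moreover have "(bx a - bx b) \<union> (bx a \<inter> bx b) = bx a" by auto
    ultimately show ?thesis by simp
  qed
  have "(LINT z:bx x|lborel. f z) - (LINT z:bx y|lborel. f z) =
      (LINT z:bx x - bx y|lborel. f z) - (LINT z:bx y - bx x|lborel. f z)"
    using split [of x y] split [of y x] by (simp add: Int_commute)
  also have "norm \<dots> \<le> R + R"
    using piece [OF x xy] piece [of y x] y xy by (intro norm_triangle_le_diff add_mono) (auto simp: abs_minus_commute)
  finally have "norm ((LINT z:bx x|lborel. f z) - (LINT z:bx y|lborel. f z)) \<le> 2 * R" by simp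
  then have "norm (shift_mean w L f x - shift_mean w L f y) \<le> (1 / L ^ ?n) * (2 * R)"
    using L by (simp add: shift_mean_eq_box [OF f] bx_def divide_right_mono flip: scaleR_diff_right)
  also have "\<dots> = 2 * A * (?n * l / L) powr ?\<theta> * ((L powr ?n) powr ?\<theta> / L powr ?n)"
    using L powr_mult [of "L ^ ?n" "?n * l / L" ?\<theta>] by (simp add: R_def powr_realpow)
  also have "(L powr ?n) powr ?\<theta> / L powr ?n = L powr (- (?n / p))"
    by (simp add: powr_powr right_diff_distrib flip: powr_diff)
  finally show ?thesis .
qed

text \<open>The means in \<open>smoothing\<close> have scales \<open>j * s \<ge> s\<close>, for
  which the Hoelder bound only improves; their coefficients add up to at most \<open>2 ^ k\<close>
  in absolute value.\<close>

lemma smoothing_holder: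
  fixes f :: "'a::euclidean_space \<Rightarrow> 'b::euclidean_space"
    and l :: real
  assumes f: "integrable lborel f" and p: "1 < p" and s: "0 < s" "0 \<le> l" "l \<le> s" and A: "0 \<le> A"
    and w: "inward_corner w"
    and bound: "\<And>E. E \<in> sets borel \<Longrightarrow> E \<subseteq> Z \<Longrightarrow>
      (\<integral>\<^sup>+x\<in>E. ennreal (norm (f x)) \<partial>lborel) \<le> ennreal (A * measure lborel E powr (1 - 1 / p))"
    and x: "x \<in> shift_region w (real k * s) Z" and y: "y \<in> shift_region w (real k * s) Z"
    and xy: "\<And>i. i \<in> Basis \<Longrightarrow> \<bar>x \<bullet> i - y \<bullet> i\<bar> \<le> l"
  shows "norm (smoothing w k s f x - smoothing w k s f y) \<le>
    2 ^ Suc k * A * DIM('a) powr (1 - 1 / p) * (l / s) powr (1 - 1 / p) * s powr (- (DIM('a) / p))"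
proof -
  let ?n = "DIM('a)" and ?\<theta> = "1 - 1 / p"
  define R where "R = 2 * A * (?n * l / s) powr ?\<theta> * s powr (- (?n / p))"
  have R0: "0 \<le> R" using A by (simp add: R_def)
  have "norm (smoothing w k s f x - smoothing w k s f y) =
     norm (\<Sum>j\<in>{1..k}. ((-1) ^ (j + 1) * real (k choose j)) *\<^sub>R
       (shift_mean w (real j * s) f x - shift_mean w (real j * s) f y))"
    unfolding smoothing_def sum_subtractf [symmetric] by (simp only: scaleR_diff_right)
  also have "\<dots> \<le> (\<Sum>j\<in>{1..k}. real (k choose j) * R)"
  proof (rule sum_norm_le)
    fix j assume j: "j \<in> {1..k}"
    then have sj: "s \<le> real j * s" "real j * s \<le> real k * s" using s by auto
    have reg: "x \<in> shift_region w (real j * s) Z" "y \<in> shift_region w (real j * s) Z"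
      using shift_region_antimono [OF w _ sj(2), of Z] x y s by auto
    have "norm (shift_mean w (real j * s) f x - shift_mean w (real j * s) f y) \<le>
        2 * A * (?n * l / (real j * s)) powr ?\<theta> * (real j * s) powr (- (?n / p))"
      using s sj by (intro shift_mean_holder [OF f p _ _ order_trans [OF s(3) sj(1)] A bound reg xy]) auto
    also have "\<dots> \<le> R"
      unfolding R_def using s sj A p
      by (intro mult_mono powr_mono2 powr_mono2' divide_left_mono mult_nonneg_nonneg mult_pos_pos) auto
    finally show "norm (((-1) ^ (j + 1) * real (k choose j)) *\<^sub>R
       (shift_mean w (real j * s) f x - shift_mean w (real j * s) f y)) \<le> real (k choose j) * R"
      by (simp add: abs_mult mult_left_mono)
  qed
  also have "\<dots> = (\<Sum>j\<in>{1..k}. real (k choose j)) * R"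
    by (simp add: sum_distrib_right)
  also have "(\<Sum>j\<in>{1..k}. real (k choose j)) \<le> (\<Sum>j\<le>k. real (k choose j))"
    by (intro sum_mono2) auto
  also have "\<dots> = 2 ^ k"
    by (metis choose_row_sum of_nat_numeral of_nat_power of_nat_sum)
  finally have "norm (smoothing w k s f x - smoothing w k s f y) \<le> 2 ^ k * R"
    using R0 by (simp add: mult_right_mono)
  also have "2 ^ k * R = 2 ^ Suc k * A * ?n powr ?\<theta> * (l / s) powr ?\<theta> * s powr (- (?n / p))"
    using s powr_mult [of "real ?n" "l / s" ?\<theta>] by (simp add: R_def)
  finally show ?thesis .
qed

text \<open>Every doubling of the scale costs \<open>(l/s)\<^sup>\<theta>\<close>, with \<open>\<theta> = 1 - 1/p\<close>; these costs form a geometric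
  series, and at the top scale the size of \<open>f\<close> itself suffices.\<close>

lemma smoothing_oscillation:
  assumes p: "1 < p" and S: "0 < S"
  obtains C where "0 < C"
    "\<And>(f :: 'a::euclidean_space \<Rightarrow> 'b::euclidean_space) w A s l Q0 x y.
      integrable lborel f \<Longrightarrow> inward_corner w \<Longrightarrow> 0 \<le> A \<Longrightarrow>
      (\<And>E. E \<in> sets borel \<Longrightarrow> E \<subseteq> Q0 \<Longrightarrow>
        (\<integral>\<^sup>+x\<in>E. ennreal (norm (f x)) \<partial>lborel) \<le> ennreal (A * measure lborel E powr (1 - 1 / p))) \<Longrightarrow>
      (\<And>s' u E. s \<le> s' \<Longrightarrow> s' \<le> S \<Longrightarrow> u \<in> cbox w (w + One) \<Longrightarrow> E \<in> sets borel \<Longrightarrow>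
        E \<subseteq> {x \<in> Q0. x + real k *\<^sub>R (s' *\<^sub>R u) \<in> Q0} \<Longrightarrow>
        (\<integral>\<^sup>+x\<in>E. ennreal (norm ((fdiff (s' *\<^sub>R u) ^^ k) f x)) \<partial>lborel) \<le>
          ennreal (A * s' powr (DIM('a) / p) * measure lborel E powr (1 - 1 / p))) \<Longrightarrow>
      0 < s \<Longrightarrow> s \<le> S \<Longrightarrow> 0 \<le> l \<Longrightarrow> l \<le> s \<Longrightarrow>
      x \<in> shift_region w (2 * real k * S) Q0 \<Longrightarrow> y \<in> shift_region w (2 * real k * S) Q0 \<Longrightarrow>
      (\<And>i. i \<in> Basis \<Longrightarrow> \<bar>x \<bullet> i - y \<bullet> i\<bar> \<le> l) \<Longrightarrow>
      norm (smoothing w k s f x - smoothing w k s f y) \<le> C * A"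
proof -
  let ?n = "DIM('a)"
  define \<theta> where "\<theta> = 1 - 1 / p"
  have \<theta>: "0 < \<theta>" using p by (simp add: \<theta>_def)
  define a where "a = 2 ^ Suc k * real ?n powr \<theta>"
  have a: "0 < a" by (simp add: a_def)
  \<comment> \<open>\<open>C3\<close> is the cost of one doubling, with one summand for each of the
    two telescoped terms, \<open>C4\<close> the cost at the top scale, and \<open>C5\<close> the sum
    of the geometric series with ratio \<open>2 powr (- \<theta>)\<close> and first term
    \<open>C3\<close>.\<close>
  define C3 where "C3 = a * (2 powr (?n / p) + 1)"
  define C4 where "C4 = a * (S / 2) powr (- (?n / p))"
  define C5 where "C5 = C3 / (1 - 2 powr (- \<theta>))"
  have r: "2 powr (- \<theta>) < (1::real)" using \<theta> by (simp add: powr_less_one)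
  have C3: "0 < C3" using a by (simp add: C3_def add_pos_pos)
  have C4: "0 < C4" using a S by (simp add: C4_def)
  have C5: "0 < C5" using C3 r by (simp add: C5_def)
  have C5eq: "C5 * 2 powr (- \<theta>) + C3 = C5"
  proof -
    have "C5 * (1 - 2 powr (- \<theta>)) = C3" using r \<theta> by (simp add: C5_def)
    then show ?thesis by (simp add: right_diff_distrib)
  qed
  show ?thesis
  proof (rule that [of "C4 + C5"])
    show "0 < C4 + C5" using C4 C5 by simp
    fix f :: "'a \<Rightarrow> 'b" and w and A s l :: real and Q0 x y
    assume f: "integrable lborel f" and w: "inward_corner w" and A: "0 \<le> A"
      and H1: "\<And>E. E \<in> sets borel \<Longrightarrow> E \<subseteq> Q0 \<Longrightarrow>
        (\<integral>\<^sup>+x\<in>E. ennreal (norm (f x)) \<partial>lborel) \<le> ennreal (A * measure lborel E powr (1 - 1 / p))"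
      and H2: "\<And>s' u E. s \<le> s' \<Longrightarrow> s' \<le> S \<Longrightarrow> u \<in> cbox w (w + One) \<Longrightarrow> E \<in> sets borel \<Longrightarrow>
        E \<subseteq> {x \<in> Q0. x + real k *\<^sub>R (s' *\<^sub>R u) \<in> Q0} \<Longrightarrow>
        (\<integral>\<^sup>+x\<in>E. ennreal (norm ((fdiff (s' *\<^sub>R u) ^^ k) f x)) \<partial>lborel) \<le>
          ennreal (A * s' powr (?n / p) * measure lborel E powr (1 - 1 / p))"
      and s: "0 < s" "s \<le> S" and l: "0 \<le> l" "l \<le> s"
      and x: "x \<in> shift_region w (2 * real k * S) Q0" and y: "y \<in> shift_region w (2 * real k * S) Q0"
      and xy: "\<And>i. i \<in> Basis \<Longrightarrow> \<bar>x \<bullet> i - y \<bullet> i\<bar> \<le> l"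
    have reg: "x \<in> shift_region w L (shift_region w L' Q0)" "y \<in> shift_region w L (shift_region w L' Q0)"
      if "0 \<le> L" "0 \<le> L'" "L + L' \<le> 2 * real k * S" for L L'
      using shift_region_antimono [OF w _ that(3), of Q0] that x y shift_region_nested [of w L L' Q0] by auto
    have rem: "(\<integral>\<^sup>+x\<in>E. ennreal (norm (f x - smoothing w k s' f x)) \<partial>lborel) \<le>
        ennreal (A * s' powr (?n / p) * measure lborel E powr (1 - 1 / p))"
      if "s \<le> s'" "s' \<le> S" "E \<in> sets borel" "E \<subseteq> shift_region w (real k * s') Q0" for s' E
      using s that by (intro smoothing_error_integral [where Q = Q0] f w H2) auto
    have base: "norm (smoothing w k s' f x - smoothing w k s' f y) \<le> A * (C4 + C5 * (l / s') powr \<theta>)"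
      if s': "s \<le> s'" "s' \<le> S" "S < 2 * s'" for s'
    proof -
      have "norm (smoothing w k s' f x - smoothing w k s' f y) \<le>
        2 ^ Suc k * A * ?n powr (1 - 1 / p) * (l / s') powr (1 - 1 / p) * s' powr (- (?n / p))"
      proof (rule smoothing_holder [OF f p _ _ _ A w H1])
        have "x \<in> shift_region w (real k * s') (shift_region w 0 Q0)" "y \<in> shift_region w (real k * s') (shift_region w 0 Q0)"
          using s s' mult_mono [of "real k" "2 * real k" s' S] by (auto intro!: reg)
        then show "x \<in> shift_region w (real k * s') Q0" "y \<in> shift_region w (real k * s') Q0"
          by (auto simp: shift_region_def)
      qed (use s s' l xy in auto)
      also have "\<dots> = a * A * (l / s') powr \<theta> * s' powr (- (?n / p))"
        by (simp add: a_def \<theta>_def)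
      also have "\<dots> \<le> a * A * 1 * (S / 2) powr (- (?n / p))"
      proof (intro mult_mono)
        have "(l / s') powr \<theta> \<le> 1 powr \<theta>"
          using s s' l \<theta> by (intro powr_mono2) (auto simp: field_simps)
        then show "(l / s') powr \<theta> \<le> 1" by simp
        show "s' powr (- (?n / p)) \<le> (S / 2) powr (- (?n / p))"
          using S s' p by (intro powr_mono2') auto
      qed (use a A in auto)
      also have "\<dots> \<le> A * (C4 + C5 * (l / s') powr \<theta>)"
        using A C5 by (simp add: C4_def algebra_simps)
      finally show ?thesis .
    qed
    \<comment> \<open>Induction on the number of doublings that lead from \<open>s'\<close> to the
      top. The factor \<open>(l / s') powr \<theta>\<close> is carried along because it shrinks by
      \<open>2 powr (- \<theta>)\<close> when the scale doubles; \<open>C5eq\<close> says that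
      adding \<open>C3\<close> restores \<open>C5\<close>.\<close>
    have main: "norm (smoothing w k s' f x - smoothing w k s' f y) \<le> A * (C4 + C5 * (l / s') powr \<theta>)"
      if "s \<le> s'" "s' \<le> S" "S < 2 ^ Suc m * s'" for s' m
      using that
    proof (induction m arbitrary: s')
      case 0
      then show ?case using base by simp
    next
      case (Suc m)
      show ?case
      proof (cases "S < 2 * s'")
        case True
        then show ?thesis using base Suc.prems by simp
      next
        case False
        then have s2: "2 * s' \<le> S" "0 < s'" using Suc.prems s by auto
        let ?G = "\<lambda>z. f z - smoothing w k (2 * s') f z" and ?H = "\<lambda>z. f z - smoothing w k s' f z"
        let ?q = "(l / s') powr \<theta>"
        \<comment> \<open>An average at scale \<open>s'\<close> of a remainder at scale
          \<open>2 * s'\<close>, or vice versa, reaches as far as a single one at scale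
          \<open>3 * k * s'\<close>; the fixed margin \<open>2 * k * S\<close> covers all these
          pairs.\<close>
        have ks: "real k * s' + real k * (2 * s') \<le> 2 * real k * S"
          using s2 mult_left_mono [of "3 * s'" "2 * S" "real k"] by (simp add: algebra_simps)
        have G: "norm (smoothing w k s' ?G x - smoothing w k s' ?G y) \<le>
          2 ^ Suc k * (A * (2 * s') powr (?n / p)) * ?n powr (1 - 1 / p) * (l / s') powr (1 - 1 / p) * s' powr (- (?n / p))"
          using ks s2 s l A Suc.prems(1)
          by (intro smoothing_holder [where Z = "shift_region w (real k * (2 * s')) Q0"] rem reg xy p w
                Bochner_Integration.integrable_diff f integrable_smoothing) auto
        have H: "norm (smoothing w k (2 * s') ?H x - smoothing w k (2 * s') ?H y) \<le>
          2 ^ Suc k * (A * s' powr (?n / p)) * ?n powr (1 - 1 / p) * (l / (2 * s')) powr (1 - 1 / p) * (2 * s') powr (- (?n / p))"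
          using ks s2 s l A Suc.prems(1)
          by (intro smoothing_holder [where Z = "shift_region w (real k * s') Q0"] rem reg xy p w
                Bochner_Integration.integrable_diff f integrable_smoothing) auto
        have G': "norm (smoothing w k s' ?G x - smoothing w k s' ?G y) \<le> a * 2 powr (?n / p) * A * ?q"
        proof -
          have "2 ^ Suc k * (A * (2 * s') powr (?n / p)) * ?n powr (1 - 1 / p) * (l / s') powr (1 - 1 / p) * s' powr (- (?n / p))
             = a * A * ?q * ((2 * s') powr (?n / p) * s' powr (- (?n / p)))"
            by (simp add: a_def \<theta>_def mult_ac)
          \<comment> \<open>The critical cancellation: the size of the remainder and the price of
            the average differ by a constant that does not depend on the scale.\<close>
          also have "(2 * s') powr (?n / p) * s' powr (- (?n / p)) = 2 powr (?n / p)"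
            using s2 by (simp add: powr_mult powr_minus field_simps)
          also have "a * A * ?q * 2 powr (?n / p) = a * 2 powr (?n / p) * A * ?q"
            by (simp only: mult_ac)
          finally show ?thesis by (rule ord_le_eq_trans [OF G])
        qed
        have H': "norm (smoothing w k (2 * s') ?H x - smoothing w k (2 * s') ?H y) \<le> a * A * ?q"
        proof -
          have "2 ^ Suc k * (A * s' powr (?n / p)) * ?n powr (1 - 1 / p) * (l / (2 * s')) powr (1 - 1 / p) * (2 * s') powr (- (?n / p))
             = a * A * (l / (2 * s')) powr \<theta> * (s' powr (?n / p) * (2 * s') powr (- (?n / p)))"
            by (simp add: a_def \<theta>_def mult_ac)
          also have "\<dots> \<le> a * A * ?q * (s' powr (?n / p) * s' powr (- (?n / p)))"
            using a A s2 l \<theta> p by (intro mult_mono powr_mono2 powr_mono2' divide_left_mono mult_nonneg_nonneg) auto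
          also have "s' powr (?n / p) * s' powr (- (?n / p)) = 1"
            using s2 by (simp flip: powr_add)
          finally show ?thesis using H by simp
        qed
        have IH: "norm (smoothing w k (2 * s') f x - smoothing w k (2 * s') f y) \<le> A * (C4 + C5 * (l / (2 * s')) powr \<theta>)"
          using Suc.prems s2 by (intro Suc.IH) auto
        have half: "(l / (2 * s')) powr \<theta> = 2 powr (- \<theta>) * ?q"
          using powr_mult [of "1/2" "l / s'" \<theta>] l s2 by (simp add: powr_minus powr_divide field_simps)
        have tel: "smoothing w k s' f z = smoothing w k (2 * s') f z + (smoothing w k s' ?G z - smoothing w k (2 * s') ?H z)" for z
          using smoothing_telescope [OF f, of s' "2 * s'" w k z] s2 by (simp add: algebra_simps)
        have "smoothing w k s' f x - smoothing w k s' f y =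
            (smoothing w k (2 * s') f x - smoothing w k (2 * s') f y)
            + ((smoothing w k s' ?G x - smoothing w k s' ?G y)
               - (smoothing w k (2 * s') ?H x - smoothing w k (2 * s') ?H y))"
          by (simp only: tel [of x] tel [of y]) simp
        also have "norm \<dots> \<le> A * (C4 + C5 * (2 powr (- \<theta>) * ?q)) + (a * 2 powr (?n / p) * A * ?q + a * A * ?q)"
          by (rule norm_triangle_mono [OF IH [unfolded half]
                order_trans [OF norm_triangle_ineq4 add_mono [OF G' H']]])
        also have "\<dots> = A * (C4 + (C5 * 2 powr (- \<theta>) + C3) * ?q)"
          by (simp add: C3_def algebra_simps)
        finally show ?thesis unfolding C5eq .
      qed
    qed
    obtain m :: nat where "S / s < 2 ^ m" using real_arch_pow [of 2 "S / s"] by auto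
    then have "S < 2 ^ Suc m * s" using s by (simp add: field_simps)
    then have "norm (smoothing w k s f x - smoothing w k s f y) \<le> A * (C4 + C5 * (l / s) powr \<theta>)"
      using s by (intro main) auto
    also have "\<dots> \<le> A * (C4 + C5 * 1 powr \<theta>)"
      using A C5 \<theta> s l by (intro mult_left_mono add_left_mono powr_mono2) auto
    finally show "norm (smoothing w k s f x - smoothing w k s f y) \<le> (C4 + C5) * A"
      by (simp add: mult.commute)
  qed
qed

section \<open>Rearrangement of the sharp maximal function\<close>

text \<open>The average differs from any constant \<open>v\<close> by at most the mean of
  \<open>norm (f x - v)\<close>, so testing with a convenient \<open>v\<close> costs a factor
  2.\<close>

lemma mean_oscillation_le:
  fixes f :: "'a::euclidean_space \<Rightarrow> 'b::euclidean_space"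
  assumes f: "integrable lborel f" and l: "0 < l" and B: "0 \<le> B"
    and le: "(\<integral>\<^sup>+x\<in>cbox c (c + l *\<^sub>R One). ennreal (norm (f x - v)) \<partial>lborel) \<le> ennreal (B * l ^ DIM('a))"
  shows "mean_oscillation (cbox c (c + l *\<^sub>R One)) f \<le> ennreal (2 * B)"
proof -
  let ?Q = "cbox c (c + l *\<^sub>R One)"
  have [measurable]: "f \<in> borel_measurable borel" using f by auto
  have lQ: "measure lborel ?Q = l ^ DIM('a)" "emeasure lborel ?Q = ennreal (l ^ DIM('a))"
    using l by (auto simp: measure_lborel_cube emeasure_lborel_cube)
  define m where "m = average ?Q f"
  have m: "m = (1 / l ^ DIM('a)) *\<^sub>R (LINT x:?Q|lborel. f x)"
    unfolding m_def average_def set_lebesgue_integral_def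
    using lQ by (subst integral_completion) auto
  have int: "set_integrable lborel ?Q f" "set_integrable lborel ?Q (\<lambda>x. v)"
    using f by (auto simp: set_integrable_def lQ intro!: integrable_mult_indicator integrable_scaleR_left)
  have intd: "integrable lborel (\<lambda>x. indicator ?Q x *\<^sub>R (f x - v))"
    using set_integral_diff(1) [OF int] by (simp add: set_integrable_def)
  have "(LINT x:?Q|lborel. v) = l ^ DIM('a) *\<^sub>R v"
    using lQ by (simp add: set_lebesgue_integral_def)
  then have "m - v = (1 / l ^ DIM('a)) *\<^sub>R (LINT x:?Q|lborel. f x - v)"
    using l by (simp add: m set_integral_diff(2) [OF int] scaleR_diff_right)
  moreover have "norm (LINT x:?Q|lborel. f x - v) \<le> B * l ^ DIM('a)"
  proof -
    have "ennreal (norm (LINT x:?Q|lborel. f x - v)) \<le> (\<integral>\<^sup>+x. norm (indicator ?Q x *\<^sub>R (f x - v)) \<partial>lborel)"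
      unfolding set_lebesgue_integral_def by (rule integral_norm_bound_ennreal [OF intd])
    also have "\<dots> = (\<integral>\<^sup>+x\<in>?Q. ennreal (norm (f x - v)) \<partial>lborel)"
      by (rule nn_integral_cong) (auto simp: indicator_def)
    also note le
    finally show ?thesis using B l by (subst (asm) ennreal_le_iff) auto
  qed
  ultimately have mv: "norm (m - v) \<le> B"
    using l by (simp add: field_simps)
  have "(\<integral>\<^sup>+x\<in>?Q. ennreal (norm (f x - m)) \<partial>lborel) \<le>
      (\<integral>\<^sup>+x. ennreal (norm (f x - v)) * indicator ?Q x + ennreal B * indicator ?Q x \<partial>lborel)"
  proof (rule nn_integral_mono)
    fix x
    have "norm (f x - m) \<le> norm (f x - v) + B"
      using mv norm_triangle_ineq4 [of "f x - v" "m - v"] by simp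
    then have "ennreal (norm (f x - m)) \<le> ennreal (norm (f x - v)) + ennreal B"
      using B by (simp add: ennreal_leI flip: ennreal_plus)
    then show "ennreal (norm (f x - m)) * indicator ?Q x \<le>
        ennreal (norm (f x - v)) * indicator ?Q x + ennreal B * indicator ?Q x"
      by (auto simp: indicator_def)
  qed
  also have "\<dots> = (\<integral>\<^sup>+x\<in>?Q. ennreal (norm (f x - v)) \<partial>lborel) + ennreal B * ennreal (l ^ DIM('a))"
    by (subst nn_integral_add) (auto simp: nn_integral_cmult_indicator lQ)
  also have "\<dots> \<le> ennreal (B * l ^ DIM('a)) + ennreal B * ennreal (l ^ DIM('a))"
    using le by (rule add_right_mono)
  also have "\<dots> = ennreal (2 * B) * ennreal (l ^ DIM('a))"
    using B l by (simp flip: ennreal_mult' ennreal_plus)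
  finally have "(\<integral>\<^sup>+x\<in>?Q. ennreal (norm (f x - m)) \<partial>lborel) / ennreal (l ^ DIM('a)) \<le>
      ennreal (2 * B) * ennreal (l ^ DIM('a)) / ennreal (l ^ DIM('a))"
    by (rule divide_right_mono_ennreal)
  also have "\<dots> = ennreal (2 * B)"
    using l by (simp add: ennreal_mult_divide_eq)
  finally show ?thesis
    using lQ by (simp add: mean_oscillation_def nn_integral_completion flip: m_def)
qed

text \<open>In each coordinate one side of the small cube has room for a step of length
  \<open>l0 / 4\<close>. If the lower end lies beyond the middle, the corner coordinate is
  \<open>-1\<close> and steps go down, otherwise it is 0 and they go up. There being finitely many
  corners, each can later be given its own exceptional set.\<close>

lemma finite_inward_corners:
  obtains W :: "'a::euclidean_space set"
  where "finite W" "card W \<le> 2 ^ DIM('a)" "\<And>w. w \<in> W \<Longrightarrow> inward_corner w"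
    "\<And>a l0 c l L. 0 < l \<Longrightarrow> l \<le> l0 / 4 \<Longrightarrow> L \<le> l0 / 4 \<Longrightarrow>
       cbox c (c + l *\<^sub>R One) \<subseteq> cbox a (a + l0 *\<^sub>R One) \<Longrightarrow>
       \<exists>w\<in>W. cbox c (c + l *\<^sub>R One) \<subseteq> shift_region w L (cbox a (a + l0 *\<^sub>R One))"
proof -
  define cor where "cor J = - (\<Sum>i\<in>J. i)" for J :: "'a set"
  have cor: "cor J \<bullet> i = (if i \<in> J then -1 else 0)" if "i \<in> Basis" "J \<subseteq> Basis" for i J
  proof -
    have "(\<Sum>j\<in>J. j) \<bullet> i = (\<Sum>j\<in>J. if j = i then 1 else 0)"
      unfolding inner_sum_left using that by (intro sum.cong) (auto simp: inner_Basis)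
    also have "\<dots> = (if i \<in> J then 1 else 0)"
      using that finite_subset [OF that(2)] by (simp add: sum.delta')
    finally show ?thesis by (simp add: cor_def)
  qed
  show ?thesis
  proof (rule that [of "cor ` Pow Basis"])
    show "finite (cor ` Pow Basis)" by simp
    show "card (cor ` Pow Basis) \<le> 2 ^ DIM('a)"
      using card_image_le [of "Pow (Basis :: 'a set)" cor] by (simp add: card_Pow)
    show "inward_corner w" if "w \<in> cor ` Pow Basis" for w
      using that cor by (auto simp: inward_corner_def)
    fix a c :: 'a and l0 l L :: real
    assume l: "0 < l" "l \<le> l0 / 4" "L \<le> l0 / 4" and sub: "cbox c (c + l *\<^sub>R One) \<subseteq> cbox a (a + l0 *\<^sub>R One)"
    have ac: "a \<bullet> i \<le> c \<bullet> i" "c \<bullet> i + l \<le> a \<bullet> i + l0" if "i \<in> Basis" for i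
      using sub l that by (auto simp: subset_box inner_simps)
    define J where "J = {i \<in> Basis. l0 / 2 < c \<bullet> i - a \<bullet> i}"
    have "cbox c (c + l *\<^sub>R One) \<subseteq> shift_region (cor J) L (cbox a (a + l0 *\<^sub>R One))"
      unfolding shift_region_def
    proof (intro subsetI CollectI ballI)
      fix x v assume x: "x \<in> cbox c (c + l *\<^sub>R One)" and v: "v \<in> cbox (L *\<^sub>R cor J) (L *\<^sub>R cor J + L *\<^sub>R One)"
      have "a \<bullet> i \<le> x \<bullet> i + v \<bullet> i \<and> x \<bullet> i + v \<bullet> i \<le> a \<bullet> i + l0" if i: "i \<in> Basis" for i
      proof -
        have X: "c \<bullet> i \<le> x \<bullet> i" "x \<bullet> i \<le> c \<bullet> i + l" using x i by (auto simp: mem_box inner_simps)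
        have V: "L * (cor J \<bullet> i) \<le> v \<bullet> i" "v \<bullet> i \<le> L * (cor J \<bullet> i) + L" using v i by (auto simp: mem_box inner_simps)
        show ?thesis
        proof (cases "i \<in> J")
          case True
          then have "cor J \<bullet> i = -1" "l0 / 2 < c \<bullet> i - a \<bullet> i" using cor [of i J] i by (auto simp: J_def)
          with X V ac [OF i] l show ?thesis by simp
        next
          case False
          then have "cor J \<bullet> i = 0" "c \<bullet> i - a \<bullet> i \<le> l0 / 2" using cor [of i J] i by (auto simp: J_def)
          with X V ac [OF i] l show ?thesis by simp
        qed
      qed
      then show "x + v \<in> cbox a (a + l0 *\<^sub>R One)" by (simp add: mem_box inner_simps)
    qed
    then show "\<exists>w\<in>cor ` Pow Basis. cbox c (c + l *\<^sub>R One) \<subseteq> shift_region w L (cbox a (a + l0 *\<^sub>R One))"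
      by (auto simp: J_def)
  qed
qed

text \<open>Cubes of side at least \<open>\<tau> \<approx> t\<^bsup>1/d\<^esup>\<close> oscillate by at most \<open>C M\<close>. A smaller cube with larger
  oscillation carries much of the remainder \<open>f - smoothing w k \<tau> f\<close>, so the weak-type bound applies.\<close>

lemma sharp_max_rearrangement:
  fixes a :: "'a::euclidean_space"
  assumes l0: "0 < l0" and p: "1 < p" and q: "0 < q" and k: "0 < k"
  obtains C c where "0 < C" "0 < c" "c \<le> 1/2"
    "\<And>(f :: 'a \<Rightarrow> 'b::euclidean_space) M t Q0. Q0 = cbox a (a + l0 *\<^sub>R One) \<Longrightarrow>
      f \<in> borel_measurable borel \<Longrightarrow> (\<And>x. x \<notin> Q0 \<Longrightarrow> f x = 0) \<Longrightarrow> 0 < M \<Longrightarrow>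
      lorentz_norm Q0 p q (\<lambda>x. ennreal (norm (f x))) \<le> ennreal M \<Longrightarrow> 0 < t \<Longrightarrow> t < 1 \<Longrightarrow>
      (\<And>u. c * t powr (1 / DIM('a)) \<le> u \<Longrightarrow> u \<le> 1/2 \<Longrightarrow>
         modulus Q0 k p q f u \<le> ennreal (M * u powr (DIM('a) / p))) \<Longrightarrow>
      rearrangement Q0 (sharp_max Q0 f) t \<le> ennreal (C * M)"
proof -
  let ?n = "DIM('a)" and ?\<theta> = "1 - 1 / p"
  have n: "1 \<le> real ?n" by (simp add: DIM_positive Suc_le_eq)
  \<comment> \<open>The first bound keeps the margin \<open>2 * k * S\<close> below
    \<open>l0 / 4\<close>, the room provided by the corners; the second keeps the steps, of norm up
    to \<open>?n * s\<close>, below 1/2.\<close>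
  define S where "S = min (l0 / (8 * real k)) (1 / (2 * real ?n))"
  have S: "0 < S" "S \<le> l0 / (8 * real k)" "S \<le> 1 / (2 * real ?n)"
    using l0 k n by (auto simp: S_def)
  have kS: "2 * real k * S \<le> l0 / 4" using S(2) k by (simp add: field_simps)
  have Sl: "S \<le> l0 / 4"
  proof -
    have "l0 / (8 * real k) \<le> l0 / 4" using l0 k by (intro divide_left_mono) auto
    with S(2) show ?thesis by linarith
  qed
  \<comment> \<open>With \<open>\<tau> = S * t powr (1 / ?n)\<close> as smallest scale, the modulus
    is evaluated at \<open>?n * s \<ge> ?n * \<tau> = c * t powr (1 / ?n)\<close>.\<close>
  define c where "c = real ?n * S"
  have c: "0 < c" "c \<le> 1/2" using S n by (auto simp: c_def field_simps)
  have V: "0 \<le> l0 ^ ?n" using l0 by simp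
  obtain K where K: "0 < K"
    "\<And>(S::'a set) g M E. (\<And>l. {x \<in> S. l < g x} \<in> sets lebesgue) \<Longrightarrow> (\<And>x. g x < \<infinity>) \<Longrightarrow>
       0 < M \<Longrightarrow> lorentz_norm S p q g \<le> ennreal M \<Longrightarrow> S \<in> sets lebesgue \<Longrightarrow> E \<in> sets lebesgue \<Longrightarrow>
       E \<subseteq> S \<Longrightarrow> emeasure lebesgue E \<le> ennreal (l0 ^ ?n) \<Longrightarrow>
       (\<integral>\<^sup>+x\<in>E. g x \<partial>lebesgue) \<le> ennreal (K * M * measure lebesgue E powr ?\<theta>)"
  proof (rule lorentz_norm_integral_bound [where ?'a = 'a, OF p q V], goal_cases)
    case (1 K)
    show ?thesis by (rule that; fact 1)
  qed
  obtain C0 where C0: "0 < C0" and osc: "\<And>(f :: 'a \<Rightarrow> 'b) w A s l Q0 x y.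
      integrable lborel f \<Longrightarrow> inward_corner w \<Longrightarrow> 0 \<le> A \<Longrightarrow>
      (\<And>E. E \<in> sets borel \<Longrightarrow> E \<subseteq> Q0 \<Longrightarrow>
        (\<integral>\<^sup>+x\<in>E. ennreal (norm (f x)) \<partial>lborel) \<le> ennreal (A * measure lborel E powr ?\<theta>)) \<Longrightarrow>
      (\<And>s' u E. s \<le> s' \<Longrightarrow> s' \<le> S \<Longrightarrow> u \<in> cbox w (w + One) \<Longrightarrow> E \<in> sets borel \<Longrightarrow>
        E \<subseteq> {x \<in> Q0. x + real k *\<^sub>R (s' *\<^sub>R u) \<in> Q0} \<Longrightarrow>
        (\<integral>\<^sup>+x\<in>E. ennreal (norm ((fdiff (s' *\<^sub>R u) ^^ k) f x)) \<partial>lborel) \<le>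
          ennreal (A * s' powr (?n / p) * measure lborel E powr ?\<theta>)) \<Longrightarrow>
      0 < s \<Longrightarrow> s \<le> S \<Longrightarrow> 0 \<le> l \<Longrightarrow> l \<le> s \<Longrightarrow>
      x \<in> shift_region w (2 * real k * S) Q0 \<Longrightarrow> y \<in> shift_region w (2 * real k * S) Q0 \<Longrightarrow>
      (\<And>i. i \<in> Basis \<Longrightarrow> \<bar>x \<bullet> i - y \<bullet> i\<bar> \<le> l) \<Longrightarrow>
      norm (smoothing w k s f x - smoothing w k s f y) \<le> C0 * A"
  proof (rule smoothing_oscillation [where ?'a = 'a and ?'b = 'b and k = k, OF p S(1)], goal_cases)
    case (1 C)
    show ?thesis by (rule that; fact 1)
  qed
  obtain W :: "'a set" where W: "finite W" "card W \<le> 2 ^ ?n" "\<And>w. w \<in> W \<Longrightarrow> inward_corner w"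
    "\<And>a l0 c l L. 0 < l \<Longrightarrow> l \<le> l0 / 4 \<Longrightarrow> L \<le> l0 / 4 \<Longrightarrow>
       cbox c (c + l *\<^sub>R One) \<subseteq> cbox a (a + l0 *\<^sub>R One) \<Longrightarrow>
       \<exists>w\<in>W. cbox c (c + l *\<^sub>R One) \<subseteq> shift_region w L (cbox a (a + l0 *\<^sub>R One))"
  proof (rule finite_inward_corners [where ?'a = 'a], goal_cases)
    case (1 W)
    show ?thesis by (rule that; fact 1)
  qed
  \<comment> \<open>Calibrated so that the covering bound
    \<open>(5 * ?n) ^ ?n * (\<tau> powr (?n / p) / \<eta>) powr p\<close> equals
    \<open>t / 2 ^ ?n\<close>, the share of each corner.\<close>
  define \<eta> where "\<eta> = (10 * real ?n * S) powr (?n / p)"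
  have \<eta>: "0 < \<eta>" using S n by (simp add: \<eta>_def)
  \<comment> \<open>The summands cover, in turn, cubes of side above \<open>S\<close>, the remainder
    on cubes of side between \<open>\<tau>\<close> and \<open>S\<close>, the oscillation of the
    smooth part, and the threshold for the remainder on cubes below \<open>\<tau>\<close>.\<close>
  define B where "B = S powr (- (?n / p)) + 1 + C0 + \<eta>"
  have B: "0 < B" using S C0 \<eta> by (simp add: B_def add_pos_pos)
  define C where "C = 2 * B * (K * real ?n powr (?n / p))"
  show ?thesis
  proof (rule that [of C c])
    show "0 < C" using B K n by (simp add: C_def)
    show "0 < c" "c \<le> 1/2" by fact+
    fix f :: "'a \<Rightarrow> 'b" and M t and Q0 :: "'a set"
    assume Q0: "Q0 = cbox a (a + l0 *\<^sub>R One)" and fm [measurable]: "f \<in> borel_measurable borel"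
      and f0: "\<And>x. x \<notin> Q0 \<Longrightarrow> f x = 0" and M: "0 < M"
      and Lf: "lorentz_norm Q0 p q (\<lambda>x. ennreal (norm (f x))) \<le> ennreal M"
      and t: "0 < t" "t < 1"
      and mod: "\<And>u. c * t powr (1 / ?n) \<le> u \<Longrightarrow> u \<le> 1/2 \<Longrightarrow>
         modulus Q0 k p q f u \<le> ennreal (M * u powr (?n / p))"
    have [measurable]: "Q0 \<in> sets borel" by (simp add: Q0)
    \<comment> \<open>The power of \<open>?n\<close> absorbs the ratio between the scale
      \<open>s\<close> and the bound \<open>?n * s\<close> for the norm of a step.\<close>
    define A where "A = K * M * real ?n powr (?n / p)"
    have A: "0 < A" using K M n by (simp add: A_def)
    have KA: "K * M \<le> A" using K M n p ge_one_powr_ge_zero [of "real ?n" "?n / p"] by (simp add: A_def)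
    define \<tau> where "\<tau> = S * t powr (1 / ?n)"
    have \<tau>: "0 < \<tau>" "\<tau> \<le> S"
      using S t n powr_mono2 [of "1 / ?n" t 1] by (auto simp: \<tau>_def mult_left_le)
    have small: "emeasure lebesgue E \<le> ennreal (l0 ^ ?n)" if "E \<in> sets borel" "E \<subseteq> Q0" for E
      using emeasure_mono [OF that(2), of lborel] that l0 by (simp add: Q0 emeasure_lborel_cube)
    have H1: "(\<integral>\<^sup>+x\<in>E. ennreal (norm (f x)) \<partial>lborel) \<le> ennreal (A * measure lborel E powr ?\<theta>)"
      if E: "E \<in> sets borel" "E \<subseteq> Q0" for E
    proof -
      have "{x \<in> Q0. l < ennreal (norm (f x))} \<in> sets lebesgue" for l
      proof -
        have "{x \<in> Q0. l < ennreal (norm (f x))} \<in> sets borel" by measurable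
        then show ?thesis by auto
      qed
      then have "(\<integral>\<^sup>+x\<in>E. ennreal (norm (f x)) \<partial>lebesgue) \<le> ennreal (K * M * measure lebesgue E powr ?\<theta>)"
        using E Lf M small by (intro K(2) [where S = Q0]) (auto simp: Q0)
      also have "\<dots> \<le> ennreal (A * measure lebesgue E powr ?\<theta>)"
        using KA by (intro ennreal_leI mult_right_mono) auto
      finally show ?thesis using E(1) by (simp add: nn_integral_completion)
    qed
    have f: "integrable lborel f"
    proof (rule integrableI_bounded)
      have "(\<integral>\<^sup>+x. ennreal (norm (f x)) \<partial>lborel) = (\<integral>\<^sup>+x\<in>Q0. ennreal (norm (f x)) \<partial>lborel)"
        using f0 by (intro nn_integral_cong) (auto simp: indicator_def)
      also have "\<dots> < \<infinity>"
        using H1 [of Q0] by (auto intro: le_less_trans)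
      finally show "(\<integral>\<^sup>+x. ennreal (norm (f x)) \<partial>lborel) < \<infinity>" .
    qed simp
    have H2: "(\<integral>\<^sup>+x\<in>E. ennreal (norm ((fdiff (s *\<^sub>R u) ^^ k) f x)) \<partial>lborel) \<le>
          ennreal (A * s powr (?n / p) * measure lborel E powr ?\<theta>)"
      if w: "w \<in> W" and s: "\<tau> \<le> s" "s \<le> S" and u: "u \<in> cbox w (w + One)" and E: "E \<in> sets borel"
        and sub: "E \<subseteq> {x \<in> Q0. x + real k *\<^sub>R (s *\<^sub>R u) \<in> Q0}" for w s u E
    proof -
      let ?X = "{x \<in> Q0. x + real k *\<^sub>R (s *\<^sub>R u) \<in> Q0}"
      let ?g = "\<lambda>x. ennreal (norm ((fdiff (s *\<^sub>R u) ^^ k) f x))"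
      have "\<bar>u \<bullet> i\<bar> \<le> 1" if "i \<in> Basis" for i
        using u W(3) [OF w] that by (fastforce simp: inward_corner_def mem_box inner_simps)
      then have "norm u \<le> real ?n"
        using norm_le_l1 [of u] sum_bounded_above [of Basis "\<lambda>i. \<bar>u \<bullet> i\<bar>" 1] by simp
      then have "norm (s *\<^sub>R u) \<le> real ?n * s"
        using s \<tau> mult_left_mono [of "norm u" "real ?n" s] by (simp add: mult.commute)
      then have "lorentz_norm ?X p q ?g \<le> modulus Q0 k p q f (real ?n * s)"
        unfolding modulus_def by (intro SUP_upper) auto
      also have "\<dots> \<le> ennreal (M * (real ?n * s) powr (?n / p))"
      proof (rule mod)
        show "c * t powr (1 / ?n) \<le> real ?n * s"
          using s(1) n by (simp add: c_def \<tau>_def mult.assoc mult_left_mono)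
        have "real ?n * s \<le> real ?n * S" using s by (intro mult_left_mono) auto
        then show "real ?n * s \<le> 1/2" using c(2) unfolding c_def by linarith
      qed
      finally have L: "lorentz_norm ?X p q ?g \<le> ennreal (M * (real ?n * s) powr (?n / p))" .
      have [measurable]: "?X \<in> sets borel" by measurable
      have [measurable]: "?g \<in> borel_measurable borel" unfolding fdiff_funpow by measurable
      have "{x \<in> ?X. l < ?g x} \<in> sets lebesgue" for l
      proof -
        have "?X \<inter> {x. l < ?g x} \<in> sets borel" by (intro sets.Int) measurable
        moreover have "{x \<in> ?X. l < ?g x} = ?X \<inter> {x. l < ?g x}" by auto
        ultimately show ?thesis by auto
      qed
      then have "(\<integral>\<^sup>+x\<in>E. ?g x \<partial>lebesgue) \<le>
          ennreal (K * (M * (real ?n * s) powr (?n / p)) * measure lebesgue E powr ?\<theta>)"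
        using E sub M s \<tau> n small by (intro K(2) [where S = ?X] L) auto
      also have "K * (M * (real ?n * s) powr (?n / p)) = A * s powr (?n / p)"
        using s \<tau> by (simp add: A_def powr_mult)
      finally show ?thesis using E(1) by (simp add: nn_integral_completion)
    qed
    have rem: "(\<integral>\<^sup>+x\<in>E. ennreal (norm (f x - smoothing w k s f x)) \<partial>lborel) \<le>
        ennreal (A * s powr (?n / p) * measure lborel E powr ?\<theta>)"
      if w: "w \<in> W" and s: "\<tau> \<le> s" "s \<le> S" and E: "E \<in> sets borel"
        and sub: "E \<subseteq> shift_region w (2 * real k * S) Q0" for w s E
    proof (rule smoothing_error_integral [where Q = Q0, OF f _ W(3) [OF w] H2 [OF w s] E])
      show "0 < s" using s \<tau> by simp
      have "real k * s \<le> 2 * real k * S" using s \<tau> k mult_mono [of "real k" "2 * real k" s S] by auto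
      then show "E \<subseteq> shift_region w (real k * s) Q0"
        using sub shift_region_antimono [OF W(3) [OF w], of "real k * s" "2 * real k * S" Q0] s \<tau> by auto
    qed
    have big: "mean_oscillation (cbox x (x + l *\<^sub>R One)) f \<le> ennreal (2 * (B * A)) \<or>
        (\<exists>w\<in>W. l \<le> \<tau> \<and> cbox x (x + l *\<^sub>R One) \<subseteq> shift_region w (2 * real k * S) Q0 \<and>
          ennreal (\<eta> * A * l ^ ?n) \<le>
            (\<integral>\<^sup>+z\<in>cbox x (x + l *\<^sub>R One). ennreal (norm (f z - smoothing w k \<tau> f z)) \<partial>lborel))"
      if l: "0 < l" and sub: "cbox x (x + l *\<^sub>R One) \<subseteq> Q0" for x l
    proof -
      let ?Q = "cbox x (x + l *\<^sub>R One)"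
      have mQ: "measure lborel ?Q powr ?\<theta> = l ^ ?n * l powr (- (?n / p))"
      proof -
        have "measure lborel ?Q powr ?\<theta> = l powr (real ?n * ?\<theta>)"
          using l by (simp add: measure_lborel_cube powr_powr flip: powr_realpow)
        also have "\<dots> = l powr real ?n * l powr (- (?n / p))"
          by (simp add: right_diff_distrib flip: powr_add)
        finally show ?thesis using l by (simp add: powr_realpow)
      qed
      show ?thesis
      proof (cases "S < l")
        case True
        have "(\<integral>\<^sup>+z\<in>?Q. ennreal (norm (f z - 0)) \<partial>lborel) \<le> ennreal (A * (l ^ ?n * l powr (- (?n / p))))"
          using H1 [OF _ sub] by (simp add: mQ)
        also have "\<dots> \<le> ennreal (B * A * l ^ ?n)"
        proof (rule ennreal_leI)
          have "l powr (- (?n / p)) \<le> S powr (- (?n / p))"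
            using True S p by (intro powr_mono2') auto
          also have "\<dots> \<le> B" using C0 \<eta> by (simp add: B_def)
          finally have "(A * l ^ ?n) * l powr (- (?n / p)) \<le> (A * l ^ ?n) * B"
            using A l by (intro mult_left_mono) auto
          then show "A * (l ^ ?n * l powr (- (?n / p))) \<le> B * A * l ^ ?n" by (simp add: mult_ac)
        qed
        finally show ?thesis
          using A B by (intro disjI1 mean_oscillation_le [OF f l, where v = 0]) auto
      next
        case False
        \<comment> \<open>A cube is compared with the smoothing at the scale of its own side, but
          never below \<open>\<tau>\<close>, where the modulus is not controlled. The constant
          subtracted from \<open>f\<close> is the value of the smoothing at the corner
          \<open>x\<close>.\<close>
        define s where "s = max l \<tau>"
        have s: "\<tau> \<le> s" "s \<le> S" "l \<le> s" "0 < s" using False \<tau> by (auto simp: s_def)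
        obtain w where w: "w \<in> W" "?Q \<subseteq> shift_region w (2 * real k * S) Q0"
          using W(4) [of l l0 "2 * real k * S" x a] l False Sl kS sub by (auto simp: Q0)
        let ?g = "smoothing w k s f"
        have gm [measurable]: "?g \<in> borel_measurable borel"
          using integrable_smoothing [OF f] by auto
        have xQ: "x \<in> ?Q" using l by (auto simp: mem_box inner_simps)
        have gosc: "norm (?g z - ?g x) \<le> C0 * A" if "z \<in> ?Q" for z
        proof (rule osc [where w = w and s = s and l = l and f = f and ?Q0.0 = Q0])
          fix i :: 'a assume "i \<in> Basis"
          then show "\<bar>z \<bullet> i - x \<bullet> i\<bar> \<le> l" using that by (auto simp: mem_box inner_simps)
        next
          fix s' u and E :: "'a set"
          assume "s \<le> s'" "s' \<le> S" "u \<in> cbox w (w + One)" "E \<in> sets borel"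
            "E \<subseteq> {x \<in> Q0. x + real k *\<^sub>R (s' *\<^sub>R u) \<in> Q0}"
          then show "(\<integral>\<^sup>+x\<in>E. ennreal (norm ((fdiff (s' *\<^sub>R u) ^^ k) f x)) \<partial>lborel) \<le>
            ennreal (A * s' powr (?n / p) * measure lborel E powr ?\<theta>)"
            using w s by (intro H2) auto
        qed (use f W(3) [OF w(1)] A H1 s l w(2) xQ that in auto)
        have red: "mean_oscillation ?Q f \<le> ennreal (2 * (B * A))"
          if b: "b + C0 \<le> B" "0 \<le> b"
            and le: "(\<integral>\<^sup>+z\<in>?Q. ennreal (norm (f z - ?g z)) \<partial>lborel) \<le> ennreal (b * A * l ^ ?n)" for b
        proof (rule mean_oscillation_le [OF f l])
          show "0 \<le> B * A" using A B by simp
          have "(\<integral>\<^sup>+z\<in>?Q. ennreal (norm (f z - ?g x)) \<partial>lborel) \<le>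
             (\<integral>\<^sup>+z. ennreal (norm (f z - ?g z)) * indicator ?Q z + ennreal (C0 * A) * indicator ?Q z \<partial>lborel)"
          proof (rule nn_integral_mono)
            fix z
            show "ennreal (norm (f z - ?g x)) * indicator ?Q z \<le>
               ennreal (norm (f z - ?g z)) * indicator ?Q z + ennreal (C0 * A) * indicator ?Q z"
            proof (cases "z \<in> ?Q")
              case True
              have "norm (f z - ?g x) \<le> norm (f z - ?g z) + C0 * A"
                using norm_triangle_ineq [of "f z - ?g z" "?g z - ?g x"] gosc [OF True] by simp
              then have "ennreal (norm (f z - ?g x)) \<le> ennreal (norm (f z - ?g z)) + ennreal (C0 * A)"
                using C0 A by (simp add: ennreal_leI flip: ennreal_plus)
              with True show ?thesis by simp
            qed simp
          qed
          also have "\<dots> = (\<integral>\<^sup>+z\<in>?Q. ennreal (norm (f z - ?g z)) \<partial>lborel) + ennreal (C0 * A) * ennreal (l ^ ?n)"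
            using l by (subst nn_integral_add) (auto simp: nn_integral_cmult_indicator emeasure_lborel_cube)
          also have "\<dots> \<le> ennreal (b * A * l ^ ?n) + ennreal (C0 * A) * ennreal (l ^ ?n)"
            using le by (rule add_right_mono)
          also have "\<dots> = ennreal ((b + C0) * (A * l ^ ?n))"
            using b A C0 l by (simp add: algebra_simps flip: ennreal_mult' ennreal_plus)
          also have "\<dots> \<le> ennreal (B * (A * l ^ ?n))"
            using b A l by (intro ennreal_leI mult_right_mono) auto
          finally show "(\<integral>\<^sup>+z\<in>?Q. ennreal (norm (f z - ?g x)) \<partial>lborel) \<le> ennreal (B * A * l ^ ?n)"
            by (simp add: mult.assoc)
        qed
        show ?thesis
        proof (cases "\<tau> \<le> l")
          case True
          then have sl: "s = l" by (simp add: s_def)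
          have "(\<integral>\<^sup>+z\<in>?Q. ennreal (norm (f z - ?g z)) \<partial>lborel) \<le>
              ennreal (A * l powr (?n / p) * (l ^ ?n * l powr (- (?n / p))))"
            using rem [OF w(1) s(1,2) _ w(2)] by (simp add: sl mQ)
          also have "A * l powr (?n / p) * (l ^ ?n * l powr (- (?n / p))) = 1 * A * l ^ ?n"
            using l by (simp add: powr_minus)
          finally show ?thesis
            using S \<eta> by (intro disjI1 red [of 1]) (auto simp: B_def)
        next
          case False
          then have st: "s = \<tau>" by (simp add: s_def)
          show ?thesis
          proof (cases "(\<integral>\<^sup>+z\<in>?Q. ennreal (norm (f z - ?g z)) \<partial>lborel) \<le> ennreal (\<eta> * A * l ^ ?n)")
            case True
            then show ?thesis
              using S \<eta> by (intro disjI1 red [of \<eta>]) (auto simp: B_def)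
          next
            case False
            then show ?thesis
              using w \<open>\<not> \<tau> \<le> l\<close> by (intro disjI2 bexI [of _ w]) (auto simp: st)
          qed
        qed
      qed
    qed
    \<comment> \<open>One family per corner, since the remainder tested on a cube depends on the
      corner \<open>w\<close> that suits this cube.\<close>
    define \<K> where "\<K> w = {(x, l). 0 < l \<and> l \<le> \<tau> \<and> cbox x (x + l *\<^sub>R One) \<subseteq> Q0 \<and>
        cbox x (x + l *\<^sub>R One) \<subseteq> shift_region w (2 * real k * S) Q0 \<and>
        ennreal (\<eta> * A * l ^ ?n) \<le>
            (\<integral>\<^sup>+z\<in>cbox x (x + l *\<^sub>R One). ennreal (norm (f z - smoothing w k \<tau> f z)) \<partial>lborel)}" for w
    have "\<exists>Z. Z \<in> sets borel \<and> (\<Union>(x, l)\<in>\<K> w. cbox x (x + l *\<^sub>R One)) \<subseteq> Z \<and>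
        emeasure lborel Z \<le> ennreal (t / 2 ^ ?n)" if w: "w \<in> W" for w
    proof -
      have [measurable]: "smoothing w k \<tau> f \<in> borel_measurable borel"
        using integrable_smoothing [OF f] by auto
      obtain Z where Z: "Z \<in> sets borel" "(\<Union>(x, l)\<in>\<K> w. cbox x (x + l *\<^sub>R One)) \<subseteq> Z"
        "emeasure lborel Z \<le> ennreal ((5 * real ?n) ^ ?n * (A * \<tau> powr (?n / p) / (\<eta> * A)) powr p)"
      proof (rule cube_family_cover [of p "A * \<tau> powr (?n / p)" "\<eta> * A"
            "\<lambda>z. ennreal (norm (f z - smoothing w k \<tau> f z))" "\<K> w" \<tau> a "a + l0 *\<^sub>R One"])
        show "0 < A * \<tau> powr (?n / p)" "0 < \<eta> * A" using A \<tau> \<eta> by auto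
        show "0 < l \<and> l \<le> \<tau>" if "(x, l) \<in> \<K> w" for x l using that by (simp add: \<K>_def)
        show "(case K of (x, l) \<Rightarrow> cbox x (x + l *\<^sub>R One)) \<subseteq> cbox a (a + l0 *\<^sub>R One)" if "K \<in> \<K> w" for K
          using that by (auto simp: \<K>_def Q0)
        show "ennreal (\<eta> * A * l ^ ?n) \<le> (\<integral>\<^sup>+z\<in>(case (x, l) of (x, l) \<Rightarrow> cbox x (x + l *\<^sub>R One)).
            ennreal (norm (f z - smoothing w k \<tau> f z)) \<partial>lborel)" if "(x, l) \<in> \<K> w" for x l
          using that by (simp add: \<K>_def)
        fix E :: "'a set"
        assume E: "E \<in> sets borel" "E \<subseteq> (\<Union>(x, l)\<in>\<K> w. cbox x (x + l *\<^sub>R One))"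
        then have "E \<subseteq> shift_region w (2 * real k * S) Q0" by (auto simp: \<K>_def)
        then show "(\<integral>\<^sup>+z\<in>E. ennreal (norm (f z - smoothing w k \<tau> f z)) \<partial>lborel) \<le>
            ennreal (A * \<tau> powr (?n / p) * measure lborel E powr (1 - 1 / p))"
          using \<tau> E by (intro rem w) auto
      qed (use p in auto)
      have d: "0 < 10 * real ?n * S" using S n by simp
      have "(5 * real ?n) ^ ?n * (A * \<tau> powr (?n / p) / (\<eta> * A)) powr p = (5 * real ?n) ^ ?n * (\<tau> powr (?n / p) / \<eta>) powr p"
        using A by simp
      also have "\<dots> = (5 * real ?n) ^ ?n * (\<tau> powr ?n / (10 * real ?n * S) powr ?n)"
        using p \<tau> \<eta> by (simp add: powr_divide powr_powr \<eta>_def)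
      also have "\<dots> = (5 * real ?n) ^ ?n * (\<tau> / (10 * real ?n * S)) ^ ?n"
        by (simp only: powr_realpow [OF \<tau>(1)] powr_realpow [OF d] power_divide)
      also have "\<dots> = ((1/2) * (\<tau> / S)) ^ ?n"
      proof -
        have "5 * real ?n * (\<tau> / (10 * real ?n * S)) = (1/2) * (\<tau> / S)"
          using S n by (simp add: field_simps)
        then show ?thesis by (simp only: flip: power_mult_distrib)
      qed
      also have "\<dots> = (\<tau> / S) ^ ?n / 2 ^ ?n" by (simp only: power_mult_distrib power_one_over) simp
      also have "(\<tau> / S) ^ ?n = t"
      proof -
        have "\<tau> / S = t powr (1 / ?n)" using S by (simp add: \<tau>_def)
        then have "(\<tau> / S) ^ ?n = (t powr (1 / ?n)) powr real ?n"
          using t by (simp add: powr_realpow)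
        also have "\<dots> = t" using t n by (simp add: powr_powr)
        finally show ?thesis .
      qed
      finally have "emeasure lborel Z \<le> ennreal (t / 2 ^ ?n)" using Z(3) by (simp only:)
      with Z(1,2) show ?thesis by blast
    qed
    then have "\<forall>w\<in>W. \<exists>Z. Z \<in> sets borel \<and> (\<Union>(x, l)\<in>\<K> w. cbox x (x + l *\<^sub>R One)) \<subseteq> Z \<and>
        emeasure lborel Z \<le> ennreal (t / 2 ^ ?n)" by blast
    from bchoice [OF this] obtain Z where Z: "\<And>w. w \<in> W \<Longrightarrow> Z w \<in> sets borel"
        "\<And>w. w \<in> W \<Longrightarrow> (\<Union>(x, l)\<in>\<K> w. cbox x (x + l *\<^sub>R One)) \<subseteq> Z w"
        "\<And>w. w \<in> W \<Longrightarrow> emeasure lborel (Z w) \<le> ennreal (t / 2 ^ ?n)"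
      by blast
    have sub: "{x \<in> Q0. ennreal (C * M) < sharp_max Q0 f x} \<subseteq> (\<Union>w\<in>W. Z w)"
    proof
      fix y assume y: "y \<in> {x \<in> Q0. ennreal (C * M) < sharp_max Q0 f x}"
      have CM: "C * M = 2 * (B * A)" by (simp add: C_def A_def)
      from y obtain x l where Q: "0 < l" "y \<in> cbox x (x + l *\<^sub>R One)" "cbox x (x + l *\<^sub>R One) \<subseteq> Q0"
          "ennreal (2 * (B * A)) < mean_oscillation (cbox x (x + l *\<^sub>R One)) f"
        unfolding CM by (auto simp: sharp_max_def less_SUP_iff cube_def)
      with big [OF Q(1,3)] obtain w where "w \<in> W" "(x, l) \<in> \<K> w"
        by (auto simp: \<K>_def not_le)
      with Z(2) Q(2) show "y \<in> (\<Union>w\<in>W. Z w)" by blast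
    qed
    \<comment> \<open>The level set is merely enclosed in a Borel set; monotonicity asks for
      measurability of the larger set.\<close>
    have "emeasure lebesgue {x \<in> Q0. ennreal (C * M) < sharp_max Q0 f x} \<le> emeasure lebesgue (\<Union>w\<in>W. Z w)"
      using W(1) Z(1) by (intro emeasure_mono sub sets.finite_UN) auto
    also have "\<dots> = emeasure lborel (\<Union>w\<in>W. Z w)"
    proof -
      have "(\<Union>w\<in>W. Z w) \<in> sets borel" using W(1) Z(1) by (intro sets.finite_UN) auto
      then show ?thesis by simp
    qed
    also have "\<dots> \<le> (\<Sum>w\<in>W. emeasure lborel (Z w))"
      using W(1) Z(1) by (intro emeasure_subadditive_finite) auto
    also have "\<dots> \<le> (\<Sum>w\<in>W. ennreal (t / 2 ^ ?n))"
      by (intro sum_mono Z(3))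
    also have "\<dots> = ennreal (real (card W) * (t / 2 ^ ?n))"
      using t by (simp add: sum_ennreal del: sum_constant) simp
    also have "\<dots> \<le> ennreal (2 ^ ?n * (t / 2 ^ ?n))"
    proof (intro ennreal_leI mult_right_mono)
      have "real (card W) \<le> real (2 ^ ?n)" using W(2) by (rule of_nat_mono)
      then show "real (card W) \<le> 2 ^ ?n" by simp
    qed (use t in auto)
    finally show "rearrangement Q0 (sharp_max Q0 f) t \<le> ennreal (C * M)"
      unfolding rearrangement_def by (intro Inf_lower) simp
  qed
qed

section \<open>Passing to a Borel representative\<close>

lemma AE_lborel_translate:
  fixes c :: "'a::euclidean_space"
  assumes "AE x in lborel. P x" shows "AE x in lborel. P (x + c)"
proof -
  obtain N where N: "N \<in> null_sets lborel" "{x. \<not> P x} \<subseteq> N"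
    using assms by (auto elim!: AE_E simp: null_sets_def)
  have "emeasure lborel ((+) c -` N) = emeasure (distr lborel borel ((+) c)) N"
    using N by (subst emeasure_distr) auto
  also have "\<dots> = 0" using N unfolding lborel_distr_plus by auto
  finally have "(+) c -` N \<in> null_sets lborel"
    using N(1) measurable_sets_borel [of "(+) c" borel N] by (auto intro!: null_setsI)
  then show ?thesis
    by (rule AE_I') (use N(2) in \<open>auto simp: add.commute\<close>)
qed

text \<open>The shifts and the Tonelli arguments on products are carried out for Borel functions;
  the representative is found coordinate by coordinate.\<close>

lemma borel_measurable_ex_AE_eq:
  fixes g :: "'a::euclidean_space \<Rightarrow> 'b::euclidean_space"
  assumes g: "g \<in> borel_measurable lebesgue"
  obtains f where "f \<in> borel_measurable borel" "AE x in lborel. g x = f x"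
proof -
  have "\<forall>i\<in>Basis. \<exists>h. h \<in> borel_measurable lborel \<and> (AE x in lborel. g x \<bullet> i = h x)"
  proof
    fix i :: 'b
    have "(\<lambda>x. g x \<bullet> i) \<in> borel_measurable lebesgue" using g by auto
    from completion_ex_borel_measurable_real [OF this]
    show "\<exists>h. h \<in> borel_measurable lborel \<and> (AE x in lborel. g x \<bullet> i = h x)" by auto
  qed
  from bchoice [OF this] obtain h where h: "\<And>i. i \<in> Basis \<Longrightarrow> h i \<in> borel_measurable borel"
    "\<And>i. i \<in> Basis \<Longrightarrow> AE x in lborel. g x \<bullet> i = h i x" by auto
  have "AE x in lborel. \<forall>i\<in>Basis. g x \<bullet> i = h i x"
    using h(2) by (intro AE_finite_allI) auto
  then have "AE x in lborel. g x = (\<Sum>i\<in>Basis. h i x *\<^sub>R i)"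
  proof eventually_elim
    case (elim x)
    have "g x = (\<Sum>i\<in>Basis. (g x \<bullet> i) *\<^sub>R i)" by (rule euclidean_representation [symmetric])
    then show ?case using elim by simp
  qed
  moreover have "(\<lambda>x. \<Sum>i\<in>Basis. h i x *\<^sub>R i) \<in> borel_measurable borel"
    using h(1) by (intro borel_measurable_sum borel_measurable_scaleR) auto
  ultimately show ?thesis by (rule that [rotated])
qed

text \<open>Completeness of Lebesgue measure transfers measurability of the level sets from
  \<open>g'\<close> to \<open>g\<close>; only then do the values of \<open>emeasure\<close>
  agree.\<close>

lemma lorentz_norm_cong_AE:
  assumes ae: "AE x in lborel. x \<in> S \<longrightarrow> g x = g' x"
    and meas: "\<And>l. {x \<in> S. l < g' x} \<in> sets lebesgue"
  shows "lorentz_norm S p q g = lorentz_norm S p q g'"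
proof -
  have "emeasure lebesgue {x \<in> S. l < g x} = emeasure lebesgue {x \<in> S. l < g' x}" for l
  proof -
    have eq: "AE x in lebesgue. x \<in> {x \<in> S. l < g' x} \<longleftrightarrow> x \<in> {x \<in> S. l < g x}"
      using AE_completion [OF ae] by eventually_elim auto
    then have "{x \<in> S. l < g x} \<in> sets lebesgue"
      by (rule completion.in_sets_AE) (use meas in auto)
    then show ?thesis
      using eq meas by (intro emeasure_eq_AE) auto
  qed
  then show ?thesis by (simp add: lorentz_norm_def rearrangement_def)
qed

text \<open>The difference at \<open>x\<close> involves the points \<open>x + j h\<close> with
  \<open>j \<le> k\<close>, which lie in \<open>Q0\<close> by convexity once both ends do. The
  exceptional null set may depend on \<open>h\<close>, as the norms are compared for each
  \<open>h\<close> separately.\<close>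

lemma modulus_cong_AE:
  fixes f f' :: "'a::euclidean_space \<Rightarrow> 'b::euclidean_space"
  assumes conv: "convex Q0" and Q0: "Q0 \<in> sets borel" and f' [measurable]: "f' \<in> borel_measurable borel"
    and ae: "AE x in lborel. x \<in> Q0 \<longrightarrow> f x = f' x"
  shows "modulus Q0 k p q f t = modulus Q0 k p q f' t"
  unfolding modulus_def
proof (rule SUP_cong [OF refl])
  fix h :: 'a
  let ?X = "{x \<in> Q0. x + real k *\<^sub>R h \<in> Q0}"
  have [measurable]: "Q0 \<in> sets borel" by fact
  have "AE x in lborel. \<forall>j\<in>{..k}. x + real j *\<^sub>R h \<in> Q0 \<longrightarrow> f (x + real j *\<^sub>R h) = f' (x + real j *\<^sub>R h)"
    by (intro AE_finite_allI AE_lborel_translate [OF ae]) auto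
  then have "AE x in lborel. x \<in> ?X \<longrightarrow>
      ennreal (norm ((fdiff h ^^ k) f x)) = ennreal (norm ((fdiff h ^^ k) f' x))"
  proof eventually_elim
    case (elim x)
    show ?case
    proof
      assume x: "x \<in> ?X"
      have "x + real j *\<^sub>R h \<in> Q0" if "j \<le> k" for j
      proof (cases "k = 0")
        case True
        then show ?thesis using x that by simp
      next
        case False
        have "(1 - real j / real k) *\<^sub>R x + (real j / real k) *\<^sub>R (x + real k *\<^sub>R h) \<in> Q0"
          using x that False by (intro convexD [OF conv]) auto
        also have "(1 - real j / real k) *\<^sub>R x + (real j / real k) *\<^sub>R (x + real k *\<^sub>R h) = x + real j *\<^sub>R h"
          using False by (simp add: algebra_simps)
        finally show ?thesis .
      qed
      then have "(fdiff h ^^ k) f x = (fdiff h ^^ k) f' x"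
        unfolding fdiff_funpow using elim by (intro sum.cong) auto
      then show "ennreal (norm ((fdiff h ^^ k) f x)) = ennreal (norm ((fdiff h ^^ k) f' x))" by simp
    qed
  qed
  moreover have "{x \<in> ?X. l < ennreal (norm ((fdiff h ^^ k) f' x))} \<in> sets lebesgue" for l
  proof -
    have [measurable]: "(\<lambda>x. (fdiff h ^^ k) f' x) \<in> borel_measurable borel"
      unfolding fdiff_funpow by measurable
    have "{x \<in> ?X. l < ennreal (norm ((fdiff h ^^ k) f' x))} \<in> sets borel" by measurable
    then show ?thesis by auto
  qed
  ultimately show "lorentz_norm ?X p q (\<lambda>x. ennreal (norm ((fdiff h ^^ k) f x))) =
      lorentz_norm ?X p q (\<lambda>x. ennreal (norm ((fdiff h ^^ k) f' x)))"
    by (rule lorentz_norm_cong_AE)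
qed

text \<open>Since this holds for every single cube, the sharp maximal functions of \<open>f\<close>
  and \<open>f'\<close> coincide at every point, not just almost everywhere.\<close>

lemma mean_oscillation_cong_AE:
  fixes f f' :: "'a::euclidean_space \<Rightarrow> 'b::euclidean_space"
  assumes f: "f \<in> borel_measurable (lebesgue_on Q0)" and f': "f' \<in> borel_measurable borel"
    and Q0: "Q0 \<in> sets borel" and Q: "Q \<in> sets borel" "Q \<subseteq> Q0"
    and ae: "AE x in lborel. x \<in> Q0 \<longrightarrow> f x = f' x"
  shows "mean_oscillation Q f = mean_oscillation Q f'"
proof -
  have ae': "AE x in lebesgue. x \<in> Q \<longrightarrow> f x = f' x"
    using AE_completion [OF ae] by eventually_elim (use Q(2) in auto)
  have "(\<lambda>x. indicator Q x *\<^sub>R f x) \<in> borel_measurable lebesgue"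
  proof -
    have "(\<lambda>x. indicator Q0 x *\<^sub>R f x) \<in> borel_measurable lebesgue"
      using f Q0 by (subst (asm) borel_measurable_restrict_space_iff) auto
    moreover have "Q \<in> sets lebesgue" using Q(1) by auto
    ultimately have "(\<lambda>x. indicator Q x *\<^sub>R (indicator Q0 x *\<^sub>R f x)) \<in> borel_measurable lebesgue"
      by (rule borel_measurable_scaleR [OF borel_measurable_indicator, rotated])
    moreover have "indicator Q x *\<^sub>R (indicator Q0 x *\<^sub>R f x) = indicator Q x *\<^sub>R f x" for x
      using Q(2) by (auto simp: indicator_def)
    ultimately show ?thesis by (simp only:)
  qed
  moreover have "(\<lambda>x. indicator Q x *\<^sub>R f' x) \<in> borel_measurable lebesgue"
    using Q(1) f' by (intro measurable_completion borel_measurable_scaleR borel_measurable_indicator) auto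
  moreover have "AE x in lebesgue. indicator Q x *\<^sub>R f x = indicator Q x *\<^sub>R f' x"
    using ae' by eventually_elim (auto simp: indicator_def)
  ultimately have "average Q f = average Q f'"
    unfolding average_def set_lebesgue_integral_def by (subst integral_cong_AE) auto
  moreover have "(\<integral>\<^sup>+x\<in>Q. ennreal (norm (f x - v)) \<partial>lebesgue) = (\<integral>\<^sup>+x\<in>Q. ennreal (norm (f' x - v)) \<partial>lebesgue)" for v
  proof (rule nn_integral_cong_AE)
    show "AE x in lebesgue. ennreal (norm (f x - v)) * indicator Q x = ennreal (norm (f' x - v)) * indicator Q x"
      using ae' by eventually_elim (auto simp: indicator_def)
  qed
  ultimately show ?thesis by (simp add: mean_oscillation_def)
qed

text \<open>The sum of the norm and the supremum is the natural choice of \<open>M\<close> in the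
  preceding estimate: weighted by \<open>u powr (- (DIM('a) / p))\<close>, each value of the modulus
  is below the supremum.\<close>

lemma sharp_max_bound:
  fixes Q0 :: "'a::euclidean_space set"
  assumes cube: "cube Q0" and p: "1 < p" and q: "0 < q" and k: "0 < k"
  obtains C c where "0 < C" "0 < c" "c \<le> 1/2"
    "\<And>(f :: 'a \<Rightarrow> 'b::euclidean_space) t. f \<in> lorentz_space Q0 p q \<Longrightarrow> 0 < t \<Longrightarrow> t < 1 \<Longrightarrow>
      rearrangement Q0 (sharp_max Q0 f) t \<le> ennreal C *
        (lorentz_norm Q0 p q (\<lambda>x. ennreal (norm (f x))) +
         (SUP u\<in>{c * t powr (1 / DIM('a))..1/2}.
            ennreal (u powr (- (DIM('a) / p))) * modulus Q0 k p q f u))"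
proof -
  obtain a l0 where l0: "0 < l0" and Q0: "Q0 = cbox a (a + l0 *\<^sub>R One)"
    using cube by (auto simp: cube_def)
  have Q0m [measurable]: "Q0 \<in> sets borel" by (simp add: Q0)
  let ?\<sigma> = "DIM('a) / p"
  show ?thesis
  proof (rule sharp_max_rearrangement [where ?'b = 'b and a = a, OF l0 p q k], goal_cases)
    case (1 C c)
    note core = 1(4) [OF Q0]
    show ?thesis
    proof (rule that [of C c])
      fix f :: "'a \<Rightarrow> 'b" and t :: real
      assume f: "f \<in> lorentz_space Q0 p q" and t: "0 < t" "t < 1"
      let ?L = "lorentz_norm Q0 p q (\<lambda>x. ennreal (norm (f x)))"
      let ?X = "?L + (SUP u\<in>{c * t powr (1 / DIM('a))..1/2}. ennreal (u powr (- ?\<sigma>)) * modulus Q0 k p q f u)"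
      have fm: "f \<in> borel_measurable (lebesgue_on Q0)" using f by (simp add: lorentz_space_def)
      then have "(\<lambda>x. indicator Q0 x *\<^sub>R f x) \<in> borel_measurable lebesgue"
        by (subst (asm) borel_measurable_restrict_space_iff) (auto simp: Q0)
      then obtain f1 where f1: "f1 \<in> borel_measurable borel" "AE x in lborel. indicator Q0 x *\<^sub>R f x = f1 x"
        by (rule borel_measurable_ex_AE_eq)
      \<comment> \<open>Cutting off once more makes the representative vanish everywhere outside
        \<open>Q0\<close>, whereas \<open>f1\<close> does so only almost everywhere.\<close>
      define f' where "f' x = indicator Q0 x *\<^sub>R f1 x" for x
      have f'm [measurable]: "f' \<in> borel_measurable borel"
        unfolding f'_def using f1 by measurable
      have f'0: "f' x = 0" if "x \<notin> Q0" for x using that by (simp add: f'_def)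
      have ae: "AE x in lborel. x \<in> Q0 \<longrightarrow> f x = f' x"
        using f1(2) by eventually_elim (auto simp: f'_def)
      have L: "?L = lorentz_norm Q0 p q (\<lambda>x. ennreal (norm (f' x)))"
      proof (rule lorentz_norm_cong_AE)
        show "AE x in lborel. x \<in> Q0 \<longrightarrow> ennreal (norm (f x)) = ennreal (norm (f' x))"
          using ae by eventually_elim auto
        fix l :: ennreal
        have "{x \<in> Q0. l < ennreal (norm (f' x))} \<in> sets borel" by measurable
        then show "{x \<in> Q0. l < ennreal (norm (f' x))} \<in> sets lebesgue" by auto
      qed
      have mod: "modulus Q0 k p q f u = modulus Q0 k p q f' u" for u
        using ae by (intro modulus_cong_AE) (auto simp: Q0)
      have "sharp_max Q0 f x = sharp_max Q0 f' x" for x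
        unfolding sharp_max_def
      proof (rule SUP_cong [OF refl])
        fix Q assume "Q \<in> {Q. cube Q \<and> x \<in> Q \<and> Q \<subseteq> Q0}"
        then show "mean_oscillation Q f = mean_oscillation Q f'"
          by (intro mean_oscillation_cong_AE [OF fm f'm Q0m _ _ ae]) (auto simp: cube_def)
      qed
      then have sharp: "sharp_max Q0 f = sharp_max Q0 f'" by blast
      show "rearrangement Q0 (sharp_max Q0 f) t \<le> ennreal C * ?X"
      proof (cases ?X)
        case top
        have "ennreal C * ?X = top"
          unfolding top using 1(1) by (simp add: ennreal_mult_top)
        then show ?thesis by (simp only: top_greatest)
      next
        case (real x)
        \<comment> \<open>The estimate asks for \<open>0 < M\<close>, but the sum \<open>x\<close>
          may be 0; hence \<open>M = x + e\<close> with \<open>e\<close> tending to 0.\<close>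
        have le: "rearrangement Q0 (sharp_max Q0 f) t \<le> ennreal (C * (x + e))" if e: "0 < e" for e
          unfolding sharp
        proof (rule core [OF f'm f'0 _ _ t])
          have xe: "?X \<le> ennreal (x + e)" using real e by (simp add: ennreal_leI)
          show "0 < x + e" using real e by simp
          show "lorentz_norm Q0 p q (\<lambda>x. ennreal (norm (f' x))) \<le> ennreal (x + e)"
            unfolding L [symmetric] by (rule order_trans [OF _ xe]) simp
          fix u assume u: "c * t powr (1 / DIM('a)) \<le> u" "u \<le> 1/2"
          have u0: "0 < u"
          proof -
            have "0 < c * t powr (1 / DIM('a))" using 1(2) t by simp
            with u(1) show ?thesis by linarith
          qed
          have "ennreal (u powr (- ?\<sigma>)) * modulus Q0 k p q f u \<le>
              (SUP u\<in>{c * t powr (1 / DIM('a))..1/2}. ennreal (u powr (- ?\<sigma>)) * modulus Q0 k p q f u)"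
            using u by (intro SUP_upper) auto
          also have "\<dots> \<le> ?X" by simp
          also note xe
          finally have "ennreal (u powr ?\<sigma>) * (ennreal (u powr (- ?\<sigma>)) * modulus Q0 k p q f u) \<le>
              ennreal (u powr ?\<sigma>) * ennreal (x + e)"
            by (rule mult_left_mono) simp
          also have "ennreal (u powr ?\<sigma>) * (ennreal (u powr (- ?\<sigma>)) * modulus Q0 k p q f u) = modulus Q0 k p q f u"
            using u0 by (simp add: powr_minus flip: mult.assoc ennreal_mult')
          finally show "modulus Q0 k p q f' u \<le> ennreal ((x + e) * u powr ?\<sigma>)"
            using real e by (simp add: mult.commute ennreal_mult' flip: mod)
        qed
        show ?thesis
        proof (rule ennreal_le_epsilon)
          fix e :: real assume e: "0 < e"
          have "rearrangement Q0 (sharp_max Q0 f) t \<le> ennreal (C * (x + e / C))"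
            using e 1(1) by (intro le) simp
          also have "C * (x + e / C) = C * x + e" using 1(1) by (simp add: field_simps)
          also have "ennreal (C * x + e) = ennreal C * ?X + ennreal e"
            using e 1(1) real by (simp add: ennreal_mult' )
          finally show "rearrangement Q0 (sharp_max Q0 f) t \<le> ennreal C * ?X + ennreal e" .
        qed
      qed
    qed (use 1 in auto)
  qed
qed

section \<open>Hardy inequality and conclusion\<close>

text \<open>A monotone function is the supremum of its truncations at \<open>n\<close>, which are
  real-valued and monotone. The modulus, a supremum over uncountably many steps, is a measurable
  function of the scale for this reason.\<close>

lemma borel_measurable_mono_ennreal:
  fixes g :: "real \<Rightarrow> ennreal"
  assumes "mono g" shows "g \<in> borel_measurable borel"
proof -
  have g: "g = (\<lambda>x. SUP n. ennreal (enn2real (min (g x) (of_nat n))))"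
  proof
    fix x
    have "ennreal (enn2real (min (g x) (of_nat n))) = min (g x) (of_nat n)" for n
      by (rule ennreal_enn2real) (simp add: min_less_iff_disj of_nat_less_top)
    moreover have "(SUP n. min (g x) (of_nat n)) = min (g x) (SUP n. of_nat n)"
      by (simp add: inf_SUP flip: inf_min)
    ultimately show "g x = (SUP n. ennreal (enn2real (min (g x) (of_nat n))))"
      by (simp add: ennreal_SUP_of_nat_eq_top)
  qed
  have "mono (\<lambda>x. enn2real (min (g x) (of_nat n)))" for n
  proof (rule monoI)
    fix x y :: real assume "x \<le> y"
    then have "min (g x) (of_nat n) \<le> min (g y) (of_nat n)"
      using assms by (intro min.mono) (auto simp: mono_def)
    then show "enn2real (min (g x) (of_nat n)) \<le> enn2real (min (g y) (of_nat n))"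
      by (rule enn2real_mono) (simp add: min_less_iff_disj of_nat_less_top)
  qed
  then have [measurable]: "(\<lambda>x. enn2real (min (g x) (of_nat n))) \<in> borel_measurable borel" for n
    by (rule borel_measurable_mono)
  show ?thesis
    by (subst g) measurable
qed

lemma nn_integral_log_power_le:
  assumes \<alpha>: "\<alpha> < -1" and T: "0 < T" "T \<le> 1"
  shows "(\<integral>\<^sup>+t\<in>{0<..<T}. ennreal ((1 + \<bar>ln t\<bar>) powr \<alpha> / t) \<partial>lborel) \<le>
    ennreal ((1 - ln T) powr (\<alpha> + 1) / (- (\<alpha> + 1)))"
proof -
  define F where "F t = (1 - ln t) powr (\<alpha> + 1) / (- (\<alpha> + 1))" for t
  let ?f = "\<lambda>t. ennreal ((1 + \<bar>ln t\<bar>) powr \<alpha> / t)"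
  define M where "M = density lborel ?f"
  define I where "I m = {T / real (Suc m)..T}" for m
  have fin: "emeasure M (I m) \<le> ennreal (F T)" for m
  proof -
    have pos: "0 < t" "ln t \<le> 0" if "t \<in> I m" for t
    proof -
      have "0 < T / real (Suc m)" using T by simp
      moreover have "T / real (Suc m) \<le> t" "t \<le> T"
        using that unfolding I_def by (simp_all only: atLeastAtMost_iff)
      ultimately show "0 < t" by linarith
      then show "ln t \<le> 0" using \<open>t \<le> T\<close> T by (simp add: ln_le_zero_iff)
    qed
    have "emeasure M (I m) = (\<integral>\<^sup>+t. ennreal ((1 + \<bar>ln t\<bar>) powr \<alpha> / t) * indicator {T / real (Suc m)..T} t \<partial>lborel)"
      unfolding M_def I_def by (subst emeasure_density) auto
    also have "\<dots> = ennreal (F T - F (T / real (Suc m)))"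
    proof (rule nn_integral_FTC_Icc)
      show "T / real (Suc m) \<le> T" using T by (simp add: field_simps)
      fix t assume "t \<in> {T / real (Suc m)..T}"
      then have "t \<in> I m" unfolding I_def .
      note t0 = pos [OF this]
      show "0 \<le> (1 + \<bar>ln t\<bar>) powr \<alpha> / t" using t0 by simp
      have "(F has_real_derivative (1 - ln t) powr \<alpha> / t) (at t)"
      proof -
        have "((\<lambda>t. 1 - ln t) has_real_derivative - (1 / t)) (at t)"
          using t0 by (auto intro!: derivative_eq_intros)
        moreover have "0 < 1 - ln t" using t0(2) by linarith
        ultimately have "((\<lambda>t. (1 - ln t) powr (\<alpha> + 1)) has_real_derivative
            (\<alpha> + 1) * (1 - ln t) powr (\<alpha> + 1 - of_nat 1) * - (1 / t)) (at t)"
          by (rule DERIV_fun_powr)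
        from DERIV_cdivide [OF this, of "- (\<alpha> + 1)"]
        have "(F has_real_derivative ((\<alpha> + 1) * (1 - ln t) powr (\<alpha> + 1 - of_nat 1) * - (1 / t)) / - (\<alpha> + 1)) (at t)"
          by (simp only: F_def [abs_def])
        moreover have "((\<alpha> + 1) * (1 - ln t) powr (\<alpha> + 1 - of_nat 1) * - (1 / t)) / - (\<alpha> + 1) = (1 - ln t) powr \<alpha> / t"
        proof -
          have cancel: "(x * y * - (1 / t)) / - x = y / t" if "x \<noteq> 0" for x y :: real using that by simp
          then show ?thesis using \<alpha> by (subst cancel) auto
        qed
        ultimately show ?thesis by (simp only:)
      qed
      then show "(F has_real_derivative (1 + \<bar>ln t\<bar>) powr \<alpha> / t) (at t)"
        using t0 by simp
    qed simp
    also have "\<dots> \<le> ennreal (F T)"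
      using \<alpha> by (intro ennreal_leI) (auto simp: F_def divide_nonneg_pos)
    finally show ?thesis .
  qed
  have "(\<integral>\<^sup>+t\<in>{0<..<T}. ?f t \<partial>lborel) = emeasure M {0<..<T}"
    unfolding M_def by (subst emeasure_density) auto
  also have "\<dots> \<le> emeasure M (\<Union>m. I m)"
  proof (rule emeasure_mono)
    show "{0<..<T} \<subseteq> (\<Union>m. I m)"
    proof
      fix t assume t: "t \<in> {0<..<T}"
      obtain m :: nat where "T / t < real m" using reals_Archimedean2 by blast
      then have "T < real m * t" using t by (simp add: field_simps)
      then have "T / real (Suc m) \<le> t" using t by (simp add: field_simps)
      then show "t \<in> (\<Union>m. I m)" using t by (auto simp: I_def)
    qed
  qed (auto simp: M_def I_def)
  also have "\<dots> = (SUP m. emeasure M (I m))"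
  proof (rule SUP_emeasure_incseq [symmetric])
    show "incseq I"
    proof (rule incseq_SucI)
      fix m
      have "T / real (Suc (Suc m)) \<le> T / real (Suc m)" using T by (intro divide_left_mono) auto
      then show "I m \<le> I (Suc m)" by (auto simp: I_def)
    qed
  qed (auto simp: M_def I_def)
  also have "\<dots> \<le> ennreal (F T)" by (intro SUP_least fin)
  finally show ?thesis by (simp add: F_def)
qed

lemma log_weight_pos: "0 < log_weight b t"
  by (simp add: log_weight_def)

text \<open>As \<open>1 / d \<le> 1\<close>, passing from \<open>t\<close> to a scale above
  \<open>c * t powr (1 / d)\<close> enlarges the logarithm at most by the constant
  \<open>- ln c\<close>; logarithmic weights at the two scales are thus comparable.\<close>

lemma log_scale_change:
  fixes c d t u :: real
  assumes c: "0 < c" "c \<le> 1" and d: "1 \<le> d" and t: "0 < t" "t \<le> 1" and u: "c * t powr (1 / d) \<le> u" "u \<le> 1"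
  shows "1 + \<bar>ln u\<bar> \<le> (1 - ln c) * (1 + \<bar>ln t\<bar>)"
proof -
  have "0 < c * t powr (1 / d)" using c t by simp
  then have u0: "0 < u" using u by linarith
  have "ln (c * t powr (1 / d)) \<le> ln u" using u c t by (intro ln_mono) auto
  then have "ln c + (1 / d) * ln t \<le> ln u" using c t by (simp add: ln_mult ln_powr)
  moreover have "ln t \<le> (1 / d) * ln t"
    using mult_right_mono_neg [of "1 / d" 1 "ln t"] d t by simp
  ultimately have "- ln u \<le> - ln c - ln t" by linarith
  moreover have "0 \<le> ln c * ln t" using c t by (simp add: mult_nonpos_nonpos)
  moreover have "ln u \<le> 0" "ln t \<le> 0" using u0 u t by auto
  ultimately show ?thesis by (simp add: algebra_simps)
qed

text \<open>A Hardy-type inequality. For finite \<open>r\<close> the supremum is replaced by an integral over dyadic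
  intervals, using that \<open>\<omega>\<close> increases; after Tonelli the inner integral of \<open>(1 + |log t|)\<^bsup>br\<^esup>\<close>
  against \<open>dt/t\<close> yields one more power of the logarithm, which is where \<open>b < - 1/r\<close> enters.\<close>

lemma Lr_dtt_sup_bound:
  assumes r: "0 < r" and b: "b < - enn2real (1 / r)" and \<sigma>: "0 < \<sigma>" and d: "1 \<le> d"
    and c: "0 < c" "c \<le> 1/2" and C: "0 < C"
  obtains D where "0 < D"
    "\<And>\<Phi> \<omega> L. mono \<omega> \<Longrightarrow>
       (\<And>t. 0 < t \<Longrightarrow> t < 1 \<Longrightarrow> \<Phi> t \<le> ennreal C * (L +
         (SUP u\<in>{c * t powr (1 / d)..1/2}. ennreal (u powr (- \<sigma>)) * \<omega> u))) \<Longrightarrow>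
       Lr_dtt r (\<lambda>t. ennreal (log_weight b t) * \<Phi> t) \<le> ennreal D *
         (L + Lr_dtt r (\<lambda>t. ennreal (t powr (- \<sigma>) * log_weight (b + enn2real (1 / r)) t) * \<omega> t))"
proof -
  define K where "K = 1 - ln c"
  have K: "1 \<le> K" using c by (simp add: K_def ln_le_zero_iff)
  have scale: "1 + \<bar>ln u\<bar> \<le> K * (1 + \<bar>ln t\<bar>)" "0 < u"
    if "0 < t" "t \<le> 1" "c * t powr (1 / d) \<le> u" "u \<le> 1" for t u
  proof -
    show "1 + \<bar>ln u\<bar> \<le> K * (1 + \<bar>ln t\<bar>)"
      unfolding K_def using c d that by (intro log_scale_change) auto
    have "0 < c * t powr (1 / d)" using c that by simp
    with that(3) show "0 < u" by linarith
  qed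
  have lw1: "log_weight b t \<le> 1" if "b < 0" for t
    unfolding log_weight_def using that powr_mono2' [of b 1 "1 + \<bar>ln t\<bar>"] by simp
  show ?thesis
  proof (cases "r = \<infinity>")
    case True
    have inv: "enn2real (1 / r) = 0" by (simp add: True)
    then have b0: "b < 0" using b by simp
    define D where "D = C * K powr (- b)"
    have K1: "1 \<le> K powr (- b)" using K b0 by (intro ge_one_powr_ge_zero) auto
    show ?thesis
    proof (rule that [of D])
      show "0 < D" using C K by (simp add: D_def)
      fix \<Phi> \<omega> and L :: ennreal
      assume *: "\<And>t. 0 < t \<Longrightarrow> t < 1 \<Longrightarrow> \<Phi> t \<le> ennreal C * (L +
         (SUP u\<in>{c * t powr (1 / d)..1/2}. ennreal (u powr (- \<sigma>)) * \<omega> u))"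
      define J where "J = (SUP t\<in>{0<..<1}. ennreal (t powr (- \<sigma>) * log_weight b t) * \<omega> t)"
      have "ennreal (log_weight b t) * \<Phi> t \<le> ennreal D * (L + J)" if t: "0 < t" "t < 1" for t
      proof -
        have w0: "0 < log_weight b t" by (simp add: log_weight_def)
        have sup: "ennreal (log_weight b t) * (SUP u\<in>{c * t powr (1 / d)..1/2}. ennreal (u powr (- \<sigma>)) * \<omega> u)
            \<le> ennreal (K powr (- b)) * J"
          unfolding SUP_mult_left_ennreal
        proof (rule SUP_least)
          fix u assume u: "u \<in> {c * t powr (1 / d)..1/2}"
          note sc = scale [of t u]
          \<comment> \<open>Since \<open>b < 0\<close>, the comparison of logarithms lets the weight
            at \<open>t\<close> pass inside the supremum as a weight at \<open>u\<close>, which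
            settles \<open>r = \<infinity>\<close>.\<close>
          have "log_weight b t \<le> K powr (- b) * log_weight b u"
          proof -
            have "(K * (1 + \<bar>ln t\<bar>)) powr b \<le> (1 + \<bar>ln u\<bar>) powr b"
              using sc(1) t u b0 by (intro powr_mono2') (auto simp del: abs_of_nonneg abs_of_neg abs_of_nonpos abs_of_pos)
            then have "K powr b * log_weight b t \<le> log_weight b u"
              using K by (simp add: powr_mult log_weight_def)
            then have "K powr (- b) * (K powr b * log_weight b t) \<le> K powr (- b) * log_weight b u"
              by (rule mult_left_mono) simp
            then show ?thesis using K by (simp flip: mult.assoc powr_add)
          qed
          then have "ennreal (log_weight b t) * (ennreal (u powr (- \<sigma>)) * \<omega> u) \<le>
             ennreal (K powr (- b) * log_weight b u) * (ennreal (u powr (- \<sigma>)) * \<omega> u)"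
            by (intro mult_right_mono ennreal_leI) auto
          also have "\<dots> = ennreal (K powr (- b)) * (ennreal (u powr (- \<sigma>) * log_weight b u) * \<omega> u)"
            by (simp add: ennreal_mult' log_weight_def mult_ac)
          also have "\<dots> \<le> ennreal (K powr (- b)) * J"
            unfolding J_def using sc(2) t u by (intro mult_left_mono SUP_upper) auto
          finally show "ennreal (log_weight b t) * (ennreal (u powr (- \<sigma>)) * \<omega> u) \<le> ennreal (K powr (- b)) * J" .
        qed
        have "ennreal (log_weight b t) * \<Phi> t \<le> ennreal (log_weight b t) * (ennreal C * (L +
         (SUP u\<in>{c * t powr (1 / d)..1/2}. ennreal (u powr (- \<sigma>)) * \<omega> u)))"
          using * [OF t] by (rule mult_left_mono) simp
        also have "\<dots> = ennreal C * (ennreal (log_weight b t) * L + ennreal (log_weight b t) *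
            (SUP u\<in>{c * t powr (1 / d)..1/2}. ennreal (u powr (- \<sigma>)) * \<omega> u))"
          by (simp only: distrib_left mult.left_commute)
        also have "\<dots> \<le> ennreal C * (ennreal (K powr (- b)) * L + ennreal (K powr (- b)) * J)"
          using sup lw1 [OF b0, of t] K1 by (intro mult_left_mono add_mono mult_right_mono ennreal_leI) auto
        also have "\<dots> = ennreal D * (L + J)"
          using C by (simp add: D_def ennreal_mult' distrib_left mult.assoc)
        finally show ?thesis .
      qed
      then show "Lr_dtt r (\<lambda>t. ennreal (log_weight b t) * \<Phi> t) \<le> ennreal D *
         (L + Lr_dtt r (\<lambda>t. ennreal (t powr (- \<sigma>) * log_weight (b + enn2real (1 / r)) t) * \<omega> t))"
        unfolding Lr_dtt_def inv by (auto simp: True J_def intro!: SUP_least)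
    qed
  next
    case False
    define \<rho> where "\<rho> = enn2real r"
    have \<rho>: "0 < \<rho>" using r False by (cases r) (auto simp: \<rho>_def)
    have inv: "enn2real (1 / r) = 1 / \<rho>"
    proof -
      have "r = ennreal \<rho>" using False by (simp add: \<rho>_def less_top)
      then have "1 / r = ennreal (1 / \<rho>)" using \<rho> by (simp add: divide_ennreal flip: ennreal_1)
      then show ?thesis using \<rho> by simp
    qed
    define \<alpha> where "\<alpha> = b * \<rho>"
    have \<alpha>: "\<alpha> < -1" using b \<rho> by (simp add: \<alpha>_def inv field_simps)
    define I where "I = 1 / (- (\<alpha> + 1))"
    \<comment> \<open>The first factor arises when a value at \<open>u\<close> is replaced by the
      integral over \<open>(u, 2u)\<close>, the second from the inner logarithmic integral after
      Tonelli.\<close>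
    define N where "N = 2 powr (\<sigma> * \<rho> + 1) * (K powr (- (\<alpha> + 1)) * I)"
    have I: "0 < I" using \<alpha> by (simp add: I_def)
    have N: "0 < N" using I K by (simp add: N_def)
    define D1 where "D1 = C powr \<rho> * 2 powr \<rho> * (I + N)"
    have D1: "0 < D1" using C I N by (simp add: D1_def add_pos_pos)
    define D where "D = D1 powr (1 / \<rho>) * 2 powr (1 / \<rho>)"
    show ?thesis
    proof (rule that [of D])
      show "0 < D" using D1 by (simp add: D_def)
      fix \<Phi> \<omega> and L :: ennreal
      assume mono: "mono \<omega>" and *: "\<And>t. 0 < t \<Longrightarrow> t < 1 \<Longrightarrow> \<Phi> t \<le> ennreal C * (L +
         (SUP u\<in>{c * t powr (1 / d)..1/2}. ennreal (u powr (- \<sigma>)) * \<omega> u))"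
      define E where "E v = epowr (\<omega> v) \<rho>" for v
      have Emono: "mono E" unfolding E_def using mono \<rho> by (auto simp: mono_def intro: epowr_mono)
      then have [measurable]: "E \<in> borel_measurable borel" by (rule borel_measurable_mono_ennreal)
      define h where "h v = ennreal (v powr (- (\<sigma> * \<rho>)) / v) * E v" for v
      have [measurable]: "h \<in> borel_measurable borel" unfolding h_def by measurable
      define w where "w t = ennreal ((1 + \<bar>ln t\<bar>) powr \<alpha> / t)" for t
      have [measurable]: "w \<in> borel_measurable borel" unfolding w_def by measurable
      define X where "X t = (\<integral>\<^sup>+v\<in>{c * t powr (1 / d)<..<1}. h v \<partial>lborel)" for t
      \<comment> \<open>On \<open>(u, 2u)\<close>, an interval of length \<open>u\<close>, the
        integrand \<open>h\<close> is at least \<open>E u\<close> times its weight at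
        \<open>2 * u\<close>. Because \<open>u \<le> 1/2\<close>, this interval lies in the range of
        integration of \<open>X t\<close>.\<close>
      have X: "epowr (SUP u\<in>{c * t powr (1 / d)..1/2}. ennreal (u powr (- \<sigma>)) * \<omega> u) \<rho> \<le>
          ennreal (2 powr (\<sigma> * \<rho> + 1)) * X t" if t: "0 < t" "t < 1" for t
        unfolding epowr_le_iff [OF \<rho>]
      proof (rule SUP_least)
        fix u assume u: "u \<in> {c * t powr (1 / d)..1/2}"
        have u0: "0 < u" using scale(2) [of t u] t u by auto
        have "ennreal (u powr (- (\<sigma> * \<rho>))) * E u =
          ennreal (2 powr (\<sigma> * \<rho> + 1)) * (ennreal ((2 * u) powr (- (\<sigma> * \<rho>)) / (2 * u)) * E u * ennreal u)"
        proof -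
          have "u powr (- (\<sigma> * \<rho>)) = 2 powr (\<sigma> * \<rho> + 1) * ((2 * u) powr (- (\<sigma> * \<rho>)) / (2 * u)) * u"
            using u0 by (simp add: powr_add powr_mult powr_minus field_simps)
          then have "ennreal (u powr (- (\<sigma> * \<rho>))) =
              ennreal (2 powr (\<sigma> * \<rho> + 1)) * ennreal ((2 * u) powr (- (\<sigma> * \<rho>)) / (2 * u)) * ennreal u"
            using u0 by (simp flip: ennreal_mult')
          then show ?thesis by (simp only: mult_ac)
        qed
        also have "ennreal ((2 * u) powr (- (\<sigma> * \<rho>)) / (2 * u)) * E u * ennreal u =
           (\<integral>\<^sup>+v. (ennreal ((2 * u) powr (- (\<sigma> * \<rho>)) / (2 * u)) * E u) * indicator {u<..<2 * u} v \<partial>lborel)"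
          using u0 by (subst nn_integral_cmult_indicator) auto
        also have "\<dots> \<le> X t"
          unfolding X_def
        proof (rule nn_integral_mono)
          fix v
          show "ennreal ((2 * u) powr (- (\<sigma> * \<rho>)) / (2 * u)) * E u * indicator {u<..<2 * u} v \<le>
             h v * indicator {c * t powr (1 / d)<..<1} v"
          proof (cases "v \<in> {u<..<2 * u}")
            case True
            have "ennreal ((2 * u) powr (- (\<sigma> * \<rho>)) / (2 * u)) * E u \<le> h v"
              unfolding h_def using True u0 \<sigma> \<rho> Emono
              by (intro mult_mono ennreal_leI frac_le powr_mono2') (auto simp: mono_def)
            then show ?thesis using True u by (auto simp: indicator_def)
          qed simp
        qed
        finally have "epowr (ennreal (u powr (- \<sigma>)) * \<omega> u) \<rho> \<le> ennreal (2 powr (\<sigma> * \<rho> + 1)) * X t"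
          using u0 \<rho> by (simp add: epowr_mult_ennreal powr_powr E_def mult_left_mono)
        then show "ennreal (u powr (- \<sigma>)) * \<omega> u \<le> epowr (ennreal (2 powr (\<sigma> * \<rho> + 1)) * X t) (1 / \<rho>)"
          by (simp only: epowr_le_iff [OF \<rho>])
      qed
      define J where "J = (\<integral>\<^sup>+v\<in>{0<..<1}. (epowr (ennreal (v powr (- \<sigma>) * log_weight (b + 1 / \<rho>) v) * \<omega> v) \<rho>
          * ennreal (1 / v)) \<partial>lborel)"
      have wX: "(\<integral>\<^sup>+t\<in>{0<..<1}. (w t * X t) \<partial>lborel) \<le> ennreal (K powr (- (\<alpha> + 1)) * I) * J"
      proof -
        \<comment> \<open>One joint integrand holds all constraints on \<open>t\<close> and
          \<open>v\<close>, so that Tonelli applies as it stands.\<close>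
        let ?ind = "\<lambda>t v. (if 0 < t \<and> t < 1 \<and> c * t powr (1 / d) < v \<and> v < 1 then w t * h v else 0 :: ennreal)"
        have "(\<integral>\<^sup>+t\<in>{0<..<1}. (w t * X t) \<partial>lborel) = (\<integral>\<^sup>+t. (\<integral>\<^sup>+v. ?ind t v \<partial>lborel) \<partial>lborel)"
        proof (rule nn_integral_cong)
          fix t
          show "w t * X t * indicator {0<..<1} t = (\<integral>\<^sup>+v. ?ind t v \<partial>lborel)"
          proof (cases "0 < t \<and> t < 1")
            case True
            then have "(\<integral>\<^sup>+v. ?ind t v \<partial>lborel) = (\<integral>\<^sup>+v. w t * (h v * indicator {c * t powr (1 / d)<..<1} v) \<partial>lborel)"
              by (intro nn_integral_cong) (auto simp: indicator_def)
            also have "\<dots> = w t * X t" unfolding X_def by (rule nn_integral_cmult) measurable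
            finally show ?thesis using True by simp
          qed auto
        qed
        also have "\<dots> = (\<integral>\<^sup>+v. (\<integral>\<^sup>+t. ?ind t v \<partial>lborel) \<partial>lborel)"
          by (rule lborel_pair.Fubini' [symmetric]) measurable
        also have "\<dots> \<le> (\<integral>\<^sup>+v. ennreal (K powr (- (\<alpha> + 1)) * I) *
           (epowr (ennreal (v powr (- \<sigma>) * log_weight (b + 1 / \<rho>) v) * \<omega> v) \<rho> * ennreal (1 / v) * indicator {0<..<1} v) \<partial>lborel)"
        proof (rule nn_integral_mono)
          fix v
          show "(\<integral>\<^sup>+t. ?ind t v \<partial>lborel) \<le> ennreal (K powr (- (\<alpha> + 1)) * I) *
           (epowr (ennreal (v powr (- \<sigma>) * log_weight (b + 1 / \<rho>) v) * \<omega> v) \<rho> * ennreal (1 / v) * indicator {0<..<1} v)"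
          proof (cases "0 < v \<and> v < 1")
            case False
            have "?ind t v = 0" for t
            proof -
              have "0 \<le> c * t powr (1 / d)" using c by simp
              with False show ?thesis by auto
            qed
            then show ?thesis by simp
          next
            case True
            \<comment> \<open>For fixed \<open>v\<close> the constraint
              \<open>c * t powr (1 / d) < v\<close> reads \<open>t < (v / c) powr d\<close>;
              \<open>T\<close> combines this with \<open>t < 1\<close>.\<close>
            define T where "T = min 1 ((v / c) powr d)"
            have T: "0 < T" "T \<le> 1" using True c by (auto simp: T_def)
            have Tv: "c * T powr (1 / d) \<le> v"
            proof -
              have "T powr (1 / d) \<le> ((v / c) powr d) powr (1 / d)"
                using T d by (intro powr_mono2) (auto simp: T_def)
              also have "\<dots> = v / c" using True c d by (simp add: powr_powr)
              finally show ?thesis using c by (simp add: field_simps)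
            qed
            have lt: "t < (v / c) powr d" if "0 < t" "c * t powr (1 / d) < v" for t
            proof -
              have "t powr (1 / d) < v / c" using that c by (simp add: field_simps)
              then have "(t powr (1 / d)) powr d < (v / c) powr d"
                using d by (intro powr_less_mono2) auto
              then show ?thesis using that d by (simp add: powr_powr)
            qed
            have "(\<integral>\<^sup>+t. ?ind t v \<partial>lborel) \<le> (\<integral>\<^sup>+t. h v * (w t * indicator {0<..<T} t) \<partial>lborel)"
              by (intro nn_integral_mono) (auto simp: indicator_def mult.commute T_def dest: lt)
            also have "\<dots> = h v * (\<integral>\<^sup>+t\<in>{0<..<T}. w t \<partial>lborel)"
              by (rule nn_integral_cmult) measurable
            also have "\<dots> \<le> h v * ennreal (K powr (- (\<alpha> + 1)) * I * (1 + \<bar>ln v\<bar>) powr (\<alpha> + 1))"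
            proof (rule mult_left_mono)
              have "(\<integral>\<^sup>+t\<in>{0<..<T}. w t \<partial>lborel) \<le> ennreal ((1 - ln T) powr (\<alpha> + 1) * I)"
                unfolding w_def I_def using nn_integral_log_power_le [OF \<alpha> T] by simp
              \<comment> \<open>The exponent is negative, so the lower bound for
                \<open>1 - ln T\<close> from the change of scale becomes an upper bound.\<close>
              also have "(1 - ln T) powr (\<alpha> + 1) \<le> ((1 + \<bar>ln v\<bar>) / K) powr (\<alpha> + 1)"
              proof (rule powr_mono2')
                have "ln T \<le> 0" using T by simp
                then show "(1 + \<bar>ln v\<bar>) / K \<le> 1 - ln T"
                  using scale(1) [OF T Tv] True K by (simp add: field_simps)
              qed (use \<alpha> K in auto)
              also have "((1 + \<bar>ln v\<bar>) / K) powr (\<alpha> + 1) = K powr (- (\<alpha> + 1)) * (1 + \<bar>ln v\<bar>) powr (\<alpha> + 1)"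
                using K by (simp add: powr_divide powr_minus_divide del: minus_add_distrib)
              finally show "(\<integral>\<^sup>+t\<in>{0<..<T}. w t \<partial>lborel) \<le>
                  ennreal (K powr (- (\<alpha> + 1)) * I * (1 + \<bar>ln v\<bar>) powr (\<alpha> + 1))"
                using I by (simp add: mult_ac ennreal_leI mult_left_mono)
            qed simp
            also have "\<dots> = ennreal (K powr (- (\<alpha> + 1)) * I) *
               (epowr (ennreal (v powr (- \<sigma>) * log_weight (b + 1 / \<rho>) v) * \<omega> v) \<rho> * ennreal (1 / v) * indicator {0<..<1} v)"
            proof -
              have lw: "0 < log_weight (b + 1 / \<rho>) v" by (simp add: log_weight_def)
              \<comment> \<open>The identity \<open>(b + 1 / \<rho>) * \<rho> = \<alpha> + 1\<close>
                matches the gained logarithm with the shift from \<open>b\<close> to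
                \<open>b + 1/r\<close> in the Besov weight.\<close>
              have "(v powr (- \<sigma>) * log_weight (b + 1 / \<rho>) v) powr \<rho> = v powr (- (\<sigma> * \<rho>)) * (1 + \<bar>ln v\<bar>) powr (\<alpha> + 1)"
                using \<rho> by (simp add: log_weight_def powr_mult powr_powr \<alpha>_def distrib_right)
              then have "epowr (ennreal (v powr (- \<sigma>) * log_weight (b + 1 / \<rho>) v) * \<omega> v) \<rho> =
                  ennreal (v powr (- (\<sigma> * \<rho>))) * ennreal ((1 + \<bar>ln v\<bar>) powr (\<alpha> + 1)) * E v"
                using lw True \<rho> by (subst epowr_mult_ennreal) (auto simp: E_def ennreal_mult')
              moreover have "h v = ennreal (v powr (- (\<sigma> * \<rho>))) * ennreal (1 / v) * E v"
                using True by (simp add: h_def flip: ennreal_mult')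
              ultimately show ?thesis
                using True I by (simp add: ennreal_mult' mult_ac)
            qed
            finally show ?thesis .
          qed
        qed
        also have "\<dots> = ennreal (K powr (- (\<alpha> + 1)) * I) * J"
        proof -
          have "(\<lambda>v. epowr (ennreal (v powr (- \<sigma>) * log_weight (b + 1 / \<rho>) v) * \<omega> v) \<rho> * ennreal (1 / v) * indicator {0<..<1} v)
             = (\<lambda>v. ennreal ((v powr (- \<sigma>) * log_weight (b + 1 / \<rho>) v) powr \<rho> / v) * E v * indicator {0<..<1::real} v)"
          proof
            fix v
            show "epowr (ennreal (v powr (- \<sigma>) * log_weight (b + 1 / \<rho>) v) * \<omega> v) \<rho> * ennreal (1 / v) * indicator {0<..<1} v
              = ennreal ((v powr (- \<sigma>) * log_weight (b + 1 / \<rho>) v) powr \<rho> / v) * E v * indicator {0<..<1} v"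
            proof (cases "v \<in> {0<..<1}")
              case True
              have lw: "0 < v powr (- \<sigma>) * log_weight (b + 1 / \<rho>) v" using True log_weight_pos by simp
              then have "epowr (ennreal (v powr (- \<sigma>) * log_weight (b + 1 / \<rho>) v) * \<omega> v) \<rho> * ennreal (1 / v) =
                ennreal ((v powr (- \<sigma>) * log_weight (b + 1 / \<rho>) v) powr \<rho>) * ennreal (1 / v) * E v"
                by (subst epowr_mult_ennreal [OF lw \<rho>]) (simp only: E_def mult_ac)
              then show ?thesis using True by (simp flip: ennreal_mult')
            qed simp
          qed
          moreover have "(\<lambda>v. ennreal ((v powr (- \<sigma>) * log_weight (b + 1 / \<rho>) v) powr \<rho> / v) * E v * indicator {0<..<1::real} v)
             \<in> borel_measurable lborel"
            unfolding log_weight_def by measurable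
          ultimately show ?thesis
            unfolding J_def by (intro nn_integral_cmult) simp
        qed
        finally show ?thesis .
      qed
      have wI: "(\<integral>\<^sup>+t\<in>{0<..<1}. w t \<partial>lborel) \<le> ennreal I"
        using nn_integral_log_power_le [OF \<alpha>, of 1] by (simp add: w_def I_def)
      have "(\<integral>\<^sup>+t\<in>{0<..<1}. (epowr (ennreal (log_weight b t) * \<Phi> t) \<rho> * ennreal (1 / t)) \<partial>lborel) \<le>
         (\<integral>\<^sup>+t. ennreal (C powr \<rho> * 2 powr \<rho>) * (epowr L \<rho> * (w t * indicator {0<..<1} t) +
            ennreal (2 powr (\<sigma> * \<rho> + 1)) * (w t * X t * indicator {0<..<1} t)) \<partial>lborel)"
      proof (rule nn_integral_mono)
        fix t
        show "epowr (ennreal (log_weight b t) * \<Phi> t) \<rho> * ennreal (1 / t) * indicator {0<..<1} t \<le>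
          ennreal (C powr \<rho> * 2 powr \<rho>) * (epowr L \<rho> * (w t * indicator {0<..<1} t) +
            ennreal (2 powr (\<sigma> * \<rho> + 1)) * (w t * X t * indicator {0<..<1} t))"
        proof (cases "t \<in> {0<..<1}")
          case True
          then have t: "0 < t" "t < 1" by auto
          let ?S = "SUP u\<in>{c * t powr (1 / d)..1/2}. ennreal (u powr (- \<sigma>)) * \<omega> u"
          have "epowr (\<Phi> t) \<rho> \<le> epowr (ennreal C * (L + ?S)) \<rho>"
            using \<rho> by (intro epowr_mono * t)
          also have "\<dots> = ennreal (C powr \<rho>) * epowr (L + ?S) \<rho>"
            using C \<rho> by (rule epowr_mult_ennreal)
          also have "\<dots> \<le> ennreal (C powr \<rho>) * (ennreal (2 powr \<rho>) * (epowr L \<rho> + epowr ?S \<rho>))"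
            using \<rho> by (intro mult_left_mono epowr_add_le) auto
          also have "\<dots> \<le> ennreal (C powr \<rho>) * (ennreal (2 powr \<rho>) * (epowr L \<rho> + ennreal (2 powr (\<sigma> * \<rho> + 1)) * X t))"
            by (intro mult_left_mono add_left_mono X t) auto
          finally have "epowr (\<Phi> t) \<rho> \<le> ennreal (C powr \<rho> * 2 powr \<rho>) * (epowr L \<rho> + ennreal (2 powr (\<sigma> * \<rho> + 1)) * X t)"
            by (simp add: ennreal_mult' mult.assoc)
          then have "w t * epowr (\<Phi> t) \<rho> \<le>
              w t * (ennreal (C powr \<rho> * 2 powr \<rho>) * (epowr L \<rho> + ennreal (2 powr (\<sigma> * \<rho> + 1)) * X t))"
            by (rule mult_left_mono) simp
          moreover have "epowr (ennreal (log_weight b t) * \<Phi> t) \<rho> * ennreal (1 / t) = w t * epowr (\<Phi> t) \<rho>"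
          proof -
            have "epowr (ennreal (log_weight b t) * \<Phi> t) \<rho> = ennreal (log_weight b t powr \<rho>) * epowr (\<Phi> t) \<rho>"
              using \<rho> by (intro epowr_mult_ennreal) (auto simp: log_weight_def)
            moreover have "w t = ennreal (log_weight b t powr \<rho>) * ennreal (1 / t)"
              by (simp add: w_def log_weight_def powr_powr \<alpha>_def flip: ennreal_mult')
            ultimately show ?thesis by (simp only: mult_ac)
          qed
          ultimately show ?thesis
            using True by (simp add: distrib_left mult_ac)
        qed simp
      qed
      also have "\<dots> = ennreal (C powr \<rho> * 2 powr \<rho>) * (epowr L \<rho> * (\<integral>\<^sup>+t\<in>{0<..<1}. w t \<partial>lborel) +
            ennreal (2 powr (\<sigma> * \<rho> + 1)) * (\<integral>\<^sup>+t\<in>{0<..<1}. (w t * X t) \<partial>lborel))"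
      proof -
        have [measurable]: "X \<in> borel_measurable borel"
        proof -
          have "(\<lambda>t. \<integral>\<^sup>+v. (if c * t powr (1 / d) < v \<and> v < 1 then h v else 0) \<partial>lborel) \<in> borel_measurable borel"
            by measurable
          moreover have "X = (\<lambda>t. \<integral>\<^sup>+v. (if c * t powr (1 / d) < v \<and> v < 1 then h v else 0) \<partial>lborel)"
            unfolding X_def by (intro ext nn_integral_cong) (auto simp: indicator_def)
          ultimately show ?thesis by simp
        qed
        show ?thesis
          by (subst nn_integral_cmult, measurable, subst nn_integral_add, measurable,
              subst nn_integral_cmult, measurable, subst nn_integral_cmult, measurable)
      qed
      also have "\<dots> \<le> ennreal (C powr \<rho> * 2 powr \<rho>) * (epowr L \<rho> * ennreal I +
            ennreal (2 powr (\<sigma> * \<rho> + 1)) * (ennreal (K powr (- (\<alpha> + 1)) * I) * J))"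
        by (intro mult_left_mono add_mono wI wX) auto
      also have "\<dots> = ennreal (C powr \<rho> * 2 powr \<rho>) * (ennreal I * epowr L \<rho> + ennreal N * J)"
      proof -
        have "ennreal N = ennreal (2 powr (\<sigma> * \<rho> + 1)) * ennreal (K powr (- (\<alpha> + 1)) * I)"
          unfolding N_def by (rule ennreal_mult') simp
        then show ?thesis by (simp only: mult_ac)
      qed
      also have "\<dots> \<le> ennreal (C powr \<rho> * 2 powr \<rho>) * (ennreal (I + N) * epowr L \<rho> + ennreal (I + N) * J)"
        using I N by (intro mult_left_mono add_mono mult_right_mono ennreal_leI) auto
      also have "\<dots> = ennreal D1 * (epowr L \<rho> + J)"
      proof -
        have "ennreal D1 = ennreal (C powr \<rho> * 2 powr \<rho>) * ennreal (I + N)"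
          unfolding D1_def by (rule ennreal_mult') simp
        then show ?thesis by (simp only: distrib_left mult.assoc)
      qed
      finally have "epowr (\<integral>\<^sup>+t\<in>{0<..<1}. (epowr (ennreal (log_weight b t) * \<Phi> t) \<rho> * ennreal (1 / t)) \<partial>lborel) (1 / \<rho>) \<le>
          epowr (ennreal D1 * (epowr L \<rho> + J)) (1 / \<rho>)"
        using \<rho> by (intro epowr_mono) auto
      also have "\<dots> = ennreal (D1 powr (1 / \<rho>)) * epowr (epowr L \<rho> + J) (1 / \<rho>)"
        using D1 \<rho> by (intro epowr_mult_ennreal) auto
      also have "\<dots> \<le> ennreal (D1 powr (1 / \<rho>)) * (ennreal (2 powr (1 / \<rho>)) * (epowr (epowr L \<rho>) (1 / \<rho>) + epowr J (1 / \<rho>)))"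
        using \<rho> by (intro mult_left_mono epowr_add_le) auto
      also have "\<dots> = ennreal D * (L + epowr J (1 / \<rho>))"
        using \<rho> by (simp add: D_def epowr_epowr ennreal_mult' mult.assoc)
      finally show "Lr_dtt r (\<lambda>t. ennreal (log_weight b t) * \<Phi> t) \<le> ennreal D *
         (L + Lr_dtt r (\<lambda>t. ennreal (t powr (- \<sigma>) * log_weight (b + enn2real (1 / r)) t) * \<omega> t))"
        using False by (simp add: Lr_dtt_def J_def inv flip: \<rho>_def)
    qed
  qed
qed

section \<open>Assembling the estimates\<close>

lemma mono_modulus: "mono (modulus Q0 k p q f)"
  unfolding modulus_def by (rule monoI) (rule SUP_subset_mono, auto)

text \<open>The Hardy inequality is applied with the rearrangement of the sharp function as
  \<open>\<Phi>\<close>, the modulus as \<open>\<omega>\<close>, the Lorentz norm of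
  \<open>f\<close> as \<open>L\<close>, and \<open>\<sigma> = DIM('a) / p\<close>.\<close>

lemma sharp_max_besov_bound:
  fixes Q0 :: "'a::euclidean_space set"
  assumes "cube Q0" and p: "1 < p" and q: "0 < q" and r: "0 < r" and "0 < k"
    and b: "b < - enn2real (1 / r)"
  shows "\<exists>C>0. \<forall>f::'a \<Rightarrow> 'b::euclidean_space.
    f \<in> besov_space Q0 k (DIM('a) / p) (b + enn2real (1 / r)) r p q \<longrightarrow>
    log_norm Q0 r b (sharp_max Q0 f)
      \<le> ennreal C * besov_norm Q0 k (DIM('a) / p) (b + enn2real (1 / r)) r p q f"
proof (rule sharp_max_bound [where ?'b = 'b, OF assms(1) p q \<open>0 < k\<close>], goal_cases)
  case (1 C c)
  have d: "1 \<le> real DIM('a)" by (simp add: DIM_positive Suc_le_eq)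
  have \<sigma>: "0 < real DIM('a) / p" using p by simp
  show ?case
  proof (rule Lr_dtt_sup_bound [OF r b \<sigma> d 1(2,3,1)], goal_cases)
    case D: (1 D)
    have "log_norm Q0 r b (sharp_max Q0 f)
      \<le> ennreal D * besov_norm Q0 k (DIM('a) / p) (b + enn2real (1 / r)) r p q f"
      if "f \<in> besov_space Q0 k (DIM('a) / p) (b + enn2real (1 / r)) r p q" for f :: "'a \<Rightarrow> 'b"
    proof -
      have f: "f \<in> lorentz_space Q0 p q" using that by (simp add: besov_space_def)
      show ?thesis
        unfolding log_norm_def besov_norm_def
        by (rule D(2) [OF mono_modulus 1(4) [OF f]])
    qed
    with D(1) show ?case by blast
  qed
qed

theorem corollary3p3:
  fixes Q0 :: "'a::euclidean_space set"
    and p b :: real and q r :: ennreal and k :: nat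
  assumes "cube Q0"
    and "1 < p"
    and "0 < q" and "0 < r"
    and "real k > real DIM('a) / p"
    and "b < - enn2real (1 / r)"
  shows "(\<exists>C>0. \<forall>f::'a \<Rightarrow> 'b::{real_normed_field, euclidean_space}.
            f \<in> besov_space Q0 k (DIM('a) / p) (b + enn2real (1 / r)) r p q \<longrightarrow>
            log_norm Q0 r b (sharp_max Q0 f)
              \<le> ennreal C * besov_norm Q0 k (DIM('a) / p) (b + enn2real (1 / r)) r p q f)
       \<and> (\<exists>C>0. \<forall>f::'a \<Rightarrow> 'b.
            f \<in> besov_pr_space Q0 k (DIM('a) / p) (b + enn2real (1 / r)) p r \<longrightarrow>
            log_norm Q0 r b (sharp_max Q0 f)
              \<le> ennreal C * besov_pr_norm Q0 k (DIM('a) / p) (b + enn2real (1 / r)) p r f)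
       \<and> (\<forall>lam>0. \<exists>C>0. \<forall>f::'a \<Rightarrow> 'b.
            f \<in> besov_pr_space Q0 k (DIM('a) / p) (- 1 / lam) p \<infinity> \<longrightarrow>
            exp_norm Q0 lam (sharp_max Q0 f)
              \<le> ennreal C * besov_pr_norm Q0 k (DIM('a) / p) (- 1 / lam) p \<infinity> f)"
proof (intro conjI allI impI)
  have "0 < real DIM('a) / p" using assms(2) by simp
  then have "0 < real k" using assms(5) by linarith
  then have k: "0 < k" by simp
  have p: "0 < ennreal p" using assms(2) by simp
  show "\<exists>C>0. \<forall>f::'a \<Rightarrow> 'b.
      f \<in> besov_space Q0 k (DIM('a) / p) (b + enn2real (1 / r)) r p q \<longrightarrow>
      log_norm Q0 r b (sharp_max Q0 f)
        \<le> ennreal C * besov_norm Q0 k (DIM('a) / p) (b + enn2real (1 / r)) r p q f"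
    by (rule sharp_max_besov_bound [OF assms(1-4) k assms(6)])
  show "\<exists>C>0. \<forall>f::'a \<Rightarrow> 'b.
      f \<in> besov_pr_space Q0 k (DIM('a) / p) (b + enn2real (1 / r)) p r \<longrightarrow>
      log_norm Q0 r b (sharp_max Q0 f)
        \<le> ennreal C * besov_pr_norm Q0 k (DIM('a) / p) (b + enn2real (1 / r)) p r f"
    unfolding besov_pr_space_def besov_pr_norm_def
    by (rule sharp_max_besov_bound [OF assms(1,2) p assms(4) k assms(6)])
  fix lam :: real assume lam: "0 < lam"
  \<comment> \<open>The exponential class is the case \<open>r = \<infinity>\<close>,
    \<open>b = - 1 / lam\<close>; there \<open>1 / r\<close> is 0 and the weight exponent of the
    Besov norm is \<open>b\<close> itself.\<close>
  have "- 1 / lam < - enn2real (1 / \<infinity>)" using lam by simp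
  from sharp_max_besov_bound [OF assms(1,2) p _ k this, where ?'b = 'b]
  show "\<exists>C>0. \<forall>f::'a \<Rightarrow> 'b.
      f \<in> besov_pr_space Q0 k (DIM('a) / p) (- 1 / lam) p \<infinity> \<longrightarrow>
      exp_norm Q0 lam (sharp_max Q0 f)
        \<le> ennreal C * besov_pr_norm Q0 k (DIM('a) / p) (- 1 / lam) p \<infinity> f"
    by (simp add: besov_pr_space_def besov_pr_norm_def exp_norm_def)
qed

end
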